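(* Assume that the mappings $(x,\theta)\mapsto\frac{\partial}{\partial x}F_i(x,\theta)$ are continuous for every $i=0,\dots,k$, as well as the gradient $(x,\theta)\mapsto\nabla_x a(x,\theta)$. Let $\bar u\in\mathcal{U}$ be a local minimizer (with respect to the $L^2$ norm) of the functional $\mathcal{F}:\mathcal{U}\to\mathbb{R}_+$, $$\mathcal{F}(u)=\int_\Theta a(x_u^\theta(1),\theta)\,d\mu(\theta)+\frac{\beta}{2}\|u\|_{L^2}^2 .$$ Let $X_{\bar u}:[0,1]\times\Theta\to\mathbb{R}^n$, $X_{\bar u}(t,\theta)=x_{\bar u}^\theta(t)$, and let $\Lambda_{\bar u}:[0,1]\times\Theta\to(\mathbb{R}^n)^*$ be the map such that, for every $\theta\in\Theta$, $t\mapsto\Lambda_{\bar u}(t,\theta)$ is the absolutely continuous solution of $$\begin{cases}\partial_t\Lambda_{\bar u}(t,\theta)=-\Lambda_{\bar u}(t,\theta)\left(\frac{\partial F_0(X_{\bar u}(t,\theta),\theta)}{\partial x}+\sum_{i=1}^k\bar u_i(t)\frac{\partial F_i(X_{\bar u}(t,\theta),\theta)}{\partial x}\right)&\text{for a.e. }t\in[0,1],\\ \Lambda_{\bar u}(1,\theta)=\nabla_x a(X_{\bar u}(1,\theta),\theta).\end{cases}$$ Then $$\bar u(t)\in\arg\max_{v\in\mathbb{R}^k}\left\{\int_\Theta-\Lambda_{\bar u}(t,\theta)\cdot F(X_{\bar u}(t,\theta),\theta)\cdot v\,d\mu(\theta)-\frac{\beta}{2}|v|_2^2\right\}$$ for a.e.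 $t\in[0,1]$.
   Context: Let $n,k\ge 1$ and let $\Theta$ be a compact subset of a finite-dimensional Euclidean space. Let $F_0:\mathbb{R}^n\times\Theta\to\mathbb{R}^n$ and $F=(F_1,\dots,F_k):\mathbb{R}^n\times\Theta\to\mathbb{R}^{n\times k}$ ($F_i$ is the $i$-th column of $F$) be such that, for some $L>0$, $|F_i(x_1,\theta_1)-F_i(x_2,\theta_2)|_2\le L(|x_1-x_2|_2+|\theta_1-\theta_2|_2)$ for all $i=0,\dots,k$ and all $(x_1,\theta_1),(x_2,\theta_2)\in\mathbb{R}^n\times\Theta$. Let $x_0:\Theta\to\mathbb{R}^n$ be continuous. Set $\mathcal{U}:=L^2([0,1],\mathbb{R}^k)$. For $u\in\mathcal{U}$ and $\theta\in\Theta$, $x_u^\theta:[0,1]\to\mathbb{R}^n$ is the unique absolutely continuous solution of $\dot x(t)=F_0(x(t),\theta)+F(x(t),\theta)u(t)$ for a.e. $t\in[0,1]$, $x(0)=x_0(\theta)$. The function $a:\mathbb{R}^n\times\Theta\to\mathbb{R}_+$ is continuous, non-negative and differentiable in $x$; $\beta>0$; $\mu$ is a Borel probability measure on $\Theta$. Elements of $(\mathbb{R}^n)^*$ are row vectors, and $\nabla_x a$ is regarded as a row vector. *)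

theory Defs
  imports "HOL-Probability.Probability"
begin

text \<open>
  Elements of L2([0,1], R^k) are represented by functions on the whole real line; only their
  restriction to [0,1] (up to null sets) matters below. An n x k matrix has type
  \<open>real^'k^'n\<close>, so the i-th control field is \<open>column i (F x \<theta>)\<close>; row vectors are
  elements of \<open>real^'n\<close> that multiply matrices from the left through \<open>v*\<close>.
\<close>

definition L2_controls :: "(real \<Rightarrow> real^'k) set" where
  "L2_controls = {u. u \<in> borel_measurable (lebesgue_on {0..1}) \<and>
                     integrable (lebesgue_on {0..1}) (\<lambda>t. (norm (u t))\<^sup>2)}"

definition L2_norm :: "(real \<Rightarrow> real^'k) \<Rightarrow> real" where
  "L2_norm u = sqrt (\<integral>t. (norm (u t))\<^sup>2 \<partial>lebesgue_on {0..1})"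

definition L2_local_minimizer :: "((real \<Rightarrow> real^'k) \<Rightarrow> real) \<Rightarrow> (real \<Rightarrow> real^'k) \<Rightarrow> bool" where
  "L2_local_minimizer J u \<longleftrightarrow> u \<in> L2_controls \<and>
     (\<exists>r>0. \<forall>w\<in>L2_controls. L2_norm (\<lambda>t. w t - u t) < r \<longrightarrow> J u \<le> J w)"

definition abs_continuous_on :: "real \<Rightarrow> real \<Rightarrow> (real \<Rightarrow> 'a::real_normed_vector) \<Rightarrow> bool" where
  "abs_continuous_on a b f \<longleftrightarrow>
     (\<forall>\<epsilon>>0. \<exists>\<delta>>0. \<forall>D. finite D \<and> (\<forall>(s,t)\<in>D. a \<le> s \<and> s \<le> t \<and> t \<le> b) \<and>
         disjoint_family_on (\<lambda>(s,t). {s<..<t}) D \<and> (\<Sum>(s,t)\<in>D. t - s) < \<delta>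
         \<longrightarrow> (\<Sum>(s,t)\<in>D. norm (f t - f s)) < \<epsilon>)"

text \<open>\<open>x\<close> is a Caratheodory solution on [0,1] of x' = F0(x,\<theta>) + F(x,\<theta>) u, x(0) = x0(\<theta>).\<close>

definition state_solution ::
  "(real^'n \<Rightarrow> 'p \<Rightarrow> real^'n) \<Rightarrow> (real^'n \<Rightarrow> 'p \<Rightarrow> real^'k^'n) \<Rightarrow> ('p \<Rightarrow> real^'n) \<Rightarrow>
   (real \<Rightarrow> real^'k) \<Rightarrow> 'p \<Rightarrow> (real \<Rightarrow> real^'n) \<Rightarrow> bool" where
  "state_solution F0 F x0 u \<theta> x \<longleftrightarrow>
     abs_continuous_on 0 1 x \<and> x 0 = x0 \<theta> \<and>
     (AE t in lebesgue_on {0..1}.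
        (x has_vector_derivative (F0 (x t) \<theta> + F (x t) \<theta> *v u t)) (at t within {0..1}))"

text \<open>
  Under the Lipschitz assumptions of the theorem, a solution exists for every square integrable
  control and any two solutions coincide on [0,1]; values outside [0,1] are irrelevant. Hence the
  choice below determines the trajectory on [0,1] uniquely.
\<close>

definition trajectory ::
  "(real^'n \<Rightarrow> 'p \<Rightarrow> real^'n) \<Rightarrow> (real^'n \<Rightarrow> 'p \<Rightarrow> real^'k^'n) \<Rightarrow> ('p \<Rightarrow> real^'n) \<Rightarrow>
   (real \<Rightarrow> real^'k) \<Rightarrow> 'p \<Rightarrow> real \<Rightarrow> real^'n" where
  "trajectory F0 F x0 u \<theta> = (SOME x. state_solution F0 F x0 u \<theta> x)"

definition cost ::
  "(real^'n \<Rightarrow> 'p \<Rightarrow> real^'n) \<Rightarrow> (real^'n \<Rightarrow> 'p \<Rightarrow> real^'k^'n) \<Rightarrow> ('p \<Rightarrow> real^'n) \<Rightarrow>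
   (real^'n \<Rightarrow> 'p \<Rightarrow> real) \<Rightarrow> real \<Rightarrow> 'p measure \<Rightarrow> (real \<Rightarrow> real^'k) \<Rightarrow> real" where
  "cost F0 F x0 a \<beta> \<mu> u =
     (\<integral>\<theta>. a (trajectory F0 F x0 u \<theta> 1) \<theta> \<partial>\<mu>) + \<beta> / 2 * (L2_norm u)\<^sup>2"

definition gradient :: "(real^'n \<Rightarrow> real) \<Rightarrow> real^'n \<Rightarrow> real^'n" where
  "gradient f x = (\<chi> i. frechet_derivative f (at x) (axis i 1))"

end

theory Submission
  imports Defs
begin

text \<open>
  The running cost is quadratic and the dynamics are affine in the control, so the maximum condition
  at time \<open>t\<close> is equivalent to \<open>\<integral> \<Lambda> F(X) d\<mu> + \<beta> u(t) = 0\<close>.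
  Perturb the minimizer to \<open>u + \<epsilon> v\<close> with \<open>v\<close> bounded. By Gronwall the
  trajectories move by at most \<open>C \<epsilon>\<close>, uniformly in time and parameter. The derivative of
  \<open>\<Lambda> \<bullet> (x\<^sub>\<epsilon> - X)\<close> contains no linear term in \<open>x\<^sub>\<epsilon> - X\<close>, so integrating it and dividing
  by \<open>\<epsilon>\<close> gives the first variation \<open>\<integral> \<integral> \<Lambda> F(X) v dt d\<mu> + \<beta> \<integral> u v dt \<ge> 0\<close> by
  dominated convergence, without solving the linearised equation. After Fubini, where joint
  continuity of \<open>X\<close> and \<open>\<Lambda>\<close> is needed, this reads \<open>\<integral> g v dt \<ge> 0\<close> with
  \<open>g = \<integral> \<Lambda> F(X) d\<mu> + \<beta> u\<close>, and \<open>v = - g / (1 + |g|)\<close> forces \<open>g = 0\<close> almost everywhere.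
\<close>

section \<open>Absolutely continuous functions\<close>

text \<open>Controls are only square integrable, so the dynamics have a Lipschitz modulus that is
  integrable but possibly unbounded in time, and derivatives exist almost everywhere only. Hence the
  calculus of absolutely continuous functions, and Gronwall and Picard arguments with an integrable
  coefficient \<open>m\<close>. Both use the weight \<open>exp (2 * \<integral> m)\<close>: its
  product with \<open>m\<close> integrates to half its increment, and this half absorbs the unknown.
  The linear term cancels because the adjoint matrix is the Jacobian of the dynamics along
  \<open>X\<close>. What remains is a Taylor remainder, of smaller order than \<epsilon> since the
  state change is of order \<epsilon>; the quotients of the state change by \<epsilon> need not
  converge. Bounded directions keep the moduli of all perturbed controls below one integrable
  function, which makes the constant \<open>C\<close> uniform. The Jacobians are merely continuous,
  so the adjoint has no Lipschitz bound in the parameter. Its continuity comes from convergence of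
  the matrices in the mean over time and a Gronwall estimate run backward from the terminal
  value.\<close>

lemma sum_integral_disjoint_intervals_le:
  fixes g :: "real \<Rightarrow> real"
  assumes D: "finite D" "\<And>s t. (s,t) \<in> D \<Longrightarrow> s \<le> t" "disjoint_family_on (\<lambda>(s,t). {s<..<t}) D"
    and g: "g integrable_on S" "\<And>x. x \<in> S \<Longrightarrow> 0 \<le> g x" and sub: "\<And>s t. (s,t) \<in> D \<Longrightarrow> {s..t} \<subseteq> S"
  shows "(\<Sum>(s,t)\<in>D. integral {s..t} g) \<le> integral S g"
proof -
  let ?T = "\<lambda>(s,t). {s..t::real}"
  have int: "(g has_integral (case p of (s,t) \<Rightarrow> integral {s..t} g)) (?T p)" if "p \<in> D" for p
    using that sub g(1) by (auto split: prod.split intro!: integrable_integral integrable_on_subinterval)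
  \<comment> \<open>Only the open intervals are disjoint. The closed ones may share endpoints, and a
    degenerate one may lie inside another, so the overlap is contained in four points.\<close>
  have neg: "pairwise (\<lambda>i i'. negligible (?T i \<inter> ?T i')) D"
  proof (rule pairwiseI)
    fix p q assume pq: "p \<in> D" "q \<in> D" "p \<noteq> q"
    obtain s t s' t' where e: "p = (s,t)" "q = (s',t')" by (metis surj_pair)
    have "{s<..<t} \<inter> {s'<..<t'} = {}"
      using D(3)[unfolded disjoint_family_on_def, rule_format, OF pq] e by simp
    moreover have "x \<in> {s<..<t} \<inter> {s'<..<t'}" if "x \<in> ?T p \<inter> ?T q" "x \<notin> {s,t,s',t'}" for x
      using that unfolding e by simp
    ultimately have "?T p \<inter> ?T q \<subseteq> {s,t,s',t'}" by blast
    then show "negligible (?T p \<inter> ?T q)"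
      by (meson finite.emptyI finite.insertI negligible_finite negligible_subset)
  qed
  have *: "(g has_integral (\<Sum>(s,t)\<in>D. integral {s..t} g)) (\<Union>p\<in>D. ?T p)"
    by (rule has_integral_UN[OF D(1) int neg])
  have "(\<Sum>(s,t)\<in>D. integral {s..t} g) = integral (\<Union>p\<in>D. ?T p) g"
    using integral_unique[OF *] by simp
  also have "\<dots> \<le> integral S g"
    using sub g * by (intro integral_subset_le) auto
  finally show ?thesis .
qed

lemma abs_continuous_onD:
  assumes "abs_continuous_on a b f" "\<epsilon> > 0"
  obtains \<delta> where "\<delta> > 0"
    "\<And>D. finite D \<Longrightarrow> (\<And>s t. (s,t) \<in> D \<Longrightarrow> a \<le> s \<and> s \<le> t \<and> t \<le> b) \<Longrightarrow>
       disjoint_family_on (\<lambda>(s,t). {s<..<t}) D \<Longrightarrow> (\<Sum>(s,t)\<in>D. t - s) < \<delta>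
       \<Longrightarrow> (\<Sum>(s,t)\<in>D. norm (f t - f s)) < \<epsilon>"
proof -
  obtain \<delta> where d: "\<delta> > 0" "\<forall>D. finite D \<and> (\<forall>(s,t)\<in>D. a \<le> s \<and> s \<le> t \<and> t \<le> b) \<and>
         disjoint_family_on (\<lambda>(s,t). {s<..<t}) D \<and> (\<Sum>(s,t)\<in>D. t - s) < \<delta>
         \<longrightarrow> (\<Sum>(s,t)\<in>D. norm (f t - f s)) < \<epsilon>"
    using assms unfolding abs_continuous_on_def by blast
  show ?thesis
    by (rule that[OF d(1)]) (use d(2) in blast)
qed

lemma abs_continuous_on_imp_continuous_on:
  assumes "abs_continuous_on a b f"
  shows "continuous_on {a..b} f"
  unfolding continuous_on_iff
proof (intro ballI allI impI)
  fix x \<epsilon> :: real assume x: "x \<in> {a..b}" and "\<epsilon> > 0"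
  obtain \<delta> where \<delta>: "\<delta> > 0"
    "\<And>D. finite D \<Longrightarrow> (\<And>s t. (s,t) \<in> D \<Longrightarrow> a \<le> s \<and> s \<le> t \<and> t \<le> b) \<Longrightarrow>
       disjoint_family_on (\<lambda>(s,t). {s<..<t}) D \<Longrightarrow> (\<Sum>(s,t)\<in>D. t - s) < \<delta>
       \<Longrightarrow> (\<Sum>(s,t)\<in>D. norm (f t - f s)) < \<epsilon>"
    using abs_continuous_onD[OF assms \<open>\<epsilon> > 0\<close>] by blast
  have "dist (f y) (f x) < \<epsilon>" if y: "y \<in> {a..b}" "dist y x < \<delta>" for y
  proof -
    have "(\<Sum>(s,t)\<in>{(min x y, max x y)}. norm (f t - f s)) < \<epsilon>"
      by (rule \<delta>(2)) (use x y in \<open>auto simp: disjoint_family_on_def dist_real_def\<close>)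
    then show ?thesis
      by (cases "x \<le> y") (auto simp: dist_norm norm_minus_commute)
  qed
  then show "\<exists>d>0. \<forall>x'\<in>{a..b}. dist x' x < d \<longrightarrow> dist (f x') (f x) < \<epsilon>"
    using \<delta>(1) by blast
qed

text \<open>Differences, bilinear products and exponentials all reduce to such an increment bound;
  taking \<open>g = f\<close> covers functions of a single argument.\<close>

lemma abs_continuous_on_compose2:
  fixes f :: "real \<Rightarrow> 'a::real_normed_vector" and g :: "real \<Rightarrow> 'b::real_normed_vector"
    and h :: "real \<Rightarrow> 'c::real_normed_vector"
  assumes f: "abs_continuous_on a b f" and g: "abs_continuous_on a b g"
    and h: "\<And>s t. s \<in> {a..b} \<Longrightarrow> t \<in> {a..b} \<Longrightarrow> norm (h t - h s) \<le> C * (norm (f t - f s) + norm (g t - g s))"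
  shows "abs_continuous_on a b h"
  unfolding abs_continuous_on_def
proof (intro allI impI)
  fix \<epsilon> :: real assume "\<epsilon> > 0"
  define C' where "C' = \<bar>C\<bar> + 1"
  have C': "C' > 0" "C \<le> C'" by (auto simp: C'_def)
  define e where "e = \<epsilon> / (2 * C')"
  have e: "e > 0" using \<open>\<epsilon> > 0\<close> C' by (auto simp: e_def)
  obtain d1 where d1: "d1 > 0"
    "\<And>D. finite D \<Longrightarrow> (\<And>s t. (s,t) \<in> D \<Longrightarrow> a \<le> s \<and> s \<le> t \<and> t \<le> b) \<Longrightarrow>
       disjoint_family_on (\<lambda>(s,t). {s<..<t}) D \<Longrightarrow> (\<Sum>(s,t)\<in>D. t - s) < d1
       \<Longrightarrow> (\<Sum>(s,t)\<in>D. norm (f t - f s)) < e"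
    using abs_continuous_onD[OF f e] by blast
  obtain d2 where d2: "d2 > 0"
    "\<And>D. finite D \<Longrightarrow> (\<And>s t. (s,t) \<in> D \<Longrightarrow> a \<le> s \<and> s \<le> t \<and> t \<le> b) \<Longrightarrow>
       disjoint_family_on (\<lambda>(s,t). {s<..<t}) D \<Longrightarrow> (\<Sum>(s,t)\<in>D. t - s) < d2
       \<Longrightarrow> (\<Sum>(s,t)\<in>D. norm (g t - g s)) < e"
    using abs_continuous_onD[OF g e] by blast
  show "\<exists>\<delta>>0. \<forall>D. finite D \<and> (\<forall>(s,t)\<in>D. a \<le> s \<and> s \<le> t \<and> t \<le> b) \<and>
         disjoint_family_on (\<lambda>(s,t). {s<..<t}) D \<and> (\<Sum>(s,t)\<in>D. t - s) < \<delta>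
         \<longrightarrow> (\<Sum>(s,t)\<in>D. norm (h t - h s)) < \<epsilon>"
  proof (intro exI[of _ "min d1 d2"] conjI allI impI)
    show "min d1 d2 > 0" using d1(1) d2(1) by simp
    fix D assume D: "finite D \<and> (\<forall>(s,t)\<in>D. a \<le> s \<and> s \<le> t \<and> t \<le> b) \<and>
         disjoint_family_on (\<lambda>(s,t). {s<..<t}) D \<and> (\<Sum>(s,t)\<in>D. t - s) < min d1 d2"
    have 1: "(\<Sum>(s,t)\<in>D. norm (f t - f s)) < e" by (rule d1(2)) (use D in auto)
    have 2: "(\<Sum>(s,t)\<in>D. norm (g t - g s)) < e" by (rule d2(2)) (use D in auto)
    have "(\<Sum>(s,t)\<in>D. norm (h t - h s)) \<le> (\<Sum>(s,t)\<in>D. C' * (norm (f t - f s) + norm (g t - g s)))"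
    proof (rule sum_mono, clarify)
      fix s t assume "(s,t) \<in> D"
      then have "s \<in> {a..b}" "t \<in> {a..b}" using D by auto
      from h[OF this] show "norm (h t - h s) \<le> C' * (norm (f t - f s) + norm (g t - g s))"
        by (rule order_trans) (use C' in \<open>intro mult_right_mono; simp\<close>)
    qed
    also have "\<dots> = C' * ((\<Sum>(s,t)\<in>D. norm (f t - f s)) + (\<Sum>(s,t)\<in>D. norm (g t - g s)))"
      by (simp add: sum_distrib_left[symmetric] sum.distrib split_def)
    also have "\<dots> < C' * (e + e)" using 1 2 C' by (intro mult_strict_left_mono) auto
    also have "\<dots> = \<epsilon>" using C' by (simp add: e_def field_simps)
    finally show "(\<Sum>(s,t)\<in>D. norm (h t - h s)) < \<epsilon>" .
  qed
qed

lemma abs_continuous_on_diff: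
  assumes "abs_continuous_on a b f" "abs_continuous_on a b g"
  shows "abs_continuous_on a b (\<lambda>t. f t - g t)"
proof (rule abs_continuous_on_compose2[OF assms, where C = 1])
  fix s t
  have "f t - g t - (f s - g s) = (f t - f s) - (g t - g s)" by (simp add: algebra_simps)
  then show "norm (f t - g t - (f s - g s)) \<le> 1 * (norm (f t - f s) + norm (g t - g s))"
    using norm_triangle_ineq4[of "f t - f s" "g t - g s"] by (metis mult_1)
qed

lemma abs_continuous_on_bounded_bilinear:
  assumes "bounded_bilinear p" "abs_continuous_on a b f" "abs_continuous_on a b g"
  shows "abs_continuous_on a b (\<lambda>t. p (f t) (g t))"
proof -
  interpret bounded_bilinear p by fact
  obtain K where K: "K > 0" "\<And>x y. norm (p x y) \<le> norm x * norm y * K"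
    using pos_bounded by blast
  have "bounded (f ` {a..b})" "bounded (g ` {a..b})"
    using assms(2,3) by (simp_all add: abs_continuous_on_imp_continuous_on compact_continuous_image compact_imp_bounded)
  then obtain A B where AB: "\<And>t. t \<in> {a..b} \<Longrightarrow> norm (f t) \<le> A" "\<And>t. t \<in> {a..b} \<Longrightarrow> norm (g t) \<le> B"
    unfolding bounded_iff by (meson imageI)
  show ?thesis
  proof (rule abs_continuous_on_compose2[OF assms(2,3), where C = "K * (\<bar>A\<bar> + \<bar>B\<bar>)"])
    fix s t assume st: "s \<in> {a..b}" "t \<in> {a..b}"
    have "p (f t) (g t) - p (f s) (g s) = p (f t - f s) (g t) + p (f s) (g t - g s)"
      by (simp add: diff_left diff_right)
    then have "norm (p (f t) (g t) - p (f s) (g s)) \<le> norm (p (f t - f s) (g t)) + norm (p (f s) (g t - g s))"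
      by (metis norm_triangle_ineq)
    also have "\<dots> \<le> norm (f t - f s) * norm (g t) * K + norm (f s) * norm (g t - g s) * K"
      by (intro add_mono K)
    also have "\<dots> \<le> norm (f t - f s) * (\<bar>A\<bar> + \<bar>B\<bar>) * K + (\<bar>A\<bar> + \<bar>B\<bar>) * norm (g t - g s) * K"
      using AB(1)[OF st(1)] AB(2)[OF st(2)] K(1)
      by (intro add_mono mult_right_mono mult_left_mono) auto
    finally show "norm (p (f t) (g t) - p (f s) (g s)) \<le> K * (\<bar>A\<bar> + \<bar>B\<bar>) * (norm (f t - f s) + norm (g t - g s))"
      by (simp add: algebra_simps)
  qed
qed

text \<open>Truncation: \<open>norm (f x)\<close> is at most
  \<open>n + max 0 (norm (f x) - n)\<close>. For large \<open>n\<close> the excess has a small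
  integral over all of \<open>{a..b}\<close>, whichever intervals are picked, and the constant part
  costs only \<open>n\<close> times their total length.\<close>

lemma abs_continuous_on_integral:
  fixes f :: "real \<Rightarrow> 'a::euclidean_space"
  assumes f: "f absolutely_integrable_on {a..b}"
  shows "abs_continuous_on a b (\<lambda>t. integral {a..t} f)"
  unfolding abs_continuous_on_def
proof (intro allI impI)
  fix \<epsilon> :: real assume "\<epsilon> > 0"
  define h where "h x = norm (f x)" for x
  have h: "h integrable_on {a..b}" "\<And>x. h x \<ge> 0"
    using f unfolding h_def absolutely_integrable_on_def by auto
  have fi: "f integrable_on {a..b}" using f by (auto simp: absolutely_integrable_on_def)
  have ha: "h absolutely_integrable_on {a..b}"
    using h by (simp add: absolutely_integrable_on_iff_nonneg)
  have cut: "(\<lambda>x. max 0 (h x - real n)) integrable_on {a..b}" for n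
  proof -
    have "(\<lambda>x. h x - real n) absolutely_integrable_on {a..b}"
      by (intro set_integral_diff ha) (auto simp: absolutely_integrable_on_const)
    then have "(\<lambda>x. max 0 (h x - real n)) absolutely_integrable_on {a..b}"
      by (intro absolutely_integrable_max_1) auto
    then show ?thesis by (simp add: absolutely_integrable_on_def)
  qed
  have "(\<lambda>n. integral {a..b} (\<lambda>x. max 0 (h x - real n))) \<longlonglongrightarrow> integral {a..b} (\<lambda>x. 0)"
  proof (rule dominated_convergence(2)[OF cut h(1)])
    fix x
    obtain N where N: "h x \<le> real N" using real_arch_simple by blast
    have "eventually (\<lambda>n. max 0 (h x - real n) = 0) sequentially"
      using eventually_ge_at_top[of N] by eventually_elim (use N in auto)
    then show "(\<lambda>n. max 0 (h x - real n)) \<longlonglongrightarrow> 0" by (rule tendsto_eventually)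
  qed (use h(2) in auto)
  then have "eventually (\<lambda>n. integral {a..b} (\<lambda>x. max 0 (h x - real n)) < \<epsilon>/2) sequentially"
    using \<open>\<epsilon> > 0\<close> by (intro order_tendstoD(2)[where y = 0]) auto
  then obtain n where n: "integral {a..b} (\<lambda>x. max 0 (h x - real n)) < \<epsilon>/2"
    by (auto simp: eventually_sequentially)
  \<comment> \<open>\<open>real n + 1\<close> instead of \<open>real n\<close> keeps the divisor
    positive when \<open>n = 0\<close>.\<close>
  define \<delta> where "\<delta> = \<epsilon> / (2 * (real n + 1))"
  have "\<delta> > 0" using \<open>\<epsilon> > 0\<close> by (simp add: \<delta>_def)
  show "\<exists>\<delta>>0. \<forall>D. finite D \<and> (\<forall>(s,t)\<in>D. a \<le> s \<and> s \<le> t \<and> t \<le> b) \<and>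
         disjoint_family_on (\<lambda>(s,t). {s<..<t}) D \<and> (\<Sum>(s,t)\<in>D. t - s) < \<delta>
         \<longrightarrow> (\<Sum>(s,t)\<in>D. norm (integral {a..t} f - integral {a..s} f)) < \<epsilon>"
  proof (intro exI[of _ \<delta>] conjI allI impI)
    show "\<delta> > 0" by fact
    fix D assume D: "finite D \<and> (\<forall>(s,t)\<in>D. a \<le> s \<and> s \<le> t \<and> t \<le> b) \<and>
         disjoint_family_on (\<lambda>(s,t). {s<..<t}) D \<and> (\<Sum>(s,t)\<in>D. t - s) < \<delta>"
    have "(\<Sum>(s,t)\<in>D. norm (integral {a..t} f - integral {a..s} f))
        \<le> (\<Sum>(s,t)\<in>D. real n * (t - s) + integral {s..t} (\<lambda>x. max 0 (h x - real n)))"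
    proof (rule sum_mono, clarify)
      fix s t assume "(s,t) \<in> D"
      then have st: "a \<le> s" "s \<le> t" "t \<le> b" using D by auto
      have ii: "f integrable_on {s..t}" "h integrable_on {s..t}" "(\<lambda>x. max 0 (h x - real n)) integrable_on {s..t}"
        using st by (auto intro: integrable_on_subinterval[OF fi] integrable_on_subinterval[OF h(1)]
            integrable_on_subinterval[OF cut[of n]])
      have "integral {a..s} f + integral {s..t} f = integral {a..t} f"
        by (rule Henstock_Kurzweil_Integration.integral_combine) (use st in \<open>auto intro: integrable_on_subinterval[OF fi]\<close>)
      then have "integral {a..t} f - integral {a..s} f = integral {s..t} f"
        by (simp add: algebra_simps)
      then have "norm (integral {a..t} f - integral {a..s} f) \<le> integral {s..t} (\<lambda>x. real n + max 0 (h x - real n))"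
        using ii by (auto intro!: integral_norm_bound_integral integrable_add simp: h_def)
      also have "\<dots> = real n * (t - s) + integral {s..t} (\<lambda>x. max 0 (h x - real n))"
        using ii st by (subst Henstock_Kurzweil_Integration.integral_add) auto
      finally show "norm (integral {a..t} f - integral {a..s} f) \<le> \<dots>" .
    qed
    also have "\<dots> = real n * (\<Sum>(s,t)\<in>D. t - s) + (\<Sum>(s,t)\<in>D. integral {s..t} (\<lambda>x. max 0 (h x - real n)))"
      by (simp add: sum_distrib_left sum.distrib split_def)
    also have "\<dots> \<le> real n * \<delta> + integral {a..b} (\<lambda>x. max 0 (h x - real n))"
      by (intro add_mono mult_left_mono sum_integral_disjoint_intervals_le cut) (use D in auto)
    also have "\<dots> < real n * \<delta> + \<epsilon>/2" using n by simp
    also have "\<dots> \<le> (real n + 1) * \<delta> + \<epsilon>/2" using \<open>\<delta> > 0\<close> by (simp add: algebra_simps)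
    also have "\<dots> = \<epsilon>" by (simp add: \<delta>_def field_simps)
    finally show "(\<Sum>(s,t)\<in>D. norm (integral {a..t} f - integral {a..s} f)) < \<epsilon>" .
  qed
qed

section \<open>Fundamental theorem of calculus and differentiation of integrals\<close>

text \<open>Integrability of \<open>f'\<close> is part of the conclusion, so a gauge is built
  directly. Off \<open>N\<close> it comes from the derivative. On \<open>N\<close>, where the
  integrand is reset to 0, it keeps the tagged interval inside an open set of measure below the
  \<open>\<delta>\<close> of absolute continuity, which makes the increments of \<open>f\<close>
  there small in total.\<close>

lemma fundamental_theorem_of_calculus_abs_continuous:
  fixes f :: "real \<Rightarrow> 'a::euclidean_space"
  assumes ab: "a \<le> b" and ac: "abs_continuous_on a b f" and N: "negligible N"
    and der: "\<And>x. x \<in> {a..b} - N \<Longrightarrow> (f has_vector_derivative f' x) (at x within {a..b})"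
  shows "(f' has_integral (f b - f a)) {a..b}"
proof -
  define g where "g x = (if x \<in> N then 0 else f' x)" for x
  have "(g has_integral (f b - f a)) {a..b}"
    unfolding has_integral_real
  proof (intro allI impI)
    fix e :: real assume "e > 0"
    \<comment> \<open>The added 1 covers \<open>a = b\<close> and makes \<open>e1 * (b - a)\<close>
      strictly smaller than \<open>e/2\<close>.\<close>
    define e1 where "e1 = e / (2 * (b - a + 1))"
    have e1: "e1 > 0" "e1 * (b - a) < e/2" using \<open>e > 0\<close> ab by (auto simp: e1_def field_simps)
    obtain \<delta> where \<delta>: "\<delta> > 0"
      "\<And>D. finite D \<Longrightarrow> (\<And>s t. (s,t) \<in> D \<Longrightarrow> a \<le> s \<and> s \<le> t \<and> t \<le> b) \<Longrightarrow>
         disjoint_family_on (\<lambda>(s,t). {s<..<t}) D \<Longrightarrow> (\<Sum>(s,t)\<in>D. t - s) < \<delta>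
         \<Longrightarrow> (\<Sum>(s,t)\<in>D. norm (f t - f s)) < e/2"
      using abs_continuous_onD[OF ac, of "e/2"] \<open>e > 0\<close> by (metis half_gt_zero)
    obtain T where T: "N \<subseteq> T" "T \<in> lmeasurable" "measure lebesgue T < \<delta>/2"
      using N \<delta>(1) unfolding negligible_outer by (metis half_gt_zero)
    \<comment> \<open>\<open>T\<close> is only measurable; the open enlargement leaves room for a
      ball around each point of \<open>N\<close>.\<close>
    obtain U where U: "open U" "T \<subseteq> U" "U - T \<in> lmeasurable" "emeasure lebesgue (U - T) < ennreal (\<delta>/2)"
      using sets_lebesgue_outer_open[of T "\<delta>/2"] T(2) \<delta>(1) by (metis fmeasurableD half_gt_zero)
    have mUT: "measure lebesgue (U - T) < \<delta>/2"
      using U(3,4) \<delta>(1) by (simp add: emeasure_eq_measure2 ennreal_less_iff)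
    have Um: "U \<in> lmeasurable" "measure lebesgue U < \<delta>"
    proof -
      have UU: "U = T \<union> (U - T)" using U(2) by auto
      show "U \<in> lmeasurable" using T(2) U(3) UU by (metis fmeasurable.Un)
      show "measure lebesgue U < \<delta>"
        using measure_Un_le[of T lebesgue "U - T"] T(2,3) U(3) mUT UU
        by (metis (no_types, lifting) add_strict_mono field_sum_of_halves fmeasurableD order_le_less_trans)
    qed
    have "\<exists>d>0. (x \<in> N \<longrightarrow> ball x d \<subseteq> U) \<and> (x \<in> {a..b} - N \<longrightarrow>
        (\<forall>y\<in>{a..b}. norm (y-x) < d \<longrightarrow> norm (f y - f x - (y-x) *\<^sub>R f' x) \<le> e1 * norm (y-x)))" for x
    proof (cases "x \<in> N")
      case True
      then have "x \<in> U" using T U by auto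
      then show ?thesis using U(1) True open_contains_ball by blast
    next
      case False
      show ?thesis
      proof (cases "x \<in> {a..b}")
        case True
        then show ?thesis using der[of x] False e1(1)
          unfolding has_vector_derivative_def has_derivative_within_alt by blast
      qed (use False in \<open>auto intro: exI[of _ 1]\<close>)
    qed
    then obtain d where d: "\<And>x. d x > 0" "\<And>x. x \<in> N \<Longrightarrow> ball x (d x) \<subseteq> U"
      "\<And>x y. x \<in> {a..b} - N \<Longrightarrow> y \<in> {a..b} \<Longrightarrow> norm (y-x) < d x \<Longrightarrow>
          norm (f y - f x - (y-x) *\<^sub>R f' x) \<le> e1 * norm (y-x)"
      by metis
    show "\<exists>\<gamma>. gauge \<gamma> \<and> (\<forall>p. p tagged_division_of {a..b} \<and> \<gamma> fine p \<longrightarrow>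
           norm ((\<Sum>(x,k)\<in>p. measure lborel k *\<^sub>R g x) - (f b - f a)) < e)"
    proof (intro exI[of _ "\<lambda>x. ball x (d x)"] conjI allI impI)
      show "gauge (\<lambda>x. ball x (d x))" using d(1) gauge_ball_dependent by blast
      fix p assume "p tagged_division_of {a..b} \<and> (\<lambda>x. ball x (d x)) fine p"
      then have p: "p tagged_division_of {a..b}" and fine: "(\<lambda>x. ball x (d x)) fine p" by auto
      note pD = tagged_division_ofD[OF p]
      have int: "\<exists>u v. K = {u..v} \<and> u \<le> x \<and> x \<le> v \<and> a \<le> u \<and> v \<le> b \<and> {u..v} \<subseteq> ball x (d x)"
        if xK: "(x,K) \<in> p" for x K
      proof -
        obtain u v where K: "K = cbox u v" using pD(4)[OF xK] by blast
        have "K \<subseteq> ball x (d x)" using fine xK by (auto simp: fine_def)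
        then show ?thesis using pD(2,3)[OF xK] K by auto
      qed
      define \<phi> where "\<phi> = (\<lambda>(x,K). measure lborel K *\<^sub>R g x - (f (Sup K) - f (Inf K)))"
      have e: "(\<Sum>(x,K)\<in>p. measure lborel K *\<^sub>R g x) - (f b - f a) = sum \<phi> p"
        using additive_tagged_division_1[OF ab p, of f] by (simp add: \<phi>_def split_def sum_subtractf)
      define P where "P = {xk\<in>p. fst xk \<in> N}"
      have fin: "finite p" "finite P" using pD(1) by (auto simp: P_def)
      have good: "norm (sum \<phi> (p - P)) \<le> e1 * (b - a)"
      proof -
        have "norm (sum \<phi> (p - P)) \<le> (\<Sum>(x,K)\<in>p - P. e1 * (Sup K - Inf K))"
        proof (rule sum_norm_le, clarify)
          fix x K assume xK: "(x,K) \<in> p" "(x,K) \<notin> P"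
          obtain u v where K: "K = {u..v}" "u \<le> x" "x \<le> v" "a \<le> u" "v \<le> b" "{u..v} \<subseteq> ball x (d x)"
            using int[OF xK(1)] by blast
          have x: "x \<in> {a..b} - N" using xK K by (auto simp: P_def)
          have "u \<in> {u..v}" "v \<in> {u..v}" using K by auto
          then have "u \<in> ball x (d x)" "v \<in> ball x (d x)" using K(6) by blast+
          then have uv: "norm (u - x) < d x" "norm (v - x) < d x" by (auto simp: dist_real_def)
          \<comment> \<open>The tag lies between the endpoints, so the two errors are
            \<open>e1\<close> times distances that add up to the length of \<open>K\<close>.\<close>
          have "\<phi> (x,K) = (f u - f x - (u - x) *\<^sub>R f' x) - (f v - f x - (v - x) *\<^sub>R f' x)"
            using x K by (simp add: \<phi>_def g_def algebra_simps)
          then have "norm (\<phi> (x,K)) \<le> norm (f u - f x - (u - x) *\<^sub>R f' x) + norm (f v - f x - (v - x) *\<^sub>R f' x)"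
            using norm_triangle_ineq4 by metis
          also have "\<dots> \<le> e1 * norm (u - x) + e1 * norm (v - x)"
            using K uv by (intro add_mono d(3) x) auto
          also have "\<dots> = e1 * (Sup K - Inf K)" using K by (simp add: algebra_simps)
          finally show "norm (\<phi> (x,K)) \<le> e1 * (Sup K - Inf K)" .
        qed
        also have "\<dots> \<le> (\<Sum>(x,K)\<in>p. e1 * (Sup K - Inf K))"
        proof (rule sum_mono2[OF fin(1)])
          fix y assume "y \<in> p - (p - P)"
          moreover obtain x K where y: "y = (x,K)" by (cases y)
          ultimately have "(x,K) \<in> p" by auto
          from int[OF this] show "0 \<le> (case y of (x,K) \<Rightarrow> e1 * (Sup K - Inf K))"
            using e1 y by auto
        qed auto
        also have "\<dots> = e1 * (\<Sum>(x,K)\<in>p. Sup K - Inf K)" by (simp add: sum_distrib_left split_def)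
        also have "\<dots> = e1 * (b - a)" using additive_tagged_division_1[OF ab p, of "\<lambda>x. x"] by simp
        finally show ?thesis .
      qed
      define q where "q = (\<lambda>(x::real,K). (Inf K, Sup K :: real))"
      define D where "D = q ` P"
      have D: "a \<le> s \<and> s \<le> t \<and> t \<le> b \<and> {s..t} \<subseteq> U" if "(s,t) \<in> D" for s t
      proof -
        obtain x K where xK: "(x,K) \<in> p" "x \<in> N" "s = Inf K" "t = Sup K"
          using \<open>(s,t) \<in> D\<close> by (auto simp: D_def P_def q_def)
        show ?thesis using int[OF xK(1)] d(2)[OF xK(2)] xK(3,4) by auto
      qed
      have disj0: "{Inf K<..<Sup K} \<inter> {Inf K'<..<Sup K'} = {}"
        if "(x,K) \<in> p" "(x',K') \<in> p" "(x,K) \<noteq> (x',K')" for x K x' K'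
        using int[OF that(1)] int[OF that(2)] pD(5)[OF that] by (auto simp: interior_atLeastAtMost_real)
      have disj: "disjoint_family_on (\<lambda>(s,t). {s<..<t}) D"
        unfolding disjoint_family_on_def
      proof (intro ballI impI)
        fix m n assume "m \<in> D" "n \<in> D" "m \<noteq> n"
        then obtain x K x' K' where "(x,K) \<in> p" "(x',K') \<in> p" "m = (Inf K, Sup K)" "n = (Inf K', Sup K')"
          by (auto simp: D_def P_def q_def)
        moreover from this \<open>m \<noteq> n\<close> have "(x,K) \<noteq> (x',K')" by auto
        ultimately show "(case m of (s,t) \<Rightarrow> {s<..<t}) \<inter> (case n of (s,t) \<Rightarrow> {s<..<t}) = {}"
          using disj0 by simp
      qed
      \<comment> \<open>\<open>q\<close> forgets the tag and need not be injective. Two distinct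
        members with equal endpoints have disjoint interiors, hence are degenerate and contribute
        0.\<close>
      have re: "sum G D = sum (G \<circ> q) P" if "\<And>s. G (s,s) = (0::real)" for G
        unfolding D_def
      proof (rule sum.reindex_nontrivial[OF fin(2)])
        fix y z assume yz: "y \<in> P" "z \<in> P" "y \<noteq> z" "q y = q z"
        obtain x K x' K' where e: "y = (x,K)" "z = (x',K')" by (metis surj_pair)
        have m: "(x,K) \<in> p" "(x',K') \<in> p" using yz e by (auto simp: P_def)
        have "{Inf K<..<Sup K} = {}"
          using disj0[OF m] yz e by (auto simp: q_def)
        moreover have "Inf K \<le> Sup K" using int[OF m(1)] by auto
        ultimately have "Inf K = Sup K" by simp
        then show "G (q y) = 0" using that e by (simp add: q_def)
      qed
      have bad: "norm (sum \<phi> P) < e/2"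
      proof -
        have "norm (sum \<phi> P) \<le> (\<Sum>(x,K)\<in>P. norm (f (Sup K) - f (Inf K)))"
          by (rule sum_norm_le) (auto simp: P_def \<phi>_def g_def norm_minus_commute)
        also have "\<dots> = (\<Sum>(s,t)\<in>D. norm (f t - f s))"
          by (subst re) (auto simp: q_def split_def)
        also have "\<dots> < e/2"
        proof (rule \<delta>(2)[OF _ _ disj])
          show "finite D" using fin by (simp add: D_def)
          show "a \<le> s \<and> s \<le> t \<and> t \<le> b" if "(s,t) \<in> D" for s t using D[OF that] by auto
          \<comment> \<open>Lengths are written as integrals of 1, so that disjointness and
            inclusion in \<open>U\<close> bound their sum by the measure of
            \<open>U\<close>.\<close>
          have "(\<Sum>(s,t)\<in>D. t - s) = (\<Sum>(s,t)\<in>D. integral {s..t} (\<lambda>x. 1::real))"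
            using D by (intro sum.cong) auto
          also have "\<dots> \<le> integral U (\<lambda>x. 1)"
            by (rule sum_integral_disjoint_intervals_le)
               (use D disj fin Um in \<open>auto simp: D_def lmeasurable_iff_integrable_on\<close>)
          also have "\<dots> < \<delta>" using Um lmeasure_integral[OF Um(1)] by simp
          finally show "(\<Sum>(s,t)\<in>D. t - s) < \<delta>" .
        qed
        finally show ?thesis .
      qed
      have "sum \<phi> p = sum \<phi> (p - P) + sum \<phi> P"
        using fin by (intro sum.subset_diff) (auto simp: P_def)
      then have "norm (sum \<phi> p) \<le> norm (sum \<phi> (p - P)) + norm (sum \<phi> P)"
        by (metis norm_triangle_ineq)
      then have "norm (sum \<phi> p) < e" using good bad e1(2) by linarith
      then show "norm ((\<Sum>(x,K)\<in>p. measure lborel K *\<^sub>R g x) - (f b - f a)) < e" using e by simp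
    qed
  qed
  then show ?thesis
    by (rule has_integral_spike[OF N, rotated]) (auto simp: g_def)
qed

text \<open>Lebesgue differentiation. The statement for averages over \<open>{x..x + h}\<close> with
  \<open>h > 0\<close> is applied to the integrand and to its reflection; this controls increments
  on both sides, and the second exceptional set has to be reflected back.\<close>

lemma integral_has_vector_derivative_almost_everywhere:
  fixes f :: "real \<Rightarrow> 'a::euclidean_space"
  assumes f: "f integrable_on {a..b}"
  obtains N where "negligible N"
    "\<And>t. t \<in> {a..b} - N \<Longrightarrow> ((\<lambda>t. integral {a..t} f) has_vector_derivative f t) (at t within {a..b})"
proof -
  \<comment> \<open>Extension by zero makes the averages meaningful on intervals that leave
    \<open>{a..b}\<close>.\<close>
  define g where "g x = (if x \<in> {a..b} then f x else 0)" for x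
  have gU: "g integrable_on UNIV" unfolding g_def using f by (subst integrable_restrict_UNIV)
  then have gi: "g integrable_on {c..d}" for c d
    using integrable_on_subcbox[of g UNIV c d] by simp
  have gi': "(\<lambda>x. g (- x)) integrable_on {c..d}" for c d
    using Henstock_Kurzweil_Integration.integrable_reflect_real[of g "-c" "-d"] gi by simp
  obtain N1 where N1: "negligible N1" "\<And>x e. x \<notin> N1 \<Longrightarrow> 0 < e \<Longrightarrow>
      \<exists>d>0. \<forall>h. 0 < h \<and> h < d \<longrightarrow> norm (integral {x..x + h} g /\<^sub>R h - g x) < e"
    using integrable_ccontinuous_explicit[of g] gi by auto
  obtain N2 where N2: "negligible N2" "\<And>x e. x \<notin> N2 \<Longrightarrow> 0 < e \<Longrightarrow>
      \<exists>d>0. \<forall>h. 0 < h \<and> h < d \<longrightarrow> norm (integral {x..x + h} (\<lambda>x. g (- x)) /\<^sub>R h - g (- x)) < e"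
    using integrable_ccontinuous_explicit[of "\<lambda>x. g (- x)"] gi' by auto
  show ?thesis
  proof (rule that[of "N1 \<union> uminus ` N2"])
    show "negligible (N1 \<union> uminus ` N2)"
      using N1(1) N2(1) by (intro negligible_Un negligible_differentiable_image_negligible)
        (auto simp: differentiable_on_def)
    fix t assume t: "t \<in> {a..b} - (N1 \<union> uminus ` N2)"
    have t2: "- t \<notin> N2" using t by (metis DiffD2 UnCI image_eqI minus_minus)
    have gt: "g t = f t" using t by (simp add: g_def)
    have sub: "integral {a..y} f - integral {a..x} f = integral {x..y} g" if "a \<le> x" "x \<le> y" "y \<le> b" for x y
    proof -
      have "integral {a..x} f + integral {x..y} f = integral {a..y} f"
        by (rule Henstock_Kurzweil_Integration.integral_combine) (use that in \<open>auto intro: integrable_on_subinterval[OF f]\<close>)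
      moreover have "integral {x..y} f = integral {x..y} g"
        by (rule Henstock_Kurzweil_Integration.integral_cong) (use that in \<open>auto simp: g_def\<close>)
      ultimately show ?thesis by (simp add: algebra_simps)
    qed
    show "((\<lambda>t. integral {a..t} f) has_vector_derivative f t) (at t within {a..b})"
      unfolding has_vector_derivative_def has_derivative_within_alt
    proof (intro conjI allI impI)
      show "bounded_linear (\<lambda>x. x *\<^sub>R f t)" by (rule bounded_linear_scaleR_left)
      fix e :: real assume "e > 0"
      obtain d1 where d1: "d1 > 0" "\<And>h. 0 < h \<Longrightarrow> h < d1 \<Longrightarrow> norm (integral {t..t + h} g /\<^sub>R h - g t) < e"
        using N1(2)[of t e] t \<open>e > 0\<close> by auto
      obtain d2 where d2: "d2 > 0" "\<And>h. 0 < h \<Longrightarrow> h < d2 \<Longrightarrow>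
          norm (integral {- t..- t + h} (\<lambda>x. g (- x)) /\<^sub>R h - g t) < e"
        using N2(2)[OF t2 \<open>e > 0\<close>] by auto
      have scale: "norm (I - h *\<^sub>R g t) \<le> e * h" if "h > 0" "norm (I /\<^sub>R h - g t) < e" for I h
      proof -
        have "I - h *\<^sub>R g t = h *\<^sub>R (I /\<^sub>R h - g t)" using that by (simp add: algebra_simps)
        then have "norm (I - h *\<^sub>R g t) = h * norm (I /\<^sub>R h - g t)" using that by simp
        then show ?thesis using that by (simp add: mult.commute)
      qed
      show "\<exists>d>0. \<forall>y\<in>{a..b}. norm (y - t) < d \<longrightarrow>
          norm (integral {a..y} f - integral {a..t} f - (y - t) *\<^sub>R f t) \<le> e * norm (y - t)"
      proof (intro exI[of _ "min d1 d2"] conjI ballI impI)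
        show "min d1 d2 > 0" using d1 d2 by simp
        fix y assume y: "y \<in> {a..b}" "norm (y - t) < min d1 d2"
        consider "y = t" | "y > t" | "y < t" by linarith
        then show "norm (integral {a..y} f - integral {a..t} f - (y - t) *\<^sub>R f t) \<le> e * norm (y - t)"
        proof cases
          case 2
          then have "norm (integral {t..y} g - (y - t) *\<^sub>R g t) \<le> e * (y - t)"
            using d1(2)[of "y - t"] y by (intro scale) auto
          then show ?thesis using sub[of t y] t y 2 gt by simp
        next
          case 3
          have "integral {- t..- y} (\<lambda>x. g (- x)) = integral {y..t} g" by simp
          then have "norm (integral {y..t} g - (t - y) *\<^sub>R g t) \<le> e * (t - y)"
            using d2(2)[of "t - y"] y 3 by (intro scale) auto
          moreover have "integral {a..y} f - integral {a..t} f - (y - t) *\<^sub>R f t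
              = - (integral {y..t} g - (t - y) *\<^sub>R g t)"
            using sub[of y t] t y 3 gt by (simp add: algebra_simps)
          ultimately have "norm (integral {a..y} f - integral {a..t} f - (y - t) *\<^sub>R f t) \<le> e * (t - y)"
            by (simp only: norm_minus_cancel)
          then show ?thesis using 3 by simp
        qed simp
      qed
    qed
  qed
qed

section \<open>Gronwall estimates and Caratheodory solutions\<close>

lemma AE_lebesgue_on_iff_negligible:
  assumes "S \<in> sets lebesgue"
  shows "(AE t in lebesgue_on S. P t) \<longleftrightarrow> (\<exists>N. negligible N \<and> (\<forall>t\<in>S - N. P t))"
  using assms by (subst AE_restrict_space_iff) (auto simp: eventually_ae_filter_negligible)

lemma integrable_on_mult_continuous:
  fixes m \<phi> :: "real \<Rightarrow> real"
  assumes "m integrable_on {a..b}" "\<And>t. t \<in> {a..b} \<Longrightarrow> 0 \<le> m t" "continuous_on {a..b} \<phi>"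
  shows "(\<lambda>s. m s * \<phi> s) integrable_on {a..b}"
proof -
  have "(\<lambda>s. \<phi> s * m s) absolutely_integrable_on {a..b}"
  proof (rule absolutely_integrable_bounded_measurable_product_real)
    show "\<phi> \<in> borel_measurable (lebesgue_on {a..b})"
      using assms(3) by (intro continuous_imp_measurable_on_sets_lebesgue) auto
    show "bounded (\<phi> ` {a..b})"
      using assms(3) by (intro compact_imp_bounded compact_continuous_image) auto
    show "m absolutely_integrable_on {a..b}"
      using assms absolutely_integrable_on_iff_nonneg[of "{a..b}" m] by blast
  qed auto
  then show ?thesis by (simp add: mult.commute absolutely_integrable_on_def)
qed

text \<open>As \<open>m\<close> is only integrable, the chain rule for the exponential holds almost
  everywhere. Integrating it is allowed because the exponential is Lipschitz on the bounded range of
  \<open>2 * M\<close>, so that \<open>E\<close> is absolutely continuous. The factor 2 in the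
  exponent yields the half on which the Gronwall bound and the contraction rest.\<close>

lemma has_integral_exp_integral:
  fixes m :: "real \<Rightarrow> real"
  assumes ab: "a \<le> b" and m: "m integrable_on {a..b}" "\<And>t. t \<in> {a..b} \<Longrightarrow> 0 \<le> m t"
  shows "((\<lambda>s. m s * exp (2 * integral {a..s} m)) has_integral (exp (2 * integral {a..b} m) - 1) / 2) {a..b}"
proof -
  define M where "M t = integral {a..t} m" for t
  have M: "abs_continuous_on a b M"
    unfolding M_def using m absolutely_integrable_on_iff_nonneg[of "{a..b}" m]
    by (intro abs_continuous_on_integral) blast
  have Mle: "M t \<le> M b" if "t \<in> {a..b}" for t
    unfolding M_def using m that by (intro integral_subset_le) (auto intro: integrable_on_subinterval)
  obtain N where N: "negligible N"
    "\<And>t. t \<in> {a..b} - N \<Longrightarrow> (M has_vector_derivative m t) (at t within {a..b})"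
    using integral_has_vector_derivative_almost_everywhere[OF m(1)] unfolding M_def by blast
  define E where "E t = exp (2 * M t) / 2" for t
  have "abs_continuous_on a b E"
  proof (rule abs_continuous_on_compose2[OF M M, where C = "exp (2 * M b) / 2"])
    have *: "exp x - exp y \<le> exp B * \<bar>x - y\<bar>" if "x \<le> B" "y \<le> B" for x y B :: real
    proof -
      have "exp x - exp y = exp x * (1 - exp (y - x))" by (simp add: algebra_simps exp_diff)
      also have "\<dots> \<le> exp x * (x - y)" using exp_ge_add_one_self[of "y - x"] by (intro mult_left_mono) (linarith, simp)
      also have "\<dots> \<le> exp x * \<bar>x - y\<bar>" by (intro mult_left_mono) auto
      also have "\<dots> \<le> exp B * \<bar>x - y\<bar>" using that by (intro mult_right_mono) auto
      finally show ?thesis .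
    qed
    fix s t assume "s \<in> {a..b}" "t \<in> {a..b}"
    then have le: "2 * M s \<le> 2 * M b" "2 * M t \<le> 2 * M b" using Mle by auto
    have "\<bar>exp (2 * M t) - exp (2 * M s)\<bar> \<le> exp (2 * M b) * \<bar>2 * M t - 2 * M s\<bar>"
      using *[OF le(2,1)] *[OF le] by (simp add: abs_le_iff abs_minus_commute)
    moreover have "\<bar>2 * M t - 2 * M s\<bar> = 2 * \<bar>M t - M s\<bar>" by (simp add: abs_if)
    moreover have "norm (E t - E s) = \<bar>exp (2 * M t) - exp (2 * M s)\<bar> / 2"
      by (simp add: E_def flip: diff_divide_distrib)
    ultimately show "norm (E t - E s) \<le> exp (2 * M b) / 2 * (norm (M t - M s) + norm (M t - M s))"
      by (simp add: algebra_simps)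
  qed
  moreover have "(E has_vector_derivative m t * exp (2 * M t)) (at t within {a..b})" if "t \<in> {a..b} - N" for t
    using N(2)[OF that] unfolding E_def has_real_derivative_iff_has_vector_derivative[symmetric]
    by (auto intro!: derivative_eq_intros)
  ultimately have "((\<lambda>s. m s * exp (2 * M s)) has_integral (E b - E a)) {a..b}"
    by (intro fundamental_theorem_of_calculus_abs_continuous[OF ab _ N(1)])
  then show ?thesis by (simp add: E_def M_def diff_divide_distrib)
qed

text \<open>Let \<open>K\<close> be the maximum of \<open>\<phi> / E\<close>, attained at
  \<open>r\<close>. The hypothesis gives \<open>K * E r \<le> c + (E r - 1) / 2 * K\<close>, hence
  \<open>K * (E r + 1) \<le> 2 * c\<close>. The constants are larger than in the classical
  inequality, which is harmless here.\<close>

lemma gronwall_integral: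
  fixes \<phi> m :: "real \<Rightarrow> real"
  assumes m: "m integrable_on {a..b}" "\<And>t. t \<in> {a..b} \<Longrightarrow> 0 \<le> m t"
    and \<phi>: "continuous_on {a..b} \<phi>" and c: "0 \<le> c"
    and le: "\<And>t. t \<in> {a..b} \<Longrightarrow> \<phi> t \<le> c + integral {a..t} (\<lambda>s. m s * \<phi> s)"
    and t: "t \<in> {a..b}"
  shows "\<phi> t \<le> 2 * c * exp (2 * integral {a..b} m)"
proof -
  define E where "E t = exp (2 * integral {a..t} m)" for t
  have cE: "continuous_on {a..b} E"
    unfolding E_def by (intro continuous_intros indefinite_integral_continuous_1 m)
  have ab: "a \<le> b" using t by simp
  have "continuous_on {a..b} (\<lambda>t. \<phi> t / E t)"
    using cE \<phi> by (intro continuous_intros) (auto simp: E_def)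
  from continuous_attains_sup[OF compact_Icc _ this] ab
  obtain r where r: "r \<in> {a..b}" "\<And>t. t \<in> {a..b} \<Longrightarrow> \<phi> t / E t \<le> \<phi> r / E r"
    by (metis atLeastAtMost_iff empty_iff order_refl)
  define K where "K = \<phi> r / E r"
  have E0: "E t > 0" for t by (simp add: E_def)
  have K: "\<phi> t \<le> K * E t" if "t \<in> {a..b}" for t
    using r(2)[OF that] E0[of t] by (simp add: K_def[symmetric] divide_le_eq)
  have "K \<le> 2 * c"
  proof -
    have sub: "m integrable_on {a..r}" "continuous_on {a..r} \<phi>" "continuous_on {a..r} E"
      using r(1) by (auto intro: integrable_on_subinterval[OF m(1)] continuous_on_subset[OF \<phi>] continuous_on_subset[OF cE])
    have hE: "((\<lambda>s. m s * E s) has_integral (E r - 1) / 2) {a..r}"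
      using has_integral_exp_integral[OF _ sub(1)] r(1) m(2) by (simp add: E_def)
    have "K * E r = \<phi> r" using E0[of r] by (simp add: K_def)
    also have "\<phi> r \<le> c + integral {a..r} (\<lambda>s. m s * \<phi> s)" using le r(1) by blast
    also have "integral {a..r} (\<lambda>s. m s * \<phi> s) \<le> integral {a..r} (\<lambda>s. m s * E s * K)"
    proof (rule integral_le)
      show "(\<lambda>s. m s * \<phi> s) integrable_on {a..r}"
        using r(1) m(2) by (intro integrable_on_mult_continuous sub) auto
      show "(\<lambda>s. m s * E s * K) integrable_on {a..r}"
        using hE by (intro integrable_on_mult_left) auto
      fix s assume "s \<in> {a..r}"
      then show "m s * \<phi> s \<le> m s * E s * K"
        using K[of s] m(2)[of s] r(1) by (auto simp: mult.assoc mult.commute[of "E s"] intro!: mult_left_mono)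
    qed
    also have "integral {a..r} (\<lambda>s. m s * E s * K) = (E r - 1) / 2 * K"
      by (rule integral_unique[OF has_integral_mult_left[OF hE]])
    finally have *: "K * E r \<le> c + (E r - 1) / 2 * K" by simp
    have "integral {a..r} m \<ge> 0" using m(2) r(1) by (intro integral_nonneg sub) auto
    then have "E r \<ge> 1" by (simp add: E_def)
    show ?thesis
    proof (rule ccontr)
      assume "\<not> K \<le> 2 * c"
      \<comment> \<open>Since \<open>c\<close> is nonnegative, a failure of the claim forces
        \<open>K\<close> to be positive.\<close>
      then have "K > 0" using c by linarith
      have "K * (E r + 1) \<le> 2 * c" using * by (simp add: field_simps)
      moreover have "K * 1 \<le> K * (E r + 1)" using \<open>K > 0\<close> \<open>E r \<ge> 1\<close> by (intro mult_left_mono) auto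
      ultimately show False using \<open>\<not> K \<le> 2 * c\<close> by simp
    qed
  qed
  have "E t \<le> E b" unfolding E_def using t m
    by (auto intro!: integral_subset_le intro: integrable_on_subinterval[OF m(1)])
  have "\<phi> t \<le> K * E t" by (rule K[OF t])
  also have "\<dots> \<le> 2 * c * E t" using \<open>K \<le> 2 * c\<close> E0[of t] by (intro mult_right_mono) auto
  also have "\<dots> \<le> 2 * c * E b" using c \<open>E t \<le> E b\<close> by (intro mult_left_mono) auto
  finally show ?thesis by (simp add: E_def)
qed

text \<open>Time reversal of the forward bound, for the adjoint, whose value is prescribed at the
  final time.\<close>

lemma gronwall_integral_backward:
  fixes \<phi> m :: "real \<Rightarrow> real"
  assumes m: "m integrable_on {a..b}" "\<And>t. t \<in> {a..b} \<Longrightarrow> 0 \<le> m t"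
    and \<phi>: "continuous_on {a..b} \<phi>" and c: "0 \<le> c"
    and le: "\<And>t. t \<in> {a..b} \<Longrightarrow> \<phi> t \<le> c + integral {t..b} (\<lambda>s. m s * \<phi> s)"
    and t: "t \<in> {a..b}"
  shows "\<phi> t \<le> 2 * c * exp (2 * integral {a..b} m)"
proof -
  have "(\<lambda>s. \<phi> (- s)) (- t) \<le> 2 * c * exp (2 * integral {-b..-a} (\<lambda>s. m (- s)))"
  proof (rule gronwall_integral[where a = "-b" and b = "-a" and m = "\<lambda>s. m (- s)" and \<phi> = "\<lambda>s. \<phi> (- s)"])
    show "(\<lambda>s. m (- s)) integrable_on {- b..- a}" using m(1) Henstock_Kurzweil_Integration.integrable_reflect_real[of m b a] by blast
    show "continuous_on {- b..- a} (\<lambda>s. \<phi> (- s))"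
      by (rule continuous_on_compose2[OF \<phi>]) (auto intro!: continuous_intros)
    fix s assume "s \<in> {-b..-a}"
    then have "\<phi> (- s) \<le> c + integral {-s..b} (\<lambda>s. m s * \<phi> s)" using le[of "-s"] by auto
    also have "integral {-s..b} (\<lambda>s. m s * \<phi> s) = integral {-b..s} (\<lambda>s. m (- s) * \<phi> (- s))"
      using Henstock_Kurzweil_Integration.integral_reflect_real[of b "-s" "\<lambda>s. m s * \<phi> s"]
      unfolding minus_minus by (rule sym)
    finally show "\<phi> (- s) \<le> c + integral {-b..s} (\<lambda>s. m (- s) * \<phi> (- s))" .
  qed (use t m c in auto)
  then show ?thesis by simp
qed

lemma abs_continuous_on_subinterval:
  assumes ac: "abs_continuous_on a b f" and "a \<le> c" "d \<le> b"
  shows "abs_continuous_on c d f"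
  unfolding abs_continuous_on_def
proof (intro allI impI)
  fix \<epsilon> :: real assume "\<epsilon> > 0"
  from abs_continuous_onD[OF ac this] obtain \<delta> where \<delta>: "\<delta> > 0"
    "\<And>D. finite D \<Longrightarrow> (\<And>s t. (s,t) \<in> D \<Longrightarrow> a \<le> s \<and> s \<le> t \<and> t \<le> b) \<Longrightarrow>
       disjoint_family_on (\<lambda>(s,t). {s<..<t}) D \<Longrightarrow> (\<Sum>(s,t)\<in>D. t - s) < \<delta>
       \<Longrightarrow> (\<Sum>(s,t)\<in>D. norm (f t - f s)) < \<epsilon>"
    by blast
  show "\<exists>\<delta>>0. \<forall>D. finite D \<and> (\<forall>(s,t)\<in>D. c \<le> s \<and> s \<le> t \<and> t \<le> d) \<and>
         disjoint_family_on (\<lambda>(s,t). {s<..<t}) D \<and> (\<Sum>(s,t)\<in>D. t - s) < \<delta>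
         \<longrightarrow> (\<Sum>(s,t)\<in>D. norm (f t - f s)) < \<epsilon>"
  proof (intro exI[of _ \<delta>] conjI allI impI)
    fix D assume D: "finite D \<and> (\<forall>(s,t)\<in>D. c \<le> s \<and> s \<le> t \<and> t \<le> d) \<and>
         disjoint_family_on (\<lambda>(s,t). {s<..<t}) D \<and> (\<Sum>(s,t)\<in>D. t - s) < \<delta>"
    have "a \<le> s \<and> s \<le> t \<and> t \<le> b" if "(s,t) \<in> D" for s t
      using D that assms(2,3) by fastforce
    then show "(\<Sum>(s,t)\<in>D. norm (f t - f s)) < \<epsilon>" by (rule \<delta>(2)[rotated]) (use D in auto)
  qed (rule \<delta>(1))
qed

text \<open>\<open>m\<close> is the growth rate and \<open>e\<close> the forcing. The forward bound
  serves differences of states, the backward one differences of adjoints. Both follow by integrating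
  the derivative and applying Gronwall to the norm.\<close>

lemma abs_continuous_growth:
  fixes d :: "real \<Rightarrow> 'a::euclidean_space"
  assumes ac: "abs_continuous_on a b d"
    and m: "m integrable_on {a..b}" "\<And>t. t \<in> {a..b} \<Longrightarrow> 0 \<le> m t"
    and e: "e integrable_on {a..b}" "\<And>t. t \<in> {a..b} \<Longrightarrow> 0 \<le> e t"
    and N: "negligible N" and der: "\<And>t. t \<in> {a..b} - N \<Longrightarrow> (d has_vector_derivative D t) (at t within {a..b})"
    and le: "\<And>t. t \<in> {a..b} - N \<Longrightarrow> norm (D t) \<le> m t * norm (d t) + e t"
    and t: "t \<in> {a..b}"
  shows "norm (d t) \<le> 2 * (norm (d a) + integral {a..b} e) * exp (2 * integral {a..b} m)" (is ?forward)
    and "norm (d t) \<le> 2 * (norm (d b) + integral {a..b} e) * exp (2 * integral {a..b} m)" (is ?backward)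
proof -
  have cont: "continuous_on {a..b} d" using ac by (rule abs_continuous_on_imp_continuous_on)
  have md: "(\<lambda>s. m s * norm (d s)) integrable_on {a..b}"
    by (intro integrable_on_mult_continuous m continuous_intros cont)
  have I: "integral {a..b} e \<ge> 0" using e by (intro integral_nonneg) auto
  have ab: "a \<le> b" using t by simp
  have hk: "(D has_integral (d y - d x)) {x..y}" if "a \<le> x" "x \<le> y" "y \<le> b" for x y
  proof (rule fundamental_theorem_of_calculus_abs_continuous[OF that(2) _ N])
    show "abs_continuous_on x y d" using ac by (rule abs_continuous_on_subinterval) (use that in auto)
    fix s assume "s \<in> {x..y} - N"
    then show "(d has_vector_derivative D s) (at s within {x..y})"
      using der[of s] that by (intro has_vector_derivative_within_subset[OF der[of s]]) auto
  qed
  have est: "norm (d y - d x) \<le> integral {a..b} e + integral {x..y} (\<lambda>s. m s * norm (d s))"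
    if "a \<le> x" "x \<le> y" "y \<le> b" for x y
  proof -
    \<comment> \<open>The comparison of integrals asks for a bound at every point, but the bound on
      \<open>D\<close> is known only off \<open>N\<close>; the derivative is therefore reset to 0 on
      \<open>N\<close>.\<close>
    define D' where "D' s = (if s \<in> N then 0 else D s)" for s
    have h: "(D' has_integral (d y - d x)) {x..y}"
      by (rule has_integral_spike[OF N _ hk[OF that]]) (auto simp: D'_def)
    have i: "e integrable_on {x..y}" "(\<lambda>s. m s * norm (d s)) integrable_on {x..y}"
      using that by (auto intro: integrable_on_subinterval[OF e(1)] integrable_on_subinterval[OF md])
    have "norm (d y - d x) = norm (integral {x..y} D')" using h by (simp add: integral_unique)
    also have "\<dots> \<le> integral {x..y} (\<lambda>s. e s + m s * norm (d s))"
    proof (rule integral_norm_bound_integral)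
      show "D' integrable_on {x..y}" using h by blast
      show "(\<lambda>s. e s + m s * norm (d s)) integrable_on {x..y}" using i by (intro integrable_add)
      fix s assume "s \<in> {x..y}"
      then show "norm (D' s) \<le> e s + m s * norm (d s)"
        using le[of s] e(2)[of s] m(2)[of s] that by (auto simp: D'_def add.commute)
    qed
    also have "\<dots> = integral {x..y} e + integral {x..y} (\<lambda>s. m s * norm (d s))"
      using i by (rule Henstock_Kurzweil_Integration.integral_add)
    also have "integral {x..y} e \<le> integral {a..b} e"
      using i e that by (intro integral_subset_le) auto
    finally show ?thesis by simp
  qed
  show ?forward
  proof (rule gronwall_integral[OF m, where \<phi> = "\<lambda>t. norm (d t)"])
    fix s assume s: "s \<in> {a..b}"
    have "norm (d s) \<le> norm (d a) + norm (d s - d a)"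
      by (metis add.commute norm_triangle_sub)
    then show "norm (d s) \<le> norm (d a) + integral {a..b} e + integral {a..s} (\<lambda>s. m s * norm (d s))"
      using est[of a s] s by simp
  qed (use t I in \<open>auto intro!: continuous_intros cont\<close>)
  show ?backward
  proof (rule gronwall_integral_backward[OF m, where \<phi> = "\<lambda>t. norm (d t)"])
    fix s assume s: "s \<in> {a..b}"
    have "norm (d s) \<le> norm (d b) + norm (d b - d s)"
      by (metis norm_minus_commute norm_triangle_sub)
    then show "norm (d s) \<le> norm (d b) + integral {a..b} e + integral {s..b} (\<lambda>s. m s * norm (d s))"
      using est[of s b] s by simp
  qed (use t I in \<open>auto intro!: continuous_intros cont\<close>)
qed

text \<open>
  With \<open>E t = exp (2 \<integral>\<^sub>a\<^sup>t m)\<close>, the substitution \<open>x = E y\<close> turns the Picard operator into a contraction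
  with factor 1/2 in the sup norm on the whole interval.
\<close>

lemma integral_equation_exists:
  fixes f :: "real \<Rightarrow> 'a::euclidean_space \<Rightarrow> 'a"
  assumes ab: "a \<le> b" and m: "m integrable_on {a..b}" "\<And>t. t \<in> {a..b} \<Longrightarrow> 0 \<le> m t"
    and lip: "\<And>t x y. t \<in> {a..b} \<Longrightarrow> norm (f t x - f t y) \<le> m t * norm (x - y)"
    and int: "\<And>x. continuous_on {a..b} x \<Longrightarrow> (\<lambda>t. f t (x t)) integrable_on {a..b}"
  shows "\<exists>x. continuous_on {a..b} x \<and> (\<forall>t\<in>{a..b}. x t = x0 + integral {a..t} (\<lambda>s. f s (x s)))"
proof -
  define E where "E t = exp (2 * integral {a..t} m)" for t
  have E0: "E t > 0" for t by (simp add: E_def)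
  have cE: "continuous_on {a..b} E"
    unfolding E_def by (intro continuous_intros indefinite_integral_continuous_1 m)
  \<comment> \<open>The fixed point is sought among bounded continuous functions on the whole line;
    freezing time at the endpoints extends a curve on \<open>{a..b}\<close> to such a
    function.\<close>
  define cl where "cl t = max a (min b t)" for t
  have cl: "cl t \<in> {a..b}" "continuous_on UNIV cl" for t
    using ab by (auto simp: cl_def intro!: continuous_intros)
  have cl_id: "cl t = t" if "t \<in> {a..b}" for t using that by (auto simp: cl_def)
  define V where "V y s = E s *\<^sub>R (apply_bcontfun y s :: 'a)" for y s
  have cV: "continuous_on {a..b} (V y)" for y
    unfolding V_def by (intro continuous_on_scaleR continuous_on_apply_bcontfun cE)
  define T where "T y t = inverse (E t) *\<^sub>R (x0 + integral {a..t} (\<lambda>s. f s (V y s)))" for y t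
  have cT: "continuous_on {a..b} (T y)" for y
    unfolding T_def using E0 by (intro continuous_intros cE indefinite_integral_continuous_1 int cV) (metis less_irrefl)
  have bT: "(\<lambda>t. T y (cl t)) \<in> bcontfun" for y
  proof -
    have "bounded (T y ` {a..b})" using cT by (intro compact_imp_bounded compact_continuous_image) auto
    then obtain B where "\<And>t. t \<in> {a..b} \<Longrightarrow> norm (T y t) \<le> B" unfolding bounded_iff by (meson imageI)
    then show ?thesis
      by (intro bcontfun_normI[where b = B] continuous_on_compose2[OF cT cl(2)]) (use cl(1) in auto)
  qed
  define \<Phi> where "\<Phi> y = Bcontfun (\<lambda>t. T y (cl t))" for y
  have app: "apply_bcontfun (\<Phi> y) t = T y (cl t)" for y t
    unfolding \<Phi>_def using bT by (simp add: Bcontfun_inverse)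
  have "\<exists>!y. \<Phi> y = y"
  proof (rule banach_fix_type[where c = "1/2"], simp, simp, intro allI)
    fix y z
    show "dist (\<Phi> y) (\<Phi> z) \<le> 1/2 * dist y z"
    proof (rule dist_bound)
      fix t'
      define t where "t = cl t'"
      have t: "t \<in> {a..b}" using cl by (simp add: t_def)
      have sub: "m integrable_on {a..t}" using t by (auto intro: integrable_on_subinterval[OF m(1)])
      have i: "(\<lambda>s. f s (V y s)) integrable_on {a..t}" for y
        using t by (auto intro: integrable_on_subinterval[OF int[OF cV]])
      have hE: "((\<lambda>s. m s * E s) has_integral (E t - 1) / 2) {a..t}"
        using has_integral_exp_integral[OF _ sub] t m(2) by (simp add: E_def)
      note hE' = has_integral_mult_left[OF hE, of "dist y z"]
      have "norm (integral {a..t} (\<lambda>s. f s (V y s)) - integral {a..t} (\<lambda>s. f s (V z s)))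
          = norm (integral {a..t} (\<lambda>s. f s (V y s) - f s (V z s)))"
        using i by (simp add: Henstock_Kurzweil_Integration.integral_diff)
      also have "\<dots> \<le> integral {a..t} (\<lambda>s. m s * E s * dist y z)"
      proof (rule integral_norm_bound_integral)
        show "(\<lambda>s. f s (V y s) - f s (V z s)) integrable_on {a..t}" using i by (intro integrable_diff)
        show "(\<lambda>s. m s * E s * dist y z) integrable_on {a..t}" using hE' by blast
        fix s assume "s \<in> {a..t}"
        then have s: "s \<in> {a..b}" using t by auto
        have "norm (f s (V y s) - f s (V z s)) \<le> m s * norm (V y s - V z s)" by (rule lip[OF s])
        also have "norm (V y s - V z s) = E s * norm (apply_bcontfun y s - apply_bcontfun z s)"
          using E0[of s] unfolding V_def by (metis abs_of_pos norm_scaleR scaleR_diff_right)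
        also have "m s * \<dots> \<le> m s * (E s * dist y z)"
          using m(2)[OF s] E0[of s] dist_bounded[of y s z]
          by (intro mult_left_mono) (auto simp: dist_norm)
        finally show "norm (f s (V y s) - f s (V z s)) \<le> m s * E s * dist y z" by (simp add: mult.assoc)
      qed
      also have "\<dots> = (E t - 1) / 2 * dist y z" using hE' by (rule integral_unique)
      also have "\<dots> \<le> E t * (1/2 * dist y z)" by (simp add: field_simps)
      finally have *: "norm (integral {a..t} (\<lambda>s. f s (V y s)) - integral {a..t} (\<lambda>s. f s (V z s))) \<le> E t * (1/2 * dist y z)" .
      have "dist (apply_bcontfun (\<Phi> y) t') (apply_bcontfun (\<Phi> z) t') = norm (T y t - T z t)"
        by (simp add: app dist_norm t_def)
      also have "T y t - T z t = inverse (E t) *\<^sub>R (integral {a..t} (\<lambda>s. f s (V y s)) - integral {a..t} (\<lambda>s. f s (V z s)))"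
        by (simp add: T_def algebra_simps)
      also have "norm \<dots> = inverse (E t) * norm (integral {a..t} (\<lambda>s. f s (V y s)) - integral {a..t} (\<lambda>s. f s (V z s)))"
        using E0[of t] by simp
      also have "\<dots> \<le> inverse (E t) * (E t * (1/2 * dist y z))"
        using E0[of t] * by (intro mult_left_mono) auto
      also have "\<dots> = 1/2 * dist y z" using E0[of t] by simp
      finally show "dist (apply_bcontfun (\<Phi> y) t') (apply_bcontfun (\<Phi> z) t') \<le> 1/2 * dist y z" .
    qed
  qed
  then obtain y where y: "\<Phi> y = y" by blast
  show ?thesis
  proof (intro exI[of _ "V y"] conjI ballI)
    show "continuous_on {a..b} (V y)" by (rule cV)
    fix t assume t: "t \<in> {a..b}"
    have "apply_bcontfun y t = T y t" using app[of y t] y cl_id[OF t] by simp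
    then show "V y t = x0 + integral {a..t} (\<lambda>s. f s (V y s))"
      using E0[of t] unfolding V_def[of y t] T_def by simp
  qed
qed

section \<open>State trajectories\<close>

lemma bounded_bilinear_matrix_vector_mult:
  "bounded_bilinear (\<lambda>(A :: real^'n^'m) x. A *v x)"
  unfolding bilinear_conv_bounded_bilinear[symmetric] bilinear_def
  by (auto intro!: linearI simp: algebra_simps scaleR_matrix_vector_assoc[symmetric])

lemma bounded_bilinear_vector_matrix_mult:
  "bounded_bilinear ((v*) :: real^'m \<Rightarrow> real^'n^'m \<Rightarrow> real^'n)"
  unfolding bilinear_conv_bounded_bilinear[symmetric] bilinear_def
  by (auto intro!: linearI simp: algebra_simps scaleR_vector_matrix_assoc vector_scaleR_matrix_ac)

text \<open>Regularity of \<open>F\<close> is assumed column by column, so estimates on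
  \<open>F *v w\<close> pass through this expansion.\<close>

lemma matrix_vector_mult_eq_sum_columns:
  "(A :: real^'k^'n) *v w = (\<Sum>i\<in>UNIV. (w $ i) *\<^sub>R column i A)"
  by (simp add: matrix_mult_sum scalar_mult_eq_scaleR)

lemma norm_sum_scaleR_le:
  fixes w :: "real^'k" and c :: "'k \<Rightarrow> 'a::real_normed_vector"
  assumes "\<And>i. norm (c i) \<le> B"
  shows "norm (\<Sum>i\<in>UNIV. (w $ i) *\<^sub>R c i) \<le> real CARD('k) * norm w * B"
proof -
  have "norm (\<Sum>i\<in>UNIV. (w $ i) *\<^sub>R c i) \<le> (\<Sum>i\<in>(UNIV::'k set). norm w * B)"
  proof (rule sum_norm_le)
    fix i
    show "norm ((w $ i) *\<^sub>R c i) \<le> norm w * B"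
      using assms[of i] component_le_norm_cart[of w i] by (auto intro!: mult_mono)
  qed
  then show ?thesis by (simp add: mult.assoc)
qed

lemma L2_controls_measurable: "w \<in> L2_controls \<Longrightarrow> w \<in> borel_measurable (lebesgue_on {0..1})"
  by (simp add: L2_controls_def)

lemma L2_controls_norm_integrable:
  assumes "w \<in> L2_controls"
  shows "(\<lambda>t. norm (w t)) integrable_on {0..1}"
proof (rule measurable_bounded_by_integrable_imp_integrable_real)
  show "(\<lambda>t. norm (w t)) \<in> borel_measurable (lebesgue_on {0..1})"
    using L2_controls_measurable[OF assms] by measurable
  have "(\<lambda>t. (norm (w t))\<^sup>2) integrable_on {0..1}"
    using assms by (intro integrable_on_lebesgue_on) (auto simp: L2_controls_def)
  then show "(\<lambda>t. 1 + (norm (w t))\<^sup>2) integrable_on {0..1}"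
    by (intro integrable_add) auto
  fix t
  have "0 \<le> (norm (w t) - 1)\<^sup>2" by simp
  then have "2 * norm (w t) \<le> 1 + (norm (w t))\<^sup>2" by (simp add: power2_diff)
  then show "\<bar>norm (w t)\<bar> \<le> 1 + (norm (w t))\<^sup>2" using norm_ge_zero[of "w t"] by linarith
qed auto

text \<open>One statement for two later objects: the right-hand side along a continuous curve, and
  the linearised matrix along a trajectory. The coefficients are bounded by compactness, which
  leaves a majorant that is affine in \<open>norm (w t)\<close>.\<close>

lemma absolutely_integrable_control_affine:
  fixes w :: "real \<Rightarrow> real^'k" and g0 :: "real \<Rightarrow> 'a::euclidean_space"
  assumes w: "w \<in> L2_controls" and g0: "continuous_on {0..1} g0" and g: "\<And>i. continuous_on {0..1} (g i)"
  shows "(\<lambda>t. g0 t + (\<Sum>i\<in>UNIV. (w t $ i) *\<^sub>R g i t)) absolutely_integrable_on {0..1}"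
proof -
  have bnd: "\<exists>B. \<forall>t\<in>{0..1}. norm (h t) \<le> B" if "continuous_on {0..1} h" for h :: "real \<Rightarrow> 'a"
  proof -
    have "bounded (h ` {0..1})" using that by (intro compact_imp_bounded compact_continuous_image) auto
    then show ?thesis unfolding bounded_iff by (meson imageI)
  qed
  obtain B0 where B0: "\<And>t. t \<in> {0..1} \<Longrightarrow> norm (g0 t) \<le> B0" using bnd[OF g0] by blast
  obtain B1 where B1: "\<And>i t. t \<in> {0..1} \<Longrightarrow> norm (g i t) \<le> B1 i" using bnd[OF g] by metis
  define B where "B = Max (range B1)"
  have B: "norm (g i t) \<le> B" if "t \<in> {0..1}" for i t
    using B1[OF that, of i] by (rule order_trans) (simp add: B_def)
  show ?thesis
  proof (rule measurable_bounded_by_integrable_imp_absolutely_integrable)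
    have [measurable]: "g0 \<in> borel_measurable (lebesgue_on {0..1})" "g i \<in> borel_measurable (lebesgue_on {0..1})" for i
      using g0 g by (auto intro!: continuous_imp_measurable_on_sets_lebesgue)
    have [measurable]: "(\<lambda>t. w t $ i) \<in> borel_measurable (lebesgue_on {0..1})" for i
      by (rule measurable_compose[OF L2_controls_measurable[OF w]])
         (intro borel_measurable_continuous_onI continuous_on_component continuous_on_id)
    show "(\<lambda>t. g0 t + (\<Sum>i\<in>UNIV. (w t $ i) *\<^sub>R g i t)) \<in> borel_measurable (lebesgue_on {0..1})"
      by measurable
    show "(\<lambda>t. B0 + real CARD('k) * norm (w t) * B) integrable_on {0..1}"
      by (intro integrable_add integrable_on_mult_left integrable_on_mult_right L2_controls_norm_integrable w) auto
    fix t :: real assume t: "t \<in> {0..1}"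
    have "norm (\<Sum>i\<in>UNIV. (w t $ i) *\<^sub>R g i t) \<le> real CARD('k) * norm (w t) * B"
      by (rule norm_sum_scaleR_le) (rule B[OF t])
    then show "norm (g0 t + (\<Sum>i\<in>UNIV. (w t $ i) *\<^sub>R g i t)) \<le> B0 + real CARD('k) * norm (w t) * B"
      using B0[OF t] by (intro norm_triangle_mono)
  qed auto
qed

text \<open>The estimate in the parameter is uniform in \<open>t\<close>, and this upgrades separate
  to joint continuity. \<open>\<rho>\<close> may depend on the base parameter, as it does for the
  adjoint.\<close>

lemma continuous_on_Times_if_uniform:
  fixes G :: "'a::metric_space \<Rightarrow> 'b::metric_space \<Rightarrow> 'c::real_normed_vector"
  assumes c: "\<And>\<theta>. \<theta> \<in> \<Theta> \<Longrightarrow> continuous_on T (\<lambda>t. G t \<theta>)"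
    and u: "\<And>\<theta>. \<theta> \<in> \<Theta> \<Longrightarrow> (\<rho> \<theta> \<longlongrightarrow> 0) (at \<theta> within \<Theta>)"
    and le: "\<And>\<theta> \<theta>' t. \<theta> \<in> \<Theta> \<Longrightarrow> \<theta>' \<in> \<Theta> \<Longrightarrow> t \<in> T \<Longrightarrow> norm (G t \<theta>' - G t \<theta>) \<le> (\<rho> \<theta> \<theta>' :: real)"
  shows "continuous_on (T \<times> \<Theta>) (\<lambda>(t,\<theta>). G t \<theta>)"
  unfolding continuous_on_iff
proof (clarify)
  fix t \<theta> and e :: real assume t: "t \<in> T" and \<theta>: "\<theta> \<in> \<Theta>" and "e > 0"
  obtain d1 where d1: "d1 > 0" "\<And>t'. t' \<in> T \<Longrightarrow> dist t' t < d1 \<Longrightarrow> dist (G t' \<theta>) (G t \<theta>) < e/2"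
    using c[OF \<theta>] t \<open>e > 0\<close> unfolding continuous_on_iff by (metis half_gt_zero)
  have "eventually (\<lambda>\<theta>'. \<rho> \<theta> \<theta>' < e/2) (at \<theta> within \<Theta>)"
    by (rule order_tendstoD(2)[OF u[OF \<theta>]]) (use \<open>e > 0\<close> in simp)
  then obtain d2 where d2: "d2 > 0" "\<And>\<theta>'. \<theta>' \<in> \<Theta> \<Longrightarrow> \<theta>' \<noteq> \<theta> \<Longrightarrow> dist \<theta>' \<theta> < d2 \<Longrightarrow> \<rho> \<theta> \<theta>' < e/2"
    unfolding eventually_at by blast
  show "\<exists>d>0. \<forall>x'\<in>T \<times> \<Theta>. dist x' (t, \<theta>) < d \<longrightarrow> dist (case x' of (t, \<theta>) \<Rightarrow> G t \<theta>) (G t \<theta>) < e"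
  proof (intro exI[of _ "min d1 d2"] conjI ballI impI)
    show "min d1 d2 > 0" using d1 d2 by simp
    fix x' assume x': "x' \<in> T \<times> \<Theta>" "dist x' (t, \<theta>) < min d1 d2"
    obtain t' \<theta>' where e: "x' = (t',\<theta>')" by (cases x')
    have d: "dist t' t < d1" "dist \<theta>' \<theta> < d2" "t' \<in> T" "\<theta>' \<in> \<Theta>"
      using x' dist_fst_le[of x' "(t,\<theta>)"] dist_snd_le[of x' "(t,\<theta>)"] by (auto simp: e)
    have "dist (G t' \<theta>') (G t' \<theta>) < e/2"
    proof (cases "\<theta>' = \<theta>")
      case False
      then show ?thesis using d2(2)[OF d(4) False d(2)] le[OF \<theta> d(4,3)] by (simp add: dist_norm)
    qed (use \<open>e > 0\<close> in auto)
    moreover have "dist (G t' \<theta>') (G t \<theta>) \<le> dist (G t' \<theta>') (G t' \<theta>) + dist (G t' \<theta>) (G t \<theta>)"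
      by (rule dist_triangle)
    ultimately show "dist (case x' of (t, \<theta>) \<Rightarrow> G t \<theta>) (G t \<theta>) < e"
      unfolding e using d1(2)[OF d(3,1)] by simp
  qed
qed

section \<open>The state equation and its dependence on control and parameter\<close>

locale control_system =
  fixes \<Theta> :: "'p::euclidean_space set"
    and F0 :: "real^'n \<Rightarrow> 'p \<Rightarrow> real^'n"
    and F :: "real^'n \<Rightarrow> 'p \<Rightarrow> real^'k^'n"
    and x0 :: "'p \<Rightarrow> real^'n"
    and L :: real
  assumes compact_\<Theta>: "compact \<Theta>"
    and L_pos: "L > 0"
    and F0_lipschitz: "\<And>x1 x2 \<theta>1 \<theta>2. \<theta>1 \<in> \<Theta> \<Longrightarrow> \<theta>2 \<in> \<Theta> \<Longrightarrow>
           norm (F0 x1 \<theta>1 - F0 x2 \<theta>2) \<le> L * (norm (x1 - x2) + norm (\<theta>1 - \<theta>2))"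
    and F_lipschitz: "\<And>i x1 x2 \<theta>1 \<theta>2. \<theta>1 \<in> \<Theta> \<Longrightarrow> \<theta>2 \<in> \<Theta> \<Longrightarrow>
           norm (column i (F x1 \<theta>1) - column i (F x2 \<theta>2)) \<le> L * (norm (x1 - x2) + norm (\<theta>1 - \<theta>2))"
    and x0_continuous: "continuous_on \<Theta> x0"
begin

definition rhs :: "(real \<Rightarrow> real^'k) \<Rightarrow> 'p \<Rightarrow> real \<Rightarrow> real^'n \<Rightarrow> real^'n" where
  "rhs w \<theta> t x = F0 x \<theta> + F x \<theta> *v w t"

text \<open>The Lipschitz modulus of \<open>rhs w\<close> at time \<open>t\<close>, jointly in state
  and parameter. For a square integrable control it is integrable in time but possibly unbounded; it
  is the coefficient \<open>m\<close> of the Picard and Gronwall arguments for states.\<close>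

definition lip :: "(real \<Rightarrow> real^'k) \<Rightarrow> real \<Rightarrow> real" where
  "lip w t = L * (1 + real CARD('k) * norm (w t))"

abbreviation traj :: "(real \<Rightarrow> real^'k) \<Rightarrow> 'p \<Rightarrow> real \<Rightarrow> real^'n" where
  "traj \<equiv> trajectory F0 F x0"

lemma lip_nonneg: "0 \<le> lip w t"
  using L_pos by (simp add: lip_def)

lemma lip_integrable: "w \<in> L2_controls \<Longrightarrow> lip w integrable_on {0..1}"
  unfolding lip_def by (intro integrable_on_mult_right integrable_add L2_controls_norm_integrable) auto

lemma rhs_lipschitz:
  assumes "\<theta>1 \<in> \<Theta>" "\<theta>2 \<in> \<Theta>"
  shows "norm (rhs w \<theta>1 t x1 - rhs w \<theta>2 t x2) \<le> lip w t * (norm (x1 - x2) + norm (\<theta>1 - \<theta>2))"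
proof -
  let ?D = "norm (x1 - x2) + norm (\<theta>1 - \<theta>2)"
  have "F x1 \<theta>1 *v w t - F x2 \<theta>2 *v w t = (\<Sum>i\<in>UNIV. (w t $ i) *\<^sub>R (column i (F x1 \<theta>1) - column i (F x2 \<theta>2)))"
    by (simp add: matrix_vector_mult_eq_sum_columns scaleR_diff_right sum_subtractf)
  then have "norm (F x1 \<theta>1 *v w t - F x2 \<theta>2 *v w t) \<le> real CARD('k) * norm (w t) * (L * ?D)"
    using norm_sum_scaleR_le[of "\<lambda>i. column i (F x1 \<theta>1) - column i (F x2 \<theta>2)" "L * ?D" "w t"] F_lipschitz[OF assms]
    by simp
  moreover have "rhs w \<theta>1 t x1 - rhs w \<theta>2 t x2 = (F0 x1 \<theta>1 - F0 x2 \<theta>2) + (F x1 \<theta>1 *v w t - F x2 \<theta>2 *v w t)"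
    by (simp add: rhs_def)
  ultimately have "norm (rhs w \<theta>1 t x1 - rhs w \<theta>2 t x2) \<le> L * ?D + real CARD('k) * norm (w t) * (L * ?D)"
    using F0_lipschitz[OF assms, of x1 x2] norm_triangle_mono by metis
  then show ?thesis by (simp add: lip_def algebra_simps)
qed

lemma continuous_on_F0:
  assumes "\<And>s. s \<in> S \<Longrightarrow> \<theta> s \<in> \<Theta>" "continuous_on S x" "continuous_on S \<theta>"
  shows "continuous_on S (\<lambda>s. F0 (x s) (\<theta> s))"
proof -
  have "((\<lambda>s'. F0 (x s') (\<theta> s')) \<longlongrightarrow> F0 (x s) (\<theta> s)) (at s within S)" if "s \<in> S" for s
  proof (rule metric_tendsto_imp_tendsto)
    have "((\<lambda>s'. L * (norm (x s' - x s) + norm (\<theta> s' - \<theta> s))) \<longlongrightarrow> L * (norm (x s - x s) + norm (\<theta> s - \<theta> s))) (at s within S)"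
      using assms(2,3) that by (intro tendsto_intros) (auto simp: continuous_on_def)
    then show "((\<lambda>s'. L * (norm (x s' - x s) + norm (\<theta> s' - \<theta> s))) \<longlongrightarrow> 0) (at s within S)" by simp
    show "\<forall>\<^sub>F s' in at s within S. dist (F0 (x s') (\<theta> s')) (F0 (x s) (\<theta> s)) \<le> dist (L * (norm (x s' - x s) + norm (\<theta> s' - \<theta> s))) 0"
      unfolding eventually_at_filter
    proof (rule always_eventually, intro allI impI)
      fix s' assume "s' \<in> S"
      have "dist (F0 (x s') (\<theta> s')) (F0 (x s) (\<theta> s)) \<le> L * (norm (x s' - x s) + norm (\<theta> s' - \<theta> s))"
        unfolding dist_norm by (intro F0_lipschitz assms that \<open>s' \<in> S\<close>)
      then show "dist (F0 (x s') (\<theta> s')) (F0 (x s) (\<theta> s)) \<le> dist (L * (norm (x s' - x s) + norm (\<theta> s' - \<theta> s))) 0"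
        by simp
    qed
  qed
  then show ?thesis by (simp add: continuous_on_def)
qed

lemma continuous_on_column_F:
  assumes "\<And>s. s \<in> S \<Longrightarrow> \<theta> s \<in> \<Theta>" "continuous_on S x" "continuous_on S \<theta>"
  shows "continuous_on S (\<lambda>s. column i (F (x s) (\<theta> s)))"
proof -
  \<comment> \<open>Column \<open>i\<close> satisfies the hypotheses made on the drift, so it can
    take the place of \<open>F0\<close> and the previous lemma applies.\<close>
  interpret C: control_system \<Theta> "\<lambda>x \<theta>. column i (F x \<theta>)" F x0 L
    by unfold_locales (fact compact_\<Theta> L_pos F_lipschitz x0_continuous)+
  show ?thesis by (rule C.continuous_on_F0[OF assms])
qed

lemma rhs_absolutely_integrable:
  assumes "w \<in> L2_controls" "\<theta> \<in> \<Theta>" "continuous_on {0..1} x"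
  shows "(\<lambda>t. rhs w \<theta> t (x t)) absolutely_integrable_on {0..1}"
  unfolding rhs_def matrix_vector_mult_eq_sum_columns
  by (intro absolutely_integrable_control_affine continuous_on_F0 continuous_on_column_F assms continuous_intros)

text \<open>Provides the witness for the choice in \<open>trajectory\<close>. The Picard fixed point
  is an indefinite integral up to a constant, hence absolutely continuous and differentiable almost
  everywhere.\<close>

lemma state_solution_exists:
  assumes w: "w \<in> L2_controls" and \<theta>: "\<theta> \<in> \<Theta>"
  shows "\<exists>x. state_solution F0 F x0 w \<theta> x"
proof -
  have "\<exists>x. continuous_on {0..1} x \<and> (\<forall>t\<in>{0..1}. x t = x0 \<theta> + integral {0..t} (\<lambda>s. rhs w \<theta> s (x s)))"
  proof (rule integral_equation_exists[where m = "lip w"])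
    show "norm (rhs w \<theta> t x - rhs w \<theta> t y) \<le> lip w t * norm (x - y)" for t x y
      using rhs_lipschitz[OF \<theta> \<theta>, of w t x y] by simp
    show "(\<lambda>t. rhs w \<theta> t (x t)) integrable_on {0..1}" if "continuous_on {0..1} x" for x
      using rhs_absolutely_integrable[OF w \<theta> that] by (rule set_lebesgue_integral_eq_integral(1))
  qed (auto simp: lip_nonneg lip_integrable w)
  then obtain x where x: "continuous_on {0..1} x"
    "\<And>t. t \<in> {0..1} \<Longrightarrow> x t = x0 \<theta> + integral {0..t} (\<lambda>s. rhs w \<theta> s (x s))" by blast
  define f where "f s = rhs w \<theta> s (x s)" for s
  have f: "f absolutely_integrable_on {0..1}"
    unfolding f_def using rhs_absolutely_integrable[OF w \<theta> x(1)] .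
  have xt: "x t = x0 \<theta> + integral {0..t} f" if "t \<in> {0..1}" for t
    using x(2)[OF that] by (simp add: f_def[abs_def])
  note acI = abs_continuous_on_integral[OF f]
  have ac: "abs_continuous_on 0 1 x"
    by (rule abs_continuous_on_compose2[OF acI acI, where C = 1]) (simp add: xt)
  obtain N where N: "negligible N"
    "\<And>t. t \<in> {0..1} - N \<Longrightarrow> ((\<lambda>t. integral {0..t} f) has_vector_derivative f t) (at t within {0..1})"
    using integral_has_vector_derivative_almost_everywhere[OF set_lebesgue_integral_eq_integral(1)[OF f]] by blast
  have "(x has_vector_derivative f t) (at t within {0..1})" if t: "t \<in> {0..1} - N" for t
  proof (rule has_vector_derivative_transform)
    show "((\<lambda>t. x0 \<theta> + integral {0..t} f) has_vector_derivative f t) (at t within {0..1})"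
      using N(2)[OF t] by (auto intro!: derivative_eq_intros)
  qed (use t xt in auto)
  then have "AE t in lebesgue_on {0..1}. (x has_vector_derivative f t) (at t within {0..1})"
    using N(1) by (subst AE_lebesgue_on_iff_negligible) auto
  then show ?thesis
    unfolding state_solution_def using ac xt[of 0] by (auto simp: f_def rhs_def)
qed

lemma traj_props:
  assumes w: "w \<in> L2_controls" and \<theta>: "\<theta> \<in> \<Theta>"
  shows traj_abs_continuous: "abs_continuous_on 0 1 (traj w \<theta>)"
    and traj_0: "traj w \<theta> 0 = x0 \<theta>"
    and traj_derivative: "\<exists>N. negligible N \<and> (\<forall>t\<in>{0..1} - N. (traj w \<theta> has_vector_derivative rhs w \<theta> t (traj w \<theta> t)) (at t within {0..1}))"
proof -
  have "state_solution F0 F x0 w \<theta> (traj w \<theta>)"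
    unfolding trajectory_def by (rule someI_ex[OF state_solution_exists[OF w \<theta>]])
  then show "abs_continuous_on 0 1 (traj w \<theta>)" "traj w \<theta> 0 = x0 \<theta>"
    "\<exists>N. negligible N \<and> (\<forall>t\<in>{0..1} - N. (traj w \<theta> has_vector_derivative rhs w \<theta> t (traj w \<theta> t)) (at t within {0..1}))"
    by (auto simp: state_solution_def AE_lebesgue_on_iff_negligible rhs_def)
qed

lemmas traj_continuous = abs_continuous_on_imp_continuous_on[OF traj_abs_continuous]

text \<open>\<open>e\<close> bounds the residual of the first trajectory in the second equation, so
  only the second control enters the exponent. Changes of parameter and changes of control are both
  instances.\<close>

lemma traj_diff_bound:
  assumes w: "w1 \<in> L2_controls" "w2 \<in> L2_controls" and \<theta>: "\<theta>1 \<in> \<Theta>" "\<theta>2 \<in> \<Theta>"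
    and e: "e integrable_on {0..1}"
    and le: "\<And>t. t \<in> {0..1} \<Longrightarrow> norm (rhs w2 \<theta>2 t (traj w1 \<theta>1 t) - rhs w1 \<theta>1 t (traj w1 \<theta>1 t)) \<le> e t"
    and t: "t \<in> {0..1}"
  shows "norm (traj w2 \<theta>2 t - traj w1 \<theta>1 t)
    \<le> 2 * (norm (x0 \<theta>2 - x0 \<theta>1) + integral {0..1} e) * exp (2 * integral {0..1} (lip w2))"
proof -
  obtain N1 where N1: "negligible N1"
    "\<And>t. t \<in> {0..1} - N1 \<Longrightarrow> (traj w1 \<theta>1 has_vector_derivative rhs w1 \<theta>1 t (traj w1 \<theta>1 t)) (at t within {0..1})"
    using traj_derivative[OF w(1) \<theta>(1)] by blast
  obtain N2 where N2: "negligible N2"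
    "\<And>t. t \<in> {0..1} - N2 \<Longrightarrow> (traj w2 \<theta>2 has_vector_derivative rhs w2 \<theta>2 t (traj w2 \<theta>2 t)) (at t within {0..1})"
    using traj_derivative[OF w(2) \<theta>(2)] by blast
  let ?D = "\<lambda>t. rhs w2 \<theta>2 t (traj w2 \<theta>2 t) - rhs w1 \<theta>1 t (traj w1 \<theta>1 t)"
  have "norm (traj w2 \<theta>2 t - traj w1 \<theta>1 t)
    \<le> 2 * (norm (traj w2 \<theta>2 0 - traj w1 \<theta>1 0) + integral {0..1} e) * exp (2 * integral {0..1} (lip w2))"
  proof (rule abs_continuous_growth(1)[where d = "\<lambda>t. traj w2 \<theta>2 t - traj w1 \<theta>1 t" and N = "N1 \<union> N2" and D = ?D])
    show "abs_continuous_on 0 1 (\<lambda>t. traj w2 \<theta>2 t - traj w1 \<theta>1 t)"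
      by (intro abs_continuous_on_diff traj_abs_continuous w \<theta>)
    show "negligible (N1 \<union> N2)" using N1 N2 by simp
    fix t assume t: "t \<in> {0..1} - (N1 \<union> N2)"
    show "((\<lambda>t. traj w2 \<theta>2 t - traj w1 \<theta>1 t) has_vector_derivative ?D t) (at t within {0..1})"
      using t by (intro has_vector_derivative_diff N1(2) N2(2)) auto
    have "norm (rhs w2 \<theta>2 t (traj w2 \<theta>2 t) - rhs w2 \<theta>2 t (traj w1 \<theta>1 t)) \<le> lip w2 t * norm (traj w2 \<theta>2 t - traj w1 \<theta>1 t)"
      using rhs_lipschitz[OF \<theta>(2) \<theta>(2), of w2 t "traj w2 \<theta>2 t" "traj w1 \<theta>1 t"] by simp
    moreover have "norm (rhs w2 \<theta>2 t (traj w1 \<theta>1 t) - rhs w1 \<theta>1 t (traj w1 \<theta>1 t)) \<le> e t"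
      using le t by simp
    moreover have "?D t = (rhs w2 \<theta>2 t (traj w2 \<theta>2 t) - rhs w2 \<theta>2 t (traj w1 \<theta>1 t))
        + (rhs w2 \<theta>2 t (traj w1 \<theta>1 t) - rhs w1 \<theta>1 t (traj w1 \<theta>1 t))" by simp
    ultimately show "norm (?D t) \<le> lip w2 t * norm (traj w2 \<theta>2 t - traj w1 \<theta>1 t) + e t"
      by (metis norm_triangle_mono)
  next
    fix t assume "t \<in> {0..1::real}"
    then show "0 \<le> e t" by (rule order_trans[OF norm_ge_zero le])
  qed (use t e lip_nonneg lip_integrable w in auto)
  then show ?thesis using traj_0 w \<theta> by simp
qed

lemma traj_param_bound:
  assumes w: "w \<in> L2_controls" and \<theta>: "\<theta>1 \<in> \<Theta>" "\<theta>2 \<in> \<Theta>" and t: "t \<in> {0..1}"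
  shows "norm (traj w \<theta>2 t - traj w \<theta>1 t) \<le> 2 * (norm (x0 \<theta>2 - x0 \<theta>1) + integral {0..1} (lip w) * norm (\<theta>2 - \<theta>1))
      * exp (2 * integral {0..1} (lip w))"
  using traj_diff_bound[OF w w \<theta> _ _ t, of "\<lambda>t. lip w t * norm (\<theta>2 - \<theta>1)"]
    rhs_lipschitz[OF \<theta>(2,1), of w] lip_integrable[OF w]
  by (simp add: integrable_on_mult_left) (metis add_0 diff_self norm_zero)

lemma traj_continuous_on_Times:
  assumes w: "w \<in> L2_controls"
  shows "continuous_on ({0..1} \<times> \<Theta>) (\<lambda>(t,\<theta>). traj w \<theta> t)"
proof (rule continuous_on_Times_if_uniform)
  show "continuous_on {0..1} (traj w \<theta>)" if "\<theta> \<in> \<Theta>" for \<theta>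
    by (rule traj_continuous[OF w that])
  let ?\<rho> = "\<lambda>\<theta> \<theta>'. 2 * (norm (x0 \<theta>' - x0 \<theta>) + integral {0..1} (lip w) * norm (\<theta>' - \<theta>)) * exp (2 * integral {0..1} (lip w))"
  show "norm (traj w \<theta>' t - traj w \<theta> t) \<le> ?\<rho> \<theta> \<theta>'" if "\<theta> \<in> \<Theta>" "\<theta>' \<in> \<Theta>" "t \<in> {0..1}" for \<theta> \<theta>' t
    by (rule traj_param_bound[OF w that])
  fix \<theta> assume "\<theta> \<in> \<Theta>"
  have "(?\<rho> \<theta> \<longlongrightarrow> ?\<rho> \<theta> \<theta>) (at \<theta> within \<Theta>)"
    using x0_continuous \<open>\<theta> \<in> \<Theta>\<close> by (intro tendsto_intros) (auto simp: continuous_on_def)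
  then show "(?\<rho> \<theta> \<longlongrightarrow> 0) (at \<theta> within \<Theta>)" by simp
qed

lemma traj_bounded:
  assumes w: "w \<in> L2_controls"
  obtains B where "\<And>t \<theta>. t \<in> {0..1} \<Longrightarrow> \<theta> \<in> \<Theta> \<Longrightarrow> norm (traj w \<theta> t) \<le> B"
proof -
  have "bounded ((\<lambda>(t,\<theta>). traj w \<theta> t) ` ({0..1} \<times> \<Theta>))"
    by (intro compact_imp_bounded compact_continuous_image traj_continuous_on_Times w compact_Times compact_\<Theta> compact_Icc)
  then obtain B where "\<forall>x\<in>(\<lambda>(t,\<theta>). traj w \<theta> t) ` ({0..1} \<times> \<Theta>). norm x \<le> B" unfolding bounded_iff by blast
  then show ?thesis by (intro that[of B]) force
qed

end

section \<open>Continuous dependence of the adjoint on the parameter\<close>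

lemma has_derivative_gradient:
  fixes f :: "real^'n \<Rightarrow> real"
  assumes "f differentiable (at x)"
  shows "(f has_derivative (\<lambda>h. gradient f x \<bullet> h)) (at x)"
proof -
  have d: "(f has_derivative frechet_derivative f (at x)) (at x)"
    using assms by (simp add: frechet_derivative_works)
  then interpret l: bounded_linear "frechet_derivative f (at x)" by (rule has_derivative_bounded_linear)
  have "frechet_derivative f (at x) h = gradient f x \<bullet> h" for h
  proof -
    have "frechet_derivative f (at x) h = frechet_derivative f (at x) (\<Sum>i\<in>UNIV. (h $ i) *\<^sub>R axis i 1)"
      by (simp add: basis_expansion flip: scalar_mult_eq_scaleR)
    also have "\<dots> = (\<Sum>i\<in>UNIV. (h $ i) * frechet_derivative f (at x) (axis i 1))"
      by (simp add: l.sum l.scaleR)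
    also have "\<dots> = gradient f x \<bullet> h"
      by (simp add: gradient_def inner_vec_def mult.commute)
    finally show ?thesis .
  qed
  then show ?thesis using d by presburger
qed

text \<open>The remainder is small relative to \<open>norm (y n - x)\<close>, which is of order
  \<open>\<epsilon> n\<close>. No limit of the quotients \<open>(y n - x) / \<epsilon> n\<close> is
  involved.\<close>

lemma has_derivative_remainder_quotient:
  fixes f :: "'a::real_normed_vector \<Rightarrow> 'b::real_normed_vector"
  assumes f: "(f has_derivative f') (at x)" and z: "\<And>n. norm (y n - x) \<le> C * \<epsilon> n"
    and \<epsilon>: "\<And>n. \<epsilon> n > 0" "\<epsilon> \<longlonglongrightarrow> 0"
  shows "(\<lambda>n. (f (y n) - f x - f' (y n - x)) /\<^sub>R \<epsilon> n) \<longlonglongrightarrow> 0"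
proof (rule LIMSEQ_I)
  fix r :: real assume "r > 0"
  define C' where "C' = \<bar>C\<bar> + 1"
  have "C * \<epsilon> n \<le> C' * \<epsilon> n" for n
    using \<epsilon>(1)[of n] by (intro mult_right_mono) (auto simp: C'_def)
  then have C': "C' > 0" "\<And>n. norm (y n - x) \<le> C' * \<epsilon> n"
    using z by (auto simp: C'_def intro: order_trans)
  define e where "e = r / (2 * C')"
  have "e > 0" using \<open>r > 0\<close> C' by (simp add: e_def)
  then obtain d where d: "d > 0" "\<And>y. norm (y - x) < d \<Longrightarrow> norm (f y - f x - f' (y - x)) \<le> e * norm (y - x)"
    using f unfolding has_derivative_at_alt by blast
  have "(\<lambda>n. C' * \<epsilon> n) \<longlonglongrightarrow> C' * 0" by (intro tendsto_intros \<epsilon>)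
  then have "eventually (\<lambda>n. C' * \<epsilon> n < d) sequentially"
    by (rule order_tendstoD(2)) (use d in simp)
  then obtain N where N: "\<And>n. n \<ge> N \<Longrightarrow> C' * \<epsilon> n < d" unfolding eventually_sequentially by blast
  have "norm ((f (y n) - f x - f' (y n - x)) /\<^sub>R \<epsilon> n - 0) < r" if "n \<ge> N" for n
  proof -
    have "norm (f (y n) - f x - f' (y n - x)) \<le> e * norm (y n - x)"
      using d(2) N[OF that] C'(2)[of n] by (meson le_less_trans)
    also have "\<dots> \<le> e * (C' * \<epsilon> n)" using \<open>e > 0\<close> C'(2) by (intro mult_left_mono) auto
    also have "\<dots> < r * \<epsilon> n" using C'(1) \<open>r > 0\<close> \<epsilon>(1)[of n] by (simp add: e_def)
    finally show ?thesis unfolding diff_0_right norm_scaleR using \<epsilon>(1)[of n] by (simp add: field_simps)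
  qed
  then show "\<exists>no. \<forall>n\<ge>no. norm ((f (y n) - f x - f' (y n - x)) /\<^sub>R \<epsilon> n - 0) < r" by blast
qed

text \<open>The finite index lets one constant serve all columns; index type \<open>unit\<close>
  gives the bound for a single function.\<close>

lemma compact_uniform_bound:
  fixes g :: "'i::finite \<Rightarrow> 'a::topological_space \<Rightarrow> 'b::real_normed_vector"
  assumes "compact S" "\<And>i. continuous_on S (g i)"
  obtains B where "B \<ge> 0" "\<And>i x. x \<in> S \<Longrightarrow> norm (g i x) \<le> B"
proof -
  have "\<exists>B. \<forall>x\<in>S. norm (g i x) \<le> B" for i
  proof -
    have "bounded (g i ` S)" using assms by (intro compact_imp_bounded compact_continuous_image) auto
    then show ?thesis unfolding bounded_iff by (meson imageI)
  qed
  then obtain b where b: "\<And>i x. x \<in> S \<Longrightarrow> norm (g i x) \<le> b i" by metis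
  show ?thesis
  proof (rule that[of "Max (insert 0 (range b))"])
    fix i x assume "x \<in> S"
    from b[OF this, of i] show "norm (g i x) \<le> Max (insert 0 (range b))"
      by (rule order_trans) (intro Max_ge, auto)
  qed simp
qed

lemma L2_controls_add_bounded:
  fixes w v :: "real \<Rightarrow> real^'k"
  assumes w: "w \<in> L2_controls" and v: "v \<in> borel_measurable (lebesgue_on {0..1})" "\<And>t. norm (v t) \<le> 1"
  shows "(\<lambda>t. w t + c *\<^sub>R v t) \<in> L2_controls"
  unfolding L2_controls_def
proof (intro CollectI conjI)
  have [measurable]: "w \<in> borel_measurable (lebesgue_on {0..1})" by (rule L2_controls_measurable[OF w])
  note [measurable] = v(1)
  show "(\<lambda>t. w t + c *\<^sub>R v t) \<in> borel_measurable (lebesgue_on {0..1})" by measurable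
  have fin: "finite_measure (lebesgue_on {0..1::real})"
    by (intro finite_measure_lebesgue_on) simp
  show "integrable (lebesgue_on {0..1}) (\<lambda>t. (norm (w t + c *\<^sub>R v t))\<^sup>2)"
  proof (rule Bochner_Integration.integrable_bound)
    show "integrable (lebesgue_on {0..1}) (\<lambda>t. 2 * (norm (w t))\<^sup>2 + 2 * c\<^sup>2)"
      using w by (intro Bochner_Integration.integrable_add integrable_mult_right finite_measure.integrable_const fin)
        (auto simp: L2_controls_def)
    show "AE t in lebesgue_on {0..1}. norm ((norm (w t + c *\<^sub>R v t))\<^sup>2) \<le> norm (2 * (norm (w t))\<^sup>2 + 2 * c\<^sup>2)"
    proof (rule AE_I2)
      fix t
      have "norm (w t + c *\<^sub>R v t) \<le> norm (w t) + \<bar>c\<bar> * norm (v t)"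
        using norm_triangle_ineq[of "w t" "c *\<^sub>R v t"] by simp
      also have "\<dots> \<le> norm (w t) + \<bar>c\<bar>" using v(2)[of t] by (simp add: mult_left_le)
      finally have "(norm (w t + c *\<^sub>R v t))\<^sup>2 \<le> (norm (w t) + \<bar>c\<bar>)\<^sup>2" by (intro power_mono) auto
      also have "\<dots> \<le> 2 * (norm (w t))\<^sup>2 + 2 * c\<^sup>2"
        using sum_squares_bound[of "norm (w t)" "\<bar>c\<bar>"] by (simp add: power2_sum)
      finally show "norm ((norm (w t + c *\<^sub>R v t))\<^sup>2) \<le> norm (2 * (norm (w t))\<^sup>2 + 2 * c\<^sup>2)" by simp
    qed
  qed measurable
qed

section \<open>Linearisation along a trajectory\<close>

locale smooth_control_system = control_system \<Theta> F0 F x0 L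
  for \<Theta> :: "'p::euclidean_space set" and F0 :: "real^'n \<Rightarrow> 'p \<Rightarrow> real^'n"
    and F :: "real^'n \<Rightarrow> 'p \<Rightarrow> real^'k^'n" and x0 L +
  fixes a :: "real^'n \<Rightarrow> 'p \<Rightarrow> real"
  assumes F0_differentiable: "\<And>x \<theta>. \<theta> \<in> \<Theta> \<Longrightarrow> (\<lambda>y. F0 y \<theta>) differentiable (at x)"
    and F0_jacobian_continuous: "continuous_on (UNIV \<times> \<Theta>) (\<lambda>(x, \<theta>). jacobian (\<lambda>y. F0 y \<theta>) (at x))"
    and F_differentiable: "\<And>i x \<theta>. \<theta> \<in> \<Theta> \<Longrightarrow> (\<lambda>y. column i (F y \<theta>)) differentiable (at x)"
    and F_jacobian_continuous: "\<And>i. continuous_on (UNIV \<times> \<Theta>) (\<lambda>(x, \<theta>). jacobian (\<lambda>y. column i (F y \<theta>)) (at x))"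
    and a_differentiable: "\<And>x \<theta>. \<theta> \<in> \<Theta> \<Longrightarrow> (\<lambda>y. a y \<theta>) differentiable (at x)"
    and a_gradient_continuous: "continuous_on (UNIV \<times> \<Theta>) (\<lambda>(x, \<theta>). gradient (\<lambda>y. a y \<theta>) x)"
begin

definition J0 :: "real^'n \<Rightarrow> 'p \<Rightarrow> real^'n^'n" where
  "J0 x \<theta> = jacobian (\<lambda>y. F0 y \<theta>) (at x)"

definition J :: "'k \<Rightarrow> real^'n \<Rightarrow> 'p \<Rightarrow> real^'n^'n" where
  "J i x \<theta> = jacobian (\<lambda>y. column i (F y \<theta>)) (at x)"

text \<open>The Jacobian of \<open>rhs w\<close> in the state, taken along the trajectory. The
  adjoint equation applies it from the left to a row vector.\<close>

definition lin :: "(real \<Rightarrow> real^'k) \<Rightarrow> real \<Rightarrow> 'p \<Rightarrow> real^'n^'n" where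
  "lin w t \<theta> = J0 (traj w \<theta> t) \<theta> + (\<Sum>i\<in>UNIV. (w t $ i) *\<^sub>R J i (traj w \<theta> t) \<theta>)"

lemma F0_has_derivative: "\<theta> \<in> \<Theta> \<Longrightarrow> ((\<lambda>y. F0 y \<theta>) has_derivative (\<lambda>h. J0 x \<theta> *v h)) (at x)"
  using F0_differentiable[of \<theta> x] unfolding J0_def jacobian_works .

lemma F_has_derivative: "\<theta> \<in> \<Theta> \<Longrightarrow> ((\<lambda>y. column i (F y \<theta>)) has_derivative (\<lambda>h. J i x \<theta> *v h)) (at x)"
  using F_differentiable[of \<theta> i x] unfolding J_def jacobian_works .

lemma continuous_on_compose_traj:
  assumes w: "w \<in> L2_controls" and g: "continuous_on (UNIV \<times> \<Theta>) (\<lambda>(x,\<theta>). g x \<theta>)"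
  shows "continuous_on ({0..1} \<times> \<Theta>) (\<lambda>p. g (traj w (snd p) (fst p)) (snd p))"
proof -
  have "continuous_on ({0..1} \<times> \<Theta>) (\<lambda>p. (case p of (t,\<theta>) \<Rightarrow> traj w \<theta> t, snd p))"
    by (intro continuous_on_Pair traj_continuous_on_Times w continuous_intros)
  from continuous_on_compose2[OF g this] show ?thesis
    by (simp add: split_def image_subset_iff)
qed

lemma J_traj_bound:
  assumes w: "w \<in> L2_controls"
  obtains B where "B \<ge> 0" "\<And>t \<theta>. t \<in> {0..1} \<Longrightarrow> \<theta> \<in> \<Theta> \<Longrightarrow> norm (J0 (traj w \<theta> t) \<theta>) \<le> B"
    "\<And>i t \<theta>. t \<in> {0..1} \<Longrightarrow> \<theta> \<in> \<Theta> \<Longrightarrow> norm (J i (traj w \<theta> t) \<theta>) \<le> B"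
proof -
  let ?S = "{0..1::real} \<times> \<Theta>"
  have S: "compact ?S" by (intro compact_Times compact_\<Theta> compact_Icc)
  have c0: "continuous_on ?S (\<lambda>p. J0 (traj w (snd p) (fst p)) (snd p))"
    unfolding J0_def by (rule continuous_on_compose_traj[OF w F0_jacobian_continuous])
  obtain B0 where B0: "B0 \<ge> 0"
    "\<And>p. p \<in> ?S \<Longrightarrow> norm (J0 (traj w (snd p) (fst p)) (snd p)) \<le> B0"
    by (rule compact_uniform_bound[where g = "\<lambda>_::unit. \<lambda>p. J0 (traj w (snd p) (fst p)) (snd p)", OF S c0]) blast
  have c1: "continuous_on ?S (\<lambda>p. J i (traj w (snd p) (fst p)) (snd p))" for i
    unfolding J_def by (rule continuous_on_compose_traj[OF w F_jacobian_continuous])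
  obtain B1 where B1: "B1 \<ge> 0" "\<And>i p. p \<in> ?S \<Longrightarrow> norm (J i (traj w (snd p) (fst p)) (snd p)) \<le> B1"
    by (rule compact_uniform_bound[where g = "\<lambda>i. \<lambda>p. J i (traj w (snd p) (fst p)) (snd p)", OF S c1]) blast
  show ?thesis
  proof (rule that[of "max B0 B1"])
    fix t \<theta> i assume "t \<in> {0..1::real}" "\<theta> \<in> \<Theta>"
    then have "(t,\<theta>) \<in> ?S" by simp
    from B0(2)[OF this] B1(2)[OF this, of i]
    show "norm (J0 (traj w \<theta> t) \<theta>) \<le> max B0 B1" "norm (J i (traj w \<theta> t) \<theta>) \<le> max B0 B1" by auto
  qed (use B0 in auto)
qed

lemma continuous_on_slices:
  assumes "continuous_on ({0..1} \<times> \<Theta>) (\<lambda>p. g (snd p) (fst p))"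
  shows "\<theta> \<in> \<Theta> \<Longrightarrow> continuous_on {0..1} (g \<theta>)" and "t \<in> {0..1} \<Longrightarrow> continuous_on \<Theta> (\<lambda>\<theta>. g \<theta> t)"
proof -
  show "continuous_on {0..1} (g \<theta>)" if "\<theta> \<in> \<Theta>"
    using continuous_on_compose2[OF assms, of "{0..1}" "\<lambda>t. (t,\<theta>)"] that
    by (simp add: image_subset_iff continuous_on_Pair)
  show "continuous_on \<Theta> (\<lambda>\<theta>. g \<theta> t)" if "t \<in> {0..1}"
    using continuous_on_compose2[OF assms, of \<Theta> "\<lambda>\<theta>. (t,\<theta>)"] that
    by (simp add: image_subset_iff continuous_on_Pair)
qed

lemmas J0_traj_slices = continuous_on_slices[OF continuous_on_compose_traj[OF _ F0_jacobian_continuous, folded J0_def]]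
lemmas J_traj_slices = continuous_on_slices[OF continuous_on_compose_traj[OF _ F_jacobian_continuous, folded J_def]]

lemma lin_absolutely_integrable:
  assumes "w \<in> L2_controls" "\<theta> \<in> \<Theta>"
  shows "(\<lambda>t. lin w t \<theta>) absolutely_integrable_on {0..1}"
  unfolding lin_def
  by (intro absolutely_integrable_control_affine assms J0_traj_slices J_traj_slices)

lemma lin_continuous:
  assumes "w \<in> L2_controls" "t \<in> {0..1}"
  shows "continuous_on \<Theta> (lin w t)"
  unfolding lin_def by (intro continuous_intros assms J0_traj_slices J_traj_slices)

text \<open>The majorant does not depend on the parameter, so it can serve both for dominated
  convergence as the parameter varies and as the Gronwall rate for the adjoint.\<close>

lemma lin_bound:
  assumes w: "w \<in> L2_controls"
  obtains b where "b integrable_on {0..1}" "\<And>t. 0 \<le> b t" "\<And>t \<theta>. t \<in> {0..1} \<Longrightarrow> \<theta> \<in> \<Theta> \<Longrightarrow> norm (lin w t \<theta>) \<le> b t"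
proof -
  obtain B where B: "B \<ge> 0" "\<And>t \<theta>. t \<in> {0..1} \<Longrightarrow> \<theta> \<in> \<Theta> \<Longrightarrow> norm (J0 (traj w \<theta> t) \<theta>) \<le> B"
    "\<And>i t \<theta>. t \<in> {0..1} \<Longrightarrow> \<theta> \<in> \<Theta> \<Longrightarrow> norm (J i (traj w \<theta> t) \<theta>) \<le> B"
    using J_traj_bound[OF w] by blast
  show ?thesis
  proof (rule that[of "\<lambda>t. B + real CARD('k) * norm (w t) * B"])
    show "(\<lambda>t. B + real CARD('k) * norm (w t) * B) integrable_on {0..1}"
      by (intro integrable_add integrable_on_mult_left integrable_on_mult_right L2_controls_norm_integrable w) auto
    fix t \<theta> assume "t \<in> {0..1::real}" "\<theta> \<in> \<Theta>"
    then show "norm (lin w t \<theta>) \<le> B + real CARD('k) * norm (w t) * B"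
      unfolding lin_def by (intro norm_triangle_mono B norm_sum_scaleR_le)
  qed (use B in auto)
qed

end

section \<open>Joint continuity of the adjoint in time and parameter\<close>

locale adjoint_system = smooth_control_system \<Theta> F0 F x0 L a
  for \<Theta> :: "'p::euclidean_space set" and F0 :: "real^'n \<Rightarrow> 'p \<Rightarrow> real^'n"
    and F :: "real^'n \<Rightarrow> 'p \<Rightarrow> real^'k^'n" and x0 L a +
  fixes u :: "real \<Rightarrow> real^'k" and \<Lambda> :: "real \<Rightarrow> 'p \<Rightarrow> real^'n"
  assumes u: "u \<in> L2_controls"
    and \<Lambda>_abs_continuous: "\<And>\<theta>. \<theta> \<in> \<Theta> \<Longrightarrow> abs_continuous_on 0 1 (\<lambda>t. \<Lambda> t \<theta>)"
    and \<Lambda>_derivative: "\<And>\<theta>. \<theta> \<in> \<Theta> \<Longrightarrow> AE t in lebesgue_on {0..1}.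
           ((\<lambda>s. \<Lambda> s \<theta>) has_vector_derivative - (\<Lambda> t \<theta> v* lin u t \<theta>)) (at t within {0..1})"
    and \<Lambda>_1: "\<And>\<theta>. \<theta> \<in> \<Theta> \<Longrightarrow> \<Lambda> 1 \<theta> = gradient (\<lambda>y. a y \<theta>) (traj u \<theta> 1)"
begin

lemma \<Lambda>_derivative_negligible:
  assumes "\<theta> \<in> \<Theta>"
  obtains N where "negligible N" "\<And>t. t \<in> {0..1} - N \<Longrightarrow>
    ((\<lambda>s. \<Lambda> s \<theta>) has_vector_derivative - (\<Lambda> t \<theta> v* lin u t \<theta>)) (at t within {0..1})"
  using \<Lambda>_derivative[OF assms] by (subst (asm) AE_lebesgue_on_iff_negligible) auto

lemmas \<Lambda>_continuous = abs_continuous_on_imp_continuous_on[OF \<Lambda>_abs_continuous]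

lemma \<Lambda>_1_continuous: "continuous_on \<Theta> (\<Lambda> 1)"
  using continuous_on_slices(2)[OF continuous_on_compose_traj[OF u a_gradient_continuous], of 1]
  by (subst continuous_on_cong[OF refl \<Lambda>_1]) auto

text \<open>This integral is, up to a constant, the forcing in the equation for the difference of
  two adjoints. Continuity of the Jacobians gives convergence at each time, and
  \<open>2 * b t * norm (\<Lambda> t \<theta>)\<close> dominates.\<close>

lemma lin_diff_integral_tendsto:
  assumes \<theta>: "\<theta> \<in> \<Theta>"
  shows "((\<lambda>\<theta>'. integral {0..1} (\<lambda>t. norm (lin u t \<theta>' - lin u t \<theta>) * norm (\<Lambda> t \<theta>))) \<longlongrightarrow> 0) (at \<theta> within \<Theta>)"
  unfolding tendsto_at_iff_sequentially
proof (intro allI impI)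
  fix T :: "nat \<Rightarrow> 'p" assume T: "\<forall>i. T i \<in> \<Theta> - {\<theta>}" "T \<longlonglongrightarrow> \<theta>"
  obtain b where b: "b integrable_on {0..1}" "\<And>t. 0 \<le> b t" "\<And>t \<theta>. t \<in> {0..1} \<Longrightarrow> \<theta> \<in> \<Theta> \<Longrightarrow> norm (lin u t \<theta>) \<le> b t"
    using lin_bound[OF u] by blast
  have cL: "continuous_on {0..1} (\<lambda>t. norm (\<Lambda> t \<theta>))"
    using \<Lambda>_continuous[OF \<theta>] by (rule continuous_on_norm)
  have "(\<lambda>i. integral {0..1} (\<lambda>t. norm (lin u t (T i) - lin u t \<theta>) * norm (\<Lambda> t \<theta>)))
      \<longlonglongrightarrow> integral {0..1} (\<lambda>t::real. 0 :: real)"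
  proof (rule dominated_convergence(2))
    show "(\<lambda>t. norm (lin u t (T i) - lin u t \<theta>) * norm (\<Lambda> t \<theta>)) integrable_on {0..1}" for i
    proof (rule integrable_on_mult_continuous[OF _ _ cL])
      have "(\<lambda>t. lin u t (T i) - lin u t \<theta>) absolutely_integrable_on {0..1}"
        using T(1) \<theta> by (intro set_integral_diff lin_absolutely_integrable u) auto
      then show "(\<lambda>t. norm (lin u t (T i) - lin u t \<theta>)) integrable_on {0..1}"
        unfolding absolutely_integrable_on_def by simp
    qed auto
    show "(\<lambda>t. 2 * b t * norm (\<Lambda> t \<theta>)) integrable_on {0..1}"
      by (rule integrable_on_mult_continuous[OF _ _ cL]) (auto intro: integrable_on_mult_right b)
    fix t :: real assume t: "t \<in> {0..1}"
    show "norm (norm (lin u t (T i) - lin u t \<theta>) * norm (\<Lambda> t \<theta>)) \<le> 2 * b t * norm (\<Lambda> t \<theta>)" for i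
    proof -
      have "norm (lin u t (T i) - lin u t \<theta>) \<le> norm (lin u t (T i)) + norm (lin u t \<theta>)"
        by (rule norm_triangle_ineq4)
      also have "\<dots> \<le> 2 * b t" using b(3)[OF t, of "T i"] b(3)[OF t \<theta>] T(1) by auto
      finally show ?thesis by (simp add: mult_right_mono)
    qed
    have "(\<lambda>i. lin u t (T i)) \<longlonglongrightarrow> lin u t \<theta>"
      by (rule continuous_on_tendsto_compose[OF lin_continuous[OF u t] T(2) \<theta>]) (use T(1) in auto)
    then have "(\<lambda>i. norm (lin u t (T i) - lin u t \<theta>) * norm (\<Lambda> t \<theta>)) \<longlonglongrightarrow> norm (lin u t \<theta> - lin u t \<theta>) * norm (\<Lambda> t \<theta>)"
      by (intro tendsto_intros)
    then show "(\<lambda>i. norm (lin u t (T i) - lin u t \<theta>) * norm (\<Lambda> t \<theta>)) \<longlonglongrightarrow> 0" by simp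
  qed
  then show "((\<lambda>\<theta>'. integral {0..1} (\<lambda>t. norm (lin u t \<theta>' - lin u t \<theta>) * norm (\<Lambda> t \<theta>))) \<circ> T) \<longlonglongrightarrow> 0"
    by (simp add: o_def)
qed

text \<open>The difference of two adjoints has growth rate \<open>K * b\<close> and a forcing whose
  integral is \<open>K * I \<theta> \<theta>'\<close>. The backward estimate starts from the
  terminal values, which depend continuously on the parameter.\<close>

lemma \<Lambda>_continuous_on_Times: "continuous_on ({0..1} \<times> \<Theta>) (\<lambda>(t,\<theta>). \<Lambda> t \<theta>)"
proof -
  obtain K where K: "K > 0" "\<And>(x::real^'n) (A::real^'n^'n). norm (x v* A) \<le> norm x * norm A * K"
    using bounded_bilinear.pos_bounded[OF bounded_bilinear_vector_matrix_mult] by blast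
  obtain b where b: "b integrable_on {0..1}" "\<And>t. 0 \<le> b t" "\<And>t \<theta>. t \<in> {0..1} \<Longrightarrow> \<theta> \<in> \<Theta> \<Longrightarrow> norm (lin u t \<theta>) \<le> b t"
    using lin_bound[OF u] by blast
  define I where "I \<theta> \<theta>' = integral {0..1} (\<lambda>t. norm (lin u t \<theta>' - lin u t \<theta>) * norm (\<Lambda> t \<theta>))" for \<theta> \<theta>'
  let ?\<rho> = "\<lambda>\<theta> \<theta>'. 2 * (norm (\<Lambda> 1 \<theta>' - \<Lambda> 1 \<theta>) + K * I \<theta> \<theta>') * exp (2 * integral {0..1} (\<lambda>t. K * b t))"
  show ?thesis
  proof (rule continuous_on_Times_if_uniform)
    fix \<theta> assume \<theta>: "\<theta> \<in> \<Theta>"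
    show "continuous_on {0..1} (\<lambda>t. \<Lambda> t \<theta>)" by (rule \<Lambda>_continuous[OF \<theta>])
    have "(?\<rho> \<theta> \<longlongrightarrow> 2 * (norm (\<Lambda> 1 \<theta> - \<Lambda> 1 \<theta>) + K * 0) * exp (2 * integral {0..1} (\<lambda>t. K * b t))) (at \<theta> within \<Theta>)"
      using \<Lambda>_1_continuous \<theta> lin_diff_integral_tendsto[OF \<theta>]
      by (intro tendsto_intros) (auto simp: continuous_on_def I_def)
    then show "(?\<rho> \<theta> \<longlongrightarrow> 0) (at \<theta> within \<Theta>)" by simp
  next
    fix \<theta> \<theta>' and t :: real assume \<theta>: "\<theta> \<in> \<Theta>" "\<theta>' \<in> \<Theta>" and t: "t \<in> {0..1}"
    obtain N where N: "negligible N" "\<And>t. t \<in> {0..1} - N \<Longrightarrow>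
      ((\<lambda>s. \<Lambda> s \<theta>) has_vector_derivative - (\<Lambda> t \<theta> v* lin u t \<theta>)) (at t within {0..1})"
      using \<Lambda>_derivative_negligible[OF \<theta>(1)] by blast
    obtain N' where N': "negligible N'" "\<And>t. t \<in> {0..1} - N' \<Longrightarrow>
      ((\<lambda>s. \<Lambda> s \<theta>') has_vector_derivative - (\<Lambda> t \<theta>' v* lin u t \<theta>')) (at t within {0..1})"
      using \<Lambda>_derivative_negligible[OF \<theta>(2)] by blast
    let ?e = "\<lambda>t. K * (norm (lin u t \<theta>' - lin u t \<theta>) * norm (\<Lambda> t \<theta>))"
    have ei: "?e integrable_on {0..1}"
    proof (intro integrable_on_mult_right integrable_on_mult_continuous continuous_on_norm \<Lambda>_continuous \<theta>)
      have "(\<lambda>t. lin u t \<theta>' - lin u t \<theta>) absolutely_integrable_on {0..1}"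
        using \<theta> by (intro set_integral_diff lin_absolutely_integrable u) auto
      then show "(\<lambda>t. norm (lin u t \<theta>' - lin u t \<theta>)) integrable_on {0..1}"
        unfolding absolutely_integrable_on_def by simp
    qed auto
    have "norm (\<Lambda> t \<theta>' - \<Lambda> t \<theta>) \<le> 2 * (norm (\<Lambda> 1 \<theta>' - \<Lambda> 1 \<theta>) + integral {0..1} ?e) * exp (2 * integral {0..1} (\<lambda>t. K * b t))"
    proof (rule abs_continuous_growth(2)[where d = "\<lambda>t. \<Lambda> t \<theta>' - \<Lambda> t \<theta>" and N = "N \<union> N'"
          and D = "\<lambda>t. - (\<Lambda> t \<theta>' v* lin u t \<theta>') - - (\<Lambda> t \<theta> v* lin u t \<theta>)"])
      show "abs_continuous_on 0 1 (\<lambda>t. \<Lambda> t \<theta>' - \<Lambda> t \<theta>)"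
        by (intro abs_continuous_on_diff \<Lambda>_abs_continuous \<theta>)
      show "(\<lambda>t. K * b t) integrable_on {0..1}" by (intro integrable_on_mult_right b)
      show "0 \<le> K * b t" for t using K(1) b(2) by simp
      show "0 \<le> ?e t" for t using K(1) by simp
      show "negligible (N \<union> N')" using N(1) N'(1) by simp
      fix t assume t: "t \<in> {0..1} - (N \<union> N')"
      show "((\<lambda>t. \<Lambda> t \<theta>' - \<Lambda> t \<theta>) has_vector_derivative
          - (\<Lambda> t \<theta>' v* lin u t \<theta>') - - (\<Lambda> t \<theta> v* lin u t \<theta>)) (at t within {0..1})"
        using t by (intro has_vector_derivative_diff N(2) N'(2)) auto
      have "norm ((\<Lambda> t \<theta>' - \<Lambda> t \<theta>) v* lin u t \<theta>') \<le> norm (\<Lambda> t \<theta>' - \<Lambda> t \<theta>) * norm (lin u t \<theta>') * K" by (rule K(2))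
      also have "\<dots> \<le> norm (\<Lambda> t \<theta>' - \<Lambda> t \<theta>) * b t * K"
        using b(3)[of t \<theta>'] t \<theta> K(1) by (intro mult_right_mono mult_left_mono) auto
      finally have 1: "norm ((\<Lambda> t \<theta>' - \<Lambda> t \<theta>) v* lin u t \<theta>') \<le> K * b t * norm (\<Lambda> t \<theta>' - \<Lambda> t \<theta>)" by (simp add: mult_ac)
      have 2: "norm (\<Lambda> t \<theta> v* (lin u t \<theta>' - lin u t \<theta>)) \<le> ?e t"
        using K(2)[of "\<Lambda> t \<theta>" "lin u t \<theta>' - lin u t \<theta>"] by (simp add: mult_ac)
      \<comment> \<open>The splitting pairs the matrix difference with the adjoint at the base
        parameter \<open>\<theta>\<close>, so the forcing is exactly the integrand of
        \<open>I \<theta> \<theta>'\<close>.\<close>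
      have "- (\<Lambda> t \<theta>' v* lin u t \<theta>') - - (\<Lambda> t \<theta> v* lin u t \<theta>)
          = - ((\<Lambda> t \<theta>' - \<Lambda> t \<theta>) v* lin u t \<theta>' + \<Lambda> t \<theta> v* (lin u t \<theta>' - lin u t \<theta>))"
        by (simp add: vector_matrix_mult_diff_distrib vector_matrix_mult_diff_rdistrib)
      then show "norm (- (\<Lambda> t \<theta>' v* lin u t \<theta>') - - (\<Lambda> t \<theta> v* lin u t \<theta>)) \<le> K * b t * norm (\<Lambda> t \<theta>' - \<Lambda> t \<theta>) + ?e t"
        using norm_triangle_mono[OF 1 2] by (metis norm_minus_cancel)
    qed (use ei t in auto)
    then show "norm (\<Lambda> t \<theta>' - \<Lambda> t \<theta>) \<le> ?\<rho> \<theta> \<theta>'" by (simp add: I_def)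
  qed
qed

end

section \<open>First variation of the final cost\<close>

context adjoint_system
begin

definition pert :: "(real \<Rightarrow> real^'k) \<Rightarrow> real \<Rightarrow> real \<Rightarrow> real^'k" where
  "pert v c t = u t + c *\<^sub>R v t"

lemma F_traj_bound:
  obtains B where "B \<ge> 0"
    "\<And>t \<theta> w. t \<in> {0..1} \<Longrightarrow> \<theta> \<in> \<Theta> \<Longrightarrow> norm (F (traj u \<theta> t) \<theta> *v w) \<le> B * norm w"
proof -
  let ?S = "{0..1::real} \<times> \<Theta>"
  have S: "compact ?S" by (intro compact_Times compact_\<Theta> compact_Icc)
  have "continuous_on ?S (\<lambda>p. traj u (snd p) (fst p))"
    using traj_continuous_on_Times[OF u] by (simp add: split_def)
  then have c: "continuous_on ?S (\<lambda>p. column i (F (traj u (snd p) (fst p)) (snd p)))" for i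
    by (intro continuous_on_column_F continuous_intros) auto
  obtain B where B: "B \<ge> 0" "\<And>i p. p \<in> ?S \<Longrightarrow> norm (column i (F (traj u (snd p) (fst p)) (snd p))) \<le> B"
    by (rule compact_uniform_bound[where g = "\<lambda>i p. column i (F (traj u (snd p) (fst p)) (snd p))", OF S c]) blast
  show ?thesis
  proof (rule that[of "real CARD('k) * B"])
    fix t \<theta> and w :: "real^'k" assume t: "t \<in> {0..1::real}" and \<theta>: "\<theta> \<in> \<Theta>"
    have "norm (column i (F (traj u \<theta> t) \<theta>)) \<le> B" for i
      using B(2)[of "(t,\<theta>)" i] t \<theta> by simp
    from norm_sum_scaleR_le[OF this, of w]
    show "norm (F (traj u \<theta> t) \<theta> *v w) \<le> real CARD('k) * B * norm w"
      unfolding matrix_vector_mult_eq_sum_columns by (simp add: mult_ac)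
  qed (use B in auto)
qed

lemma F_mult_lipschitz:
  assumes "\<theta> \<in> \<Theta>"
  shows "norm (F x \<theta> *v w - F y \<theta> *v w) \<le> real CARD('k) * norm w * (L * norm (x - y))"
proof -
  have "F x \<theta> *v w - F y \<theta> *v w = (\<Sum>i\<in>UNIV. (w $ i) *\<^sub>R (column i (F x \<theta>) - column i (F y \<theta>)))"
    by (simp add: matrix_vector_mult_eq_sum_columns scaleR_diff_right sum_subtractf)
  moreover have "norm (column i (F x \<theta>) - column i (F y \<theta>)) \<le> L * norm (x - y)" for i
    using F_lipschitz[OF assms assms, where i = i and ?x1.0 = x and ?x2.0 = y] by simp
  ultimately show ?thesis
    using norm_sum_scaleR_le[of "\<lambda>i. column i (F x \<theta>) - column i (F y \<theta>)" "L * norm (x - y)" w] by simp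
qed

end

section \<open>Bounded perturbations of the control\<close>

locale perturbation = adjoint_system \<Theta> F0 F x0 L a u \<Lambda>
  for \<Theta> :: "'p::euclidean_space set" and F0 :: "real^'n \<Rightarrow> 'p \<Rightarrow> real^'n"
    and F :: "real^'n \<Rightarrow> 'p \<Rightarrow> real^'k^'n" and x0 L a u \<Lambda> +
  fixes v :: "real \<Rightarrow> real^'k"
  assumes v_measurable: "v \<in> borel_measurable (lebesgue_on {0..1})"
    and v_bound: "\<And>t. norm (v t) \<le> 1"
begin

lemma pert_L2: "pert v c \<in> L2_controls"
  unfolding pert_def by (rule L2_controls_add_bounded[OF u v_measurable v_bound])

text \<open>The trajectory of \<open>u\<close> has residual \<open>c *\<^sub>R (F *v v)\<close> in
  the perturbed equation, which is at most \<open>c * B\<close> in norm because \<open>v\<close> is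
  bounded by 1.\<close>

lemma traj_pert_bound:
  obtains C where "C \<ge> 0"
    "\<And>c t \<theta>. 0 \<le> c \<Longrightarrow> c \<le> 1 \<Longrightarrow> t \<in> {0..1} \<Longrightarrow> \<theta> \<in> \<Theta> \<Longrightarrow> norm (traj (pert v c) \<theta> t - traj u \<theta> t) \<le> C * c"
proof -
  obtain B where B: "B \<ge> 0"
    "\<And>t \<theta> w. t \<in> {0..1} \<Longrightarrow> \<theta> \<in> \<Theta> \<Longrightarrow> norm (F (traj u \<theta> t) \<theta> *v w) \<le> B * norm w"
    using F_traj_bound by blast
  \<comment> \<open>A common majorant of \<open>lip (pert v c)\<close> for all \<open>c\<close> in
    [0,1]; without it the Gronwall exponent would depend on \<open>c\<close>.\<close>
  define m where "m t = L * (1 + real CARD('k) * (norm (u t) + 1))" for t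
  have m: "m integrable_on {0..1}" unfolding m_def
    by (intro integrable_on_mult_right integrable_add L2_controls_norm_integrable u) auto
  show ?thesis
  proof (rule that[of "2 * B * exp (2 * integral {0..1} m)"])
    fix c t \<theta> assume c: "0 \<le> c" "c \<le> (1::real)" and t: "t \<in> {0..1::real}" and \<theta>: "\<theta> \<in> \<Theta>"
    have "norm (traj (pert v c) \<theta> t - traj u \<theta> t)
      \<le> 2 * (norm (x0 \<theta> - x0 \<theta>) + integral {0..1} (\<lambda>t::real. c * B)) * exp (2 * integral {0..1} (lip (pert v c)))"
    proof (rule traj_diff_bound[where e = "\<lambda>t. c * B", OF u pert_L2 \<theta> \<theta> _ _ t])
      fix t :: real assume t: "t \<in> {0..1}"
      have "rhs (pert v c) \<theta> t (traj u \<theta> t) - rhs u \<theta> t (traj u \<theta> t) = c *\<^sub>R (F (traj u \<theta> t) \<theta> *v v t)"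
        by (simp add: rhs_def pert_def matrix_vector_right_distrib matrix_vector_mult_scaleR)
      moreover have "norm (F (traj u \<theta> t) \<theta> *v v t) \<le> B"
        using B(2)[OF t \<theta>, of "v t"] mult_left_mono[OF v_bound[of t] B(1)] by simp
      ultimately show "norm (rhs (pert v c) \<theta> t (traj u \<theta> t) - rhs u \<theta> t (traj u \<theta> t)) \<le> c * B"
        using c by (simp add: mult_left_mono)
    qed auto
    also have "\<dots> = 2 * B * exp (2 * integral {0..1} (lip (pert v c))) * c" by simp
    also have "\<dots> \<le> 2 * B * exp (2 * integral {0..1} m) * c"
    proof -
      have "integral {0..1} (lip (pert v c)) \<le> integral {0..1} m"
      proof (rule integral_le[OF lip_integrable[OF pert_L2] m])
        fix t :: real
        have "norm (pert v c t) \<le> norm (u t) + c * norm (v t)"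
          unfolding pert_def using norm_triangle_ineq[of "u t" "c *\<^sub>R v t"] c by simp
        also have "\<dots> \<le> norm (u t) + 1"
          using mult_mono[OF c(2) v_bound[of t]] c by simp
        finally show "lip (pert v c) t \<le> m t"
          unfolding lip_def m_def using L_pos by (intro mult_left_mono add_left_mono) auto
      qed
      then show ?thesis using B(1) c by (intro mult_right_mono mult_left_mono) auto
    qed
    finally show "norm (traj (pert v c) \<theta> t - traj u \<theta> t) \<le> 2 * B * exp (2 * integral {0..1} m) * c" .
  qed (use B in auto)
qed

section \<open>Duality between the adjoint and finite state differences\<close>

text \<open>Dominated convergence works along sequences, so the perturbation size runs through one.
  Its values stay in the range where \<open>traj_pert_bound\<close> applies.\<close>

definition step :: "nat \<Rightarrow> real" where
  "step n = inverse (real (Suc n))"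

lemma step: "step n > 0" "step n \<le> 1" "step \<longlonglongrightarrow> 0"
  unfolding step_def[abs_def] using LIMSEQ_inverse_real_of_nat by (auto simp: inverse_le_1_iff)

abbreviation xn :: "nat \<Rightarrow> 'p \<Rightarrow> real \<Rightarrow> real^'n" where
  "xn n \<equiv> traj (pert v (step n))"

text \<open>The derivative of \<open>\<Lambda> \<bullet> (xn n - traj u)\<close> divided by the
  step; the subtracted \<open>lin\<close> term is the contribution of the adjoint equation.\<close>

definition duality_integrand :: "nat \<Rightarrow> 'p \<Rightarrow> real \<Rightarrow> real" where
  "duality_integrand n \<theta> t = \<Lambda> t \<theta> \<bullet>
     ((rhs (pert v (step n)) \<theta> t (xn n \<theta> t) - rhs u \<theta> t (traj u \<theta> t) - lin u t \<theta> *v (xn n \<theta> t - traj u \<theta> t)) /\<^sub>R step n)"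

lemma duality_integrand_has_integral:
  assumes \<theta>: "\<theta> \<in> \<Theta>"
  shows "(duality_integrand n \<theta> has_integral (\<Lambda> 1 \<theta> \<bullet> (xn n \<theta> 1 - traj u \<theta> 1)) / step n) {0..1}"
proof -
  let ?z = "\<lambda>t. xn n \<theta> t - traj u \<theta> t"
  \<comment> \<open>Transposition, \<open>(l v* A) \<bullet> z = l \<bullet> (A *v z)\<close>, moves
    the adjoint matrix onto the state difference.\<close>
  have alg: "l \<bullet> p + (- (l v* A)) \<bullet> z = s * (l \<bullet> ((p - A *v z) /\<^sub>R s))" if "s \<noteq> 0"
    for l p z :: "real^'n" and A s
    using that by (simp add: dot_lmul_matrix inner_diff_right)
  obtain N1 where N1: "negligible N1" "\<And>t. t \<in> {0..1} - N1 \<Longrightarrow>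
      (xn n \<theta> has_vector_derivative rhs (pert v (step n)) \<theta> t (xn n \<theta> t)) (at t within {0..1})"
    using traj_derivative[OF pert_L2[of "step n"] \<theta>] by blast
  obtain N2 where N2: "negligible N2" "\<And>t. t \<in> {0..1} - N2 \<Longrightarrow>
      (traj u \<theta> has_vector_derivative rhs u \<theta> t (traj u \<theta> t)) (at t within {0..1})"
    using traj_derivative[OF u \<theta>] by blast
  obtain N3 where N3: "negligible N3" "\<And>t. t \<in> {0..1} - N3 \<Longrightarrow>
      ((\<lambda>s. \<Lambda> s \<theta>) has_vector_derivative - (\<Lambda> t \<theta> v* lin u t \<theta>)) (at t within {0..1})"
    using \<Lambda>_derivative_negligible[OF \<theta>] by blast
  have "((\<lambda>t. step n * duality_integrand n \<theta> t) has_integral (\<Lambda> 1 \<theta> \<bullet> ?z 1 - \<Lambda> 0 \<theta> \<bullet> ?z 0)) {0..1}"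
  proof (rule fundamental_theorem_of_calculus_abs_continuous[where N = "N1 \<union> N2 \<union> N3"])
    show "abs_continuous_on 0 1 (\<lambda>t. \<Lambda> t \<theta> \<bullet> ?z t)"
      by (intro abs_continuous_on_bounded_bilinear[OF bounded_bilinear_inner] abs_continuous_on_diff
          \<Lambda>_abs_continuous traj_abs_continuous pert_L2 u \<theta>)
    show "negligible (N1 \<union> N2 \<union> N3)" using N1 N2 N3 by simp
    fix t assume t: "t \<in> {0..1} - (N1 \<union> N2 \<union> N3)"
    have "((\<lambda>t. \<Lambda> t \<theta> \<bullet> ?z t) has_vector_derivative
        \<Lambda> t \<theta> \<bullet> (rhs (pert v (step n)) \<theta> t (xn n \<theta> t) - rhs u \<theta> t (traj u \<theta> t))
        + (- (\<Lambda> t \<theta> v* lin u t \<theta>)) \<bullet> ?z t) (at t within {0..1})"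
      by (rule bounded_bilinear.has_vector_derivative[OF bounded_bilinear_inner N3(2)
            has_vector_derivative_diff[OF N1(2) N2(2)]]) (use t in auto)
    moreover have "\<Lambda> t \<theta> \<bullet> (rhs (pert v (step n)) \<theta> t (xn n \<theta> t) - rhs u \<theta> t (traj u \<theta> t))
        + (- (\<Lambda> t \<theta> v* lin u t \<theta>)) \<bullet> ?z t = step n * duality_integrand n \<theta> t"
      unfolding duality_integrand_def by (rule alg) (use step(1)[of n] in simp)
    ultimately show "((\<lambda>t. \<Lambda> t \<theta> \<bullet> ?z t) has_vector_derivative step n * duality_integrand n \<theta> t) (at t within {0..1})"
      by simp
  qed simp
  \<comment> \<open>Both trajectories start at \<open>x0 \<theta>\<close>, so the boundary term at
    time 0 vanishes.\<close>
  moreover have "?z 0 = 0" using traj_0[OF pert_L2 \<theta>] traj_0[OF u \<theta>] by simp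
  ultimately have "((\<lambda>t. step n * duality_integrand n \<theta> t) has_integral (\<Lambda> 1 \<theta> \<bullet> ?z 1)) {0..1}" by simp
  from has_integral_divide[OF this, of "step n"] show ?thesis
    using step(1)[of n] by simp
qed

text \<open>The first-order Taylor remainder of the drift divided by the step;
  \<open>F_quotient\<close> is its analogue for a column of \<open>F\<close>.\<close>

definition F0_quotient :: "nat \<Rightarrow> 'p \<Rightarrow> real \<Rightarrow> real^'n" where
  "F0_quotient n \<theta> t = (F0 (xn n \<theta> t) \<theta> - F0 (traj u \<theta> t) \<theta> - J0 (traj u \<theta> t) \<theta> *v (xn n \<theta> t - traj u \<theta> t)) /\<^sub>R step n"

definition F_quotient :: "'k \<Rightarrow> nat \<Rightarrow> 'p \<Rightarrow> real \<Rightarrow> real^'n" where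
  "F_quotient i n \<theta> t = (column i (F (xn n \<theta> t) \<theta>) - column i (F (traj u \<theta> t) \<theta>)
      - J i (traj u \<theta> t) \<theta> *v (xn n \<theta> t - traj u \<theta> t)) /\<^sub>R step n"

text \<open>Separates the Taylor remainders, which vanish in the limit, from the term with
  \<open>v\<close>, the only one that survives.\<close>

lemma duality_integrand_eq:
  "duality_integrand n \<theta> t = \<Lambda> t \<theta> \<bullet>
     (F0_quotient n \<theta> t + (\<Sum>i\<in>UNIV. (u t $ i) *\<^sub>R F_quotient i n \<theta> t) + F (xn n \<theta> t) \<theta> *v v t)"
proof -
  let ?x = "xn n \<theta> t" and ?y = "traj u \<theta> t"
  interpret mv: bounded_bilinear "\<lambda>(A :: real^'n^'n) x. A *v x"
    by (rule bounded_bilinear_matrix_vector_mult)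
  have 1: "lin u t \<theta> *v (?x - ?y) = J0 ?y \<theta> *v (?x - ?y) + (\<Sum>i\<in>UNIV. (u t $ i) *\<^sub>R (J i ?y \<theta> *v (?x - ?y)))"
    by (simp only: lin_def mv.add_left mv.sum_left mv.scaleR_left)
  have 2: "rhs (pert v (step n)) \<theta> t ?x = F0 ?x \<theta> + (\<Sum>i\<in>UNIV. (u t $ i) *\<^sub>R column i (F ?x \<theta>)) + step n *\<^sub>R (F ?x \<theta> *v v t)"
    by (simp add: rhs_def pert_def matrix_vector_right_distrib matrix_vector_mult_scaleR
        flip: matrix_vector_mult_eq_sum_columns)
  have 3: "rhs u \<theta> t ?y = F0 ?y \<theta> + (\<Sum>i\<in>UNIV. (u t $ i) *\<^sub>R column i (F ?y \<theta>))"
    by (simp add: rhs_def flip: matrix_vector_mult_eq_sum_columns)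
  have 4: "(\<Sum>i\<in>UNIV. (u t $ i) *\<^sub>R F_quotient i n \<theta> t)
      = ((\<Sum>i\<in>UNIV. (u t $ i) *\<^sub>R column i (F ?x \<theta>)) - (\<Sum>i\<in>UNIV. (u t $ i) *\<^sub>R column i (F ?y \<theta>))
        - (\<Sum>i\<in>UNIV. (u t $ i) *\<^sub>R (J i ?y \<theta> *v (?x - ?y)))) /\<^sub>R step n"
  proof -
    have "(\<Sum>i\<in>UNIV. (u t $ i) *\<^sub>R F_quotient i n \<theta> t) = (\<Sum>i\<in>UNIV. ((u t $ i) *\<^sub>R column i (F ?x \<theta>)
        - (u t $ i) *\<^sub>R column i (F ?y \<theta>) - (u t $ i) *\<^sub>R (J i ?y \<theta> *v (?x - ?y))) /\<^sub>R step n)"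
      by (rule sum.cong) (simp_all add: F_quotient_def scaleR_diff_right mult.commute)
    then show ?thesis by (simp only: scaleR_right.sum[symmetric] sum_subtractf)
  qed
  have "(rhs (pert v (step n)) \<theta> t ?x - rhs u \<theta> t ?y - lin u t \<theta> *v (?x - ?y)) /\<^sub>R step n
     = F0_quotient n \<theta> t + (\<Sum>i\<in>UNIV. (u t $ i) *\<^sub>R F_quotient i n \<theta> t) + F ?x \<theta> *v v t"
    unfolding 1 2 3 4 F0_quotient_def using step(1)[of n]
    by (simp add: algebra_simps)
  then show ?thesis by (simp add: duality_integrand_def)
qed

text \<open>State differences are at most \<open>C * step n\<close>, so division by
  \<open>step n\<close> leaves constants that do not depend on \<open>n\<close>; they dominate the
  integrand.\<close>

lemma quotients_bound:
  obtains B where "B \<ge> 0"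
    "\<And>n \<theta> t. t \<in> {0..1} \<Longrightarrow> \<theta> \<in> \<Theta> \<Longrightarrow> norm (F0_quotient n \<theta> t) \<le> B"
    "\<And>i n \<theta> t. t \<in> {0..1} \<Longrightarrow> \<theta> \<in> \<Theta> \<Longrightarrow> norm (F_quotient i n \<theta> t) \<le> B"
    "\<And>n \<theta> t. t \<in> {0..1} \<Longrightarrow> \<theta> \<in> \<Theta> \<Longrightarrow> norm (F (xn n \<theta> t) \<theta> *v v t) \<le> B"
proof -
  obtain C where C: "C \<ge> 0"
    "\<And>c t \<theta>. 0 \<le> c \<Longrightarrow> c \<le> 1 \<Longrightarrow> t \<in> {0..1} \<Longrightarrow> \<theta> \<in> \<Theta> \<Longrightarrow> norm (traj (pert v c) \<theta> t - traj u \<theta> t) \<le> C * c"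
    using traj_pert_bound by blast
  obtain B where B: "B \<ge> 0" "\<And>t \<theta>. t \<in> {0..1} \<Longrightarrow> \<theta> \<in> \<Theta> \<Longrightarrow> norm (J0 (traj u \<theta> t) \<theta>) \<le> B"
    "\<And>i t \<theta>. t \<in> {0..1} \<Longrightarrow> \<theta> \<in> \<Theta> \<Longrightarrow> norm (J i (traj u \<theta> t) \<theta>) \<le> B"
    using J_traj_bound[OF u] by blast
  obtain BF where BF: "BF \<ge> 0"
    "\<And>t \<theta> w. t \<in> {0..1} \<Longrightarrow> \<theta> \<in> \<Theta> \<Longrightarrow> norm (F (traj u \<theta> t) \<theta> *v w) \<le> BF * norm w"
    using F_traj_bound by blast
  obtain K where K: "K > 0" "\<And>(A::real^'n^'n) (x::real^'n). norm (A *v x) \<le> norm A * norm x * K"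
    using bounded_bilinear.pos_bounded[OF bounded_bilinear_matrix_vector_mult] by blast
  \<comment> \<open>\<open>L\<close> accounts for the Lipschitz increment \<open>p\<close>, and
    \<open>B * K\<close> for the Jacobian term.\<close>
  have q: "norm ((p - A *v z) /\<^sub>R step n) \<le> (L + B * K) * C"
    if "norm z \<le> C * step n" "norm p \<le> L * norm z" "norm A \<le> B" for n p and z :: "real^'n" and A :: "real^'n^'n"
  proof -
    have "norm (p - A *v z) \<le> norm p + norm (A *v z)" by (rule norm_triangle_ineq4)
    also have "\<dots> \<le> L * norm z + norm A * norm z * K" using that K by (intro add_mono)
    also have "\<dots> \<le> L * norm z + B * norm z * K" using that K(1) by (intro add_mono mult_right_mono) auto
    also have "\<dots> = (L + B * K) * norm z" by (simp add: algebra_simps)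
    also have "\<dots> \<le> (L + B * K) * (C * step n)" using that B(1) K(1) L_pos by (intro mult_left_mono) auto
    finally have "norm (p - A *v z) \<le> (L + B * K) * C * step n" by (simp add: mult.assoc)
    then show ?thesis unfolding norm_scaleR using step(1)[of n] by (simp add: field_simps)
  qed
  let ?B1 = "(L + B * K) * C" and ?B2 = "BF + real CARD('k) * (L * C)"
  have z: "norm (xn n \<theta> t - traj u \<theta> t) \<le> C * step n" if "t \<in> {0..1}" "\<theta> \<in> \<Theta>" for n \<theta> t
    using C(2)[OF _ _ that, of "step n"] step(1,2)[of n] by simp
  have pos: "?B1 \<ge> 0" "?B2 \<ge> 0" using B(1) BF(1) C(1) K(1) L_pos by auto
  show ?thesis
  proof (rule that[of "?B1 + ?B2"])
    fix n \<theta> t i assume t: "t \<in> {0..1::real}" and \<theta>: "\<theta> \<in> \<Theta>"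
    have "norm (F0_quotient n \<theta> t) \<le> ?B1" unfolding F0_quotient_def
      using F0_lipschitz[OF \<theta> \<theta>, of "xn n \<theta> t" "traj u \<theta> t"]
      by (intro q z t \<theta> B) auto
    then show "norm (F0_quotient n \<theta> t) \<le> ?B1 + ?B2" using pos by linarith
    have "norm (F_quotient i n \<theta> t) \<le> ?B1" unfolding F_quotient_def
      using F_lipschitz[OF \<theta> \<theta>, where i = i and ?x1.0 = "xn n \<theta> t" and ?x2.0 = "traj u \<theta> t"]
      by (intro q z t \<theta> B) auto
    then show "norm (F_quotient i n \<theta> t) \<le> ?B1 + ?B2" using pos by linarith
    have "norm (F (xn n \<theta> t) \<theta> *v v t - F (traj u \<theta> t) \<theta> *v v t)
        \<le> real CARD('k) * norm (v t) * (L * norm (xn n \<theta> t - traj u \<theta> t))" by (rule F_mult_lipschitz[OF \<theta>])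
    also have "\<dots> \<le> real CARD('k) * 1 * (L * C)"
    proof (intro mult_mono v_bound)
      have "C * step n \<le> C" using C(1) step(2)[of n] by (simp add: mult_left_le)
      then show "norm (xn n \<theta> t - traj u \<theta> t) \<le> C" using z[OF t \<theta>, of n] by linarith
    qed (use L_pos C in auto)
    finally have 1: "norm (F (xn n \<theta> t) \<theta> *v v t - F (traj u \<theta> t) \<theta> *v v t) \<le> real CARD('k) * (L * C)" by simp
    have 2: "norm (F (traj u \<theta> t) \<theta> *v v t) \<le> BF"
      using BF(2)[OF t \<theta>, of "v t"] mult_left_mono[OF v_bound[of t] BF(1)] by simp
    have "norm (F (xn n \<theta> t) \<theta> *v v t) \<le> norm (F (traj u \<theta> t) \<theta> *v v t) + norm (F (xn n \<theta> t) \<theta> *v v t - F (traj u \<theta> t) \<theta> *v v t)"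
      by (rule norm_triangle_sub)
    then show "norm (F (xn n \<theta> t) \<theta> *v v t) \<le> ?B1 + ?B2" using 1 2 pos by linarith
  qed (use pos in auto)
qed

lemma duality_integral:
  assumes \<theta>: "\<theta> \<in> \<Theta>"
  shows "(\<lambda>t. \<Lambda> t \<theta> \<bullet> (F (traj u \<theta> t) \<theta> *v v t)) integrable_on {0..1}"
    and "(\<lambda>n. (\<Lambda> 1 \<theta> \<bullet> (xn n \<theta> 1 - traj u \<theta> 1)) / step n)
      \<longlonglongrightarrow> integral {0..1} (\<lambda>t. \<Lambda> t \<theta> \<bullet> (F (traj u \<theta> t) \<theta> *v v t))"
proof -
  obtain C where C: "C \<ge> 0"
    "\<And>c t \<theta>. 0 \<le> c \<Longrightarrow> c \<le> 1 \<Longrightarrow> t \<in> {0..1} \<Longrightarrow> \<theta> \<in> \<Theta> \<Longrightarrow> norm (traj (pert v c) \<theta> t - traj u \<theta> t) \<le> C * c"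
    using traj_pert_bound by blast
  have z: "norm (xn n \<theta> t - traj u \<theta> t) \<le> C * step n" if "t \<in> {0..1}" for n t
    using C(2)[OF _ _ that \<theta>, of "step n"] step(1,2)[of n] by simp
  obtain B where B: "B \<ge> 0"
    "\<And>n \<theta> t. t \<in> {0..1} \<Longrightarrow> \<theta> \<in> \<Theta> \<Longrightarrow> norm (F0_quotient n \<theta> t) \<le> B"
    "\<And>i n \<theta> t. t \<in> {0..1} \<Longrightarrow> \<theta> \<in> \<Theta> \<Longrightarrow> norm (F_quotient i n \<theta> t) \<le> B"
    "\<And>n \<theta> t. t \<in> {0..1} \<Longrightarrow> \<theta> \<in> \<Theta> \<Longrightarrow> norm (F (xn n \<theta> t) \<theta> *v v t) \<le> B"
    using quotients_bound by blast
  have "continuous_on {0..1} (\<lambda>t. norm (\<Lambda> t \<theta>))" by (intro continuous_on_norm \<Lambda>_continuous \<theta>)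
  note cL = this
  \<comment> \<open>The drift remainder and the term with \<open>v\<close> contribute
    \<open>B\<close> each. The column remainders are multiplied by the control, so the majorant is
    integrable rather than bounded.\<close>
  let ?h = "\<lambda>t. (2 * B + real CARD('k) * norm (u t) * B) * norm (\<Lambda> t \<theta>)"
  have h: "?h integrable_on {0..1}"
    by (intro integrable_on_mult_continuous[OF _ _ cL] integrable_add integrable_on_mult_left
        integrable_on_mult_right L2_controls_norm_integrable u) (use B in auto)
  have le: "norm (duality_integrand n \<theta> t) \<le> ?h t" if t: "t \<in> {0..1}" for n t
  proof -
    have "norm (F0_quotient n \<theta> t + (\<Sum>i\<in>UNIV. (u t $ i) *\<^sub>R F_quotient i n \<theta> t) + F (xn n \<theta> t) \<theta> *v v t)
      \<le> B + real CARD('k) * norm (u t) * B + B"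
      by (intro norm_triangle_mono norm_sum_scaleR_le B t \<theta>)
    then show ?thesis unfolding duality_integrand_eq real_norm_def
      by (intro order_trans[OF Cauchy_Schwarz_ineq2]) (simp add: mult.commute[of "norm (\<Lambda> t \<theta>)"] mult_right_mono)
  qed
  have lim: "(\<lambda>n. duality_integrand n \<theta> t) \<longlonglongrightarrow> \<Lambda> t \<theta> \<bullet> (F (traj u \<theta> t) \<theta> *v v t)" if t: "t \<in> {0..1}" for t
  proof -
    have 0: "(\<lambda>n. F0_quotient n \<theta> t) \<longlonglongrightarrow> 0" unfolding F0_quotient_def
      by (rule has_derivative_remainder_quotient[OF F0_has_derivative[OF \<theta>] z[OF t] step(1) step(3)])
    have i: "(\<lambda>n. F_quotient i n \<theta> t) \<longlonglongrightarrow> 0" for i unfolding F_quotient_def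
      by (rule has_derivative_remainder_quotient[OF F_has_derivative[OF \<theta>] z[OF t] step(1) step(3)])
    have "(\<lambda>n. F (xn n \<theta> t) \<theta> *v v t) \<longlonglongrightarrow> F (traj u \<theta> t) \<theta> *v v t"
    proof (rule LIM_zero_cancel, rule Lim_null_comparison)
      show "(\<lambda>n. real CARD('k) * 1 * (L * (C * step n))) \<longlonglongrightarrow> 0"
        using tendsto_mult_right_zero[OF step(3), of "real CARD('k) * 1 * L * C"] by (simp add: mult.assoc)
      show "\<forall>\<^sub>F n in sequentially. norm (F (xn n \<theta> t) \<theta> *v v t - F (traj u \<theta> t) \<theta> *v v t) \<le> real CARD('k) * 1 * (L * (C * step n))"
      proof (rule always_eventually, rule allI)
        fix n
        have "real CARD('k) * norm (v t) * (L * norm (xn n \<theta> t - traj u \<theta> t)) \<le> real CARD('k) * 1 * (L * (C * step n))"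
          using L_pos by (intro mult_mono v_bound z t mult_left_mono) auto
        then show "norm (F (xn n \<theta> t) \<theta> *v v t - F (traj u \<theta> t) \<theta> *v v t) \<le> real CARD('k) * 1 * (L * (C * step n))"
          using F_mult_lipschitz[OF \<theta>, of "xn n \<theta> t" "v t" "traj u \<theta> t"] by linarith
      qed
    qed
    from tendsto_add[OF tendsto_add[OF 0 tendsto_sum[OF tendsto_scaleR[OF tendsto_const i]]] this]
    have "(\<lambda>n. F0_quotient n \<theta> t + (\<Sum>i\<in>UNIV. (u t $ i) *\<^sub>R F_quotient i n \<theta> t) + F (xn n \<theta> t) \<theta> *v v t)
      \<longlonglongrightarrow> F (traj u \<theta> t) \<theta> *v v t" by simp
    then show ?thesis unfolding duality_integrand_eq by (intro tendsto_inner tendsto_const)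
  qed
  note hi = duality_integrand_has_integral[OF \<theta>]
  have ii: "duality_integrand n \<theta> integrable_on {0..1}" for n using hi by blast
  show "(\<lambda>t. \<Lambda> t \<theta> \<bullet> (F (traj u \<theta> t) \<theta> *v v t)) integrable_on {0..1}"
    by (rule dominated_convergence(1)[OF ii h le lim])
  have "(\<lambda>n. integral {0..1} (duality_integrand n \<theta>)) \<longlonglongrightarrow> integral {0..1} (\<lambda>t. \<Lambda> t \<theta> \<bullet> (F (traj u \<theta> t) \<theta> *v v t))"
    by (rule dominated_convergence(2)[OF ii h le lim])
  then show "(\<lambda>n. (\<Lambda> 1 \<theta> \<bullet> (xn n \<theta> 1 - traj u \<theta> 1)) / step n)
      \<longlonglongrightarrow> integral {0..1} (\<lambda>t. \<Lambda> t \<theta> \<bullet> (F (traj u \<theta> t) \<theta> *v v t))"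
    using integral_unique[OF hi] by simp
qed

section \<open>Difference quotients of the final cost\<close>

text \<open>The linear part of the increment of \<open>a\<close> pairs its gradient with the final
  state difference. By the terminal condition that gradient is \<open>\<Lambda> 1 \<theta>\<close>,
  so this part is the quantity whose limit \<open>duality_integral\<close> gives.\<close>

lemma final_cost_quotient_tendsto:
  assumes \<theta>: "\<theta> \<in> \<Theta>"
  shows "(\<lambda>n. (a (xn n \<theta> 1) \<theta> - a (traj u \<theta> 1) \<theta>) / step n)
      \<longlonglongrightarrow> integral {0..1} (\<lambda>t. \<Lambda> t \<theta> \<bullet> (F (traj u \<theta> t) \<theta> *v v t))"
proof -
  obtain C where C: "C \<ge> 0"
    "\<And>c t \<theta>. 0 \<le> c \<Longrightarrow> c \<le> 1 \<Longrightarrow> t \<in> {0..1} \<Longrightarrow> \<theta> \<in> \<Theta> \<Longrightarrow> norm (traj (pert v c) \<theta> t - traj u \<theta> t) \<le> C * c"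
    using traj_pert_bound by blast
  have z: "norm (xn n \<theta> 1 - traj u \<theta> 1) \<le> C * step n" for n
    using C(2)[OF _ _ _ \<theta>, of "step n" 1] step(1,2)[of n] by simp
  have "(\<lambda>n. (a (xn n \<theta> 1) \<theta> - a (traj u \<theta> 1) \<theta> - gradient (\<lambda>y. a y \<theta>) (traj u \<theta> 1) \<bullet> (xn n \<theta> 1 - traj u \<theta> 1)) /\<^sub>R step n) \<longlonglongrightarrow> 0"
    by (rule has_derivative_remainder_quotient[OF has_derivative_gradient[OF a_differentiable[OF \<theta>]] z step(1) step(3)])
  from tendsto_add[OF this duality_integral(2)[OF \<theta>]]
  show ?thesis using \<Lambda>_1[OF \<theta>] by (simp add: divide_inverse algebra_simps)
qed

text \<open>The dominating constant for the limit under the integral over the parameter. Steps are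
  at most 1, so all final states lie in the ball of radius \<open>R + C\<close>; there the gradient
  is bounded and the mean value inequality applies.\<close>

lemma final_cost_quotient_bound:
  obtains B where "\<And>n \<theta>. \<theta> \<in> \<Theta> \<Longrightarrow> norm ((a (xn n \<theta> 1) \<theta> - a (traj u \<theta> 1) \<theta>) / step n) \<le> B"
proof -
  obtain C where C: "C \<ge> 0"
    "\<And>c t \<theta>. 0 \<le> c \<Longrightarrow> c \<le> 1 \<Longrightarrow> t \<in> {0..1} \<Longrightarrow> \<theta> \<in> \<Theta> \<Longrightarrow> norm (traj (pert v c) \<theta> t - traj u \<theta> t) \<le> C * c"
    using traj_pert_bound by blast
  have z: "norm (xn n \<theta> 1 - traj u \<theta> 1) \<le> C * step n" if "\<theta> \<in> \<Theta>" for n \<theta>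
    using C(2)[OF _ _ _ that, of "step n" 1] step(1,2)[of n] by simp
  obtain R where R: "\<And>t \<theta>. t \<in> {0..1} \<Longrightarrow> \<theta> \<in> \<Theta> \<Longrightarrow> norm (traj u \<theta> t) \<le> R"
    using traj_bounded[OF u] by blast
  let ?S = "cball (0::real^'n) (R + C)"
  have S: "compact (?S \<times> \<Theta>)" by (intro compact_Times compact_cball compact_\<Theta>)
  have c: "continuous_on (?S \<times> \<Theta>) (\<lambda>(x,\<theta>). gradient (\<lambda>y. a y \<theta>) x)"
    by (rule continuous_on_subset[OF a_gradient_continuous]) auto
  obtain G where G: "G \<ge> 0" "\<And>p. p \<in> ?S \<times> \<Theta> \<Longrightarrow> norm ((\<lambda>(x,\<theta>). gradient (\<lambda>y. a y \<theta>) x) p) \<le> G"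
    by (rule compact_uniform_bound[where g = "\<lambda>_::unit. \<lambda>(x,\<theta>). gradient (\<lambda>y. a y \<theta>) x", OF S c]) blast
  show ?thesis
  proof (rule that[of "G * C"])
    fix n \<theta> assume \<theta>: "\<theta> \<in> \<Theta>"
    have in1: "traj u \<theta> 1 \<in> ?S" using R[of 1, OF _ \<theta>] C(1) by simp
    have "C * step n \<le> C" using C(1) step(2)[of n] by (simp add: mult_left_le)
    then have in2: "xn n \<theta> 1 \<in> ?S"
      using R[of 1, OF _ \<theta>] z[OF \<theta>, of n] norm_triangle_sub[of "xn n \<theta> 1" "traj u \<theta> 1"] by simp
    have "norm (a (xn n \<theta> 1) \<theta> - a (traj u \<theta> 1) \<theta>) \<le> G * norm (xn n \<theta> 1 - traj u \<theta> 1)"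
    proof (rule differentiable_bound[OF convex_cball _ _ in2 in1])
      fix x assume x: "x \<in> ?S"
      show "((\<lambda>x. a x \<theta>) has_derivative (\<lambda>h. gradient (\<lambda>y. a y \<theta>) x \<bullet> h)) (at x within ?S)"
        by (rule has_derivative_at_withinI[OF has_derivative_gradient[OF a_differentiable[OF \<theta>]]])
      have "norm (gradient (\<lambda>y. a y \<theta>) x) \<le> G" using G(2)[of "(x,\<theta>)"] x \<theta> by simp
      then have "norm (gradient (\<lambda>y. a y \<theta>) x \<bullet> h) \<le> G * norm h" for h
        using Cauchy_Schwarz_ineq2[of "gradient (\<lambda>y. a y \<theta>) x" h]
        by (simp add: order_trans[OF _ mult_right_mono])
      then show "onorm (\<lambda>h. gradient (\<lambda>y. a y \<theta>) x \<bullet> h) \<le> G" by (intro onorm_bound G(1))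
    qed
    also have "\<dots> \<le> G * (C * step n)" by (intro mult_left_mono z \<theta> G(1))
    finally show "norm ((a (xn n \<theta> 1) \<theta> - a (traj u \<theta> 1) \<theta>) / step n) \<le> G * C"
      using step(1)[of n] by (simp add: norm_divide divide_le_eq)
  qed
qed

end

section \<open>Stationarity and the maximum condition\<close>

locale optimal_control_problem = adjoint_system \<Theta> F0 F x0 L a u \<Lambda>
  for \<Theta> :: "'p::euclidean_space set" and F0 :: "real^'n \<Rightarrow> 'p \<Rightarrow> real^'n"
    and F :: "real^'n \<Rightarrow> 'p \<Rightarrow> real^'k^'n" and x0 L a u \<Lambda> +
  fixes \<beta> :: real and \<mu> :: "'p measure"
  assumes \<beta>_pos: "\<beta> > 0"
    and prob: "prob_space \<mu>"
    and sets_\<mu>: "sets \<mu> = sets (restrict_space borel \<Theta>)"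
    and a_continuous: "continuous_on (UNIV \<times> \<Theta>) (\<lambda>(x, \<theta>). a x \<theta>)"
    and minimizer: "L2_local_minimizer (cost F0 F x0 a \<beta> \<mu>) u"
begin

abbreviation unit_lebesgue :: "real measure" where
  "unit_lebesgue \<equiv> lebesgue_on {0..1}"

lemma finite_unit_lebesgue: "finite_measure unit_lebesgue"
  by (intro finite_measure_lebesgue_on) simp

lemma finite_\<mu>: "finite_measure \<mu>"
  using prob by (simp add: prob_space_def)

lemma space_\<mu>: "space \<mu> = \<Theta>"
  using sets_eq_imp_space_eq[OF sets_\<mu>] by (simp add: space_restrict_space)

lemma continuous_on_imp_measurable:
  fixes g :: "'p \<Rightarrow> 'b::topological_space"
  assumes "continuous_on \<Theta> g"
  shows "g \<in> borel_measurable \<mu>"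
  using borel_measurable_continuous_on_restrict[OF assms] by (simp add: measurable_cong_sets[OF sets_\<mu> refl])

lemma continuous_on_imp_integrable:
  fixes g :: "'p \<Rightarrow> 'b::euclidean_space"
  assumes "continuous_on \<Theta> g"
  shows "integrable \<mu> g"
proof -
  have "bounded (g ` \<Theta>)" using assms compact_\<Theta> by (intro compact_imp_bounded compact_continuous_image)
  then obtain B where "\<And>\<theta>. \<theta> \<in> \<Theta> \<Longrightarrow> norm (g \<theta>) \<le> B" unfolding bounded_iff by (meson imageI)
  then show ?thesis
    using continuous_on_imp_measurable[OF assms] space_\<mu>
    by (intro finite_measure.integrable_const_bound[OF finite_\<mu>, where B = B] AE_I2) auto
qed

lemma final_cost_integrable:
  assumes "w \<in> L2_controls"
  shows "integrable \<mu> (\<lambda>\<theta>. a (traj w \<theta> 1) \<theta>)"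
  using continuous_on_slices(2)[OF continuous_on_compose_traj[OF assms a_continuous], of 1]
  by (intro continuous_on_imp_integrable) auto

lemma L2_norm_square: "(L2_norm w)\<^sup>2 = (\<integral>t. (norm (w t))\<^sup>2 \<partial>unit_lebesgue)"
  unfolding L2_norm_def by (intro real_sqrt_pow2 Bochner_Integration.integral_nonneg) simp

lemma u_norm_integrable: "integrable unit_lebesgue (\<lambda>t. norm (u t))"
proof (rule Bochner_Integration.integrable_bound)
  have [measurable]: "u \<in> borel_measurable unit_lebesgue" by (rule L2_controls_measurable[OF u])
  show "(\<lambda>t. norm (u t)) \<in> borel_measurable unit_lebesgue" by measurable
  show "integrable unit_lebesgue (\<lambda>t. 1 + (norm (u t))\<^sup>2)"
    using u by (intro Bochner_Integration.integrable_add finite_measure.integrable_const finite_unit_lebesgue)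
      (auto simp: L2_controls_def)
  have "x \<le> 1 + x\<^sup>2" for x :: real
  proof -
    have "0 \<le> (x - 1)\<^sup>2" by simp
    then have "2 * x \<le> 1 + x\<^sup>2" by (simp add: power2_diff)
    moreover have "0 \<le> x\<^sup>2" by simp
    ultimately show ?thesis by linarith
  qed
  then show "AE t in unit_lebesgue. norm (norm (u t)) \<le> norm (1 + (norm (u t))\<^sup>2)"
    by (intro AE_I2) (simp add: abs_of_nonneg add_nonneg_nonneg)
qed

lemma inner_bounded_integrable:
  fixes v :: "real \<Rightarrow> real^'k"
  assumes v: "v \<in> borel_measurable unit_lebesgue" "\<And>t. norm (v t) \<le> 1"
  shows "integrable unit_lebesgue (\<lambda>t. u t \<bullet> v t)"
proof (rule Bochner_Integration.integrable_bound[OF u_norm_integrable])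
  have [measurable]: "u \<in> borel_measurable unit_lebesgue" by (rule L2_controls_measurable[OF u])
  note [measurable] = v(1)
  show "(\<lambda>t. u t \<bullet> v t) \<in> borel_measurable unit_lebesgue" by measurable
  show "AE t in unit_lebesgue. norm (u t \<bullet> v t) \<le> norm (norm (u t))"
  proof (rule AE_I2)
    fix t
    have "\<bar>u t \<bullet> v t\<bar> \<le> norm (u t) * norm (v t)" by (rule Cauchy_Schwarz_ineq2)
    also have "\<dots> \<le> norm (u t)" using v(2)[of t] by (simp add: mult_left_le)
    finally show "norm (u t \<bullet> v t) \<le> norm (norm (u t))" by simp
  qed
qed

section \<open>The variational inequality at a local minimizer\<close>

text \<open>The minimality inequality is divided by a positive step, so its sign survives the limit.
  The second-order part of the control cost leaves \<open>\<beta> / 2 * step n * V\<close>, which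
  tends to 0.\<close>

lemma first_variation_nonneg:
  fixes v :: "real \<Rightarrow> real^'k"
  assumes v: "v \<in> borel_measurable unit_lebesgue" "\<And>t. norm (v t) \<le> 1"
  shows "0 \<le> (\<integral>\<theta>. integral {0..1} (\<lambda>t. \<Lambda> t \<theta> \<bullet> (F (traj u \<theta> t) \<theta> *v v t)) \<partial>\<mu>) + \<beta> * (\<integral>t. u t \<bullet> v t \<partial>unit_lebesgue)"
proof -
  interpret perturbation \<Theta> F0 F x0 L a u \<Lambda> v
    by unfold_locales (fact v)+
  define U where "U = (\<integral>t. u t \<bullet> v t \<partial>unit_lebesgue)"
  define V where "V = (\<integral>t. (norm (v t))\<^sup>2 \<partial>unit_lebesgue)"
  define q where "q n \<theta> = (a (xn n \<theta> 1) \<theta> - a (traj u \<theta> 1) \<theta>) / step n" for n \<theta>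
  have iu: "integrable unit_lebesgue (\<lambda>t. (norm (u t))\<^sup>2)" using u by (simp add: L2_controls_def)
  note iuv = inner_bounded_integrable[OF v]
  have iv: "integrable unit_lebesgue (\<lambda>t. (norm (v t))\<^sup>2)"
  proof (rule finite_measure.integrable_const_bound[OF finite_unit_lebesgue, where B = 1])
    note [measurable] = v(1)
    show "(\<lambda>t. (norm (v t))\<^sup>2) \<in> borel_measurable unit_lebesgue" by measurable
    show "AE t in unit_lebesgue. norm ((norm (v t))\<^sup>2) \<le> 1"
      using v(2) by (intro AE_I2) (simp add: power_le_one)
  qed
  have sq: "(L2_norm (pert v c))\<^sup>2 = (L2_norm u)\<^sup>2 + 2 * c * U + c\<^sup>2 * V" for c
  proof -
    have "(L2_norm (pert v c))\<^sup>2 = (\<integral>t. (norm (u t))\<^sup>2 + 2 * c * (u t \<bullet> v t) + c\<^sup>2 * (norm (v t))\<^sup>2 \<partial>unit_lebesgue)"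
      unfolding L2_norm_square
    proof (rule Bochner_Integration.integral_cong[OF refl])
      fix t
      show "(norm (pert v c t))\<^sup>2 = (norm (u t))\<^sup>2 + 2 * c * (u t \<bullet> v t) + c\<^sup>2 * (norm (v t))\<^sup>2"
        unfolding pert_def power2_norm_eq_inner
        by (simp add: inner_add_left inner_add_right inner_commute[of "v t" "u t"] power2_eq_square algebra_simps)
    qed
    also have "\<dots> = (L2_norm u)\<^sup>2 + 2 * c * U + c\<^sup>2 * V"
      using iu iuv iv by (simp add: L2_norm_square U_def V_def)
    finally show ?thesis .
  qed
  \<comment> \<open>Shows that the perturbed controls eventually enter the ball in which
    \<open>u\<close> is minimal.\<close>
  have dist: "L2_norm (\<lambda>t. pert v (step n) t - u t) = step n * sqrt V" for n
  proof -
    have "L2_norm (\<lambda>t. pert v (step n) t - u t) = sqrt (\<integral>t. (step n)\<^sup>2 * (norm (v t))\<^sup>2 \<partial>unit_lebesgue)"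
      unfolding L2_norm_def by (simp add: pert_def power_mult_distrib)
    also have "\<dots> = step n * sqrt V" using step(1)[of n] by (simp add: V_def real_sqrt_mult)
    finally show ?thesis .
  qed
  obtain r where r: "r > 0" "\<And>w. w \<in> L2_controls \<Longrightarrow> L2_norm (\<lambda>t. w t - u t) < r \<Longrightarrow>
      cost F0 F x0 a \<beta> \<mu> u \<le> cost F0 F x0 a \<beta> \<mu> w"
    using minimizer unfolding L2_local_minimizer_def by blast
  have "(\<lambda>n. step n * sqrt V) \<longlonglongrightarrow> 0 * sqrt V" by (intro tendsto_intros step(3))
  then have "eventually (\<lambda>n. step n * sqrt V < r) sequentially"
    by (rule order_tendstoD(2)) (use r in simp)
  then have ev: "eventually (\<lambda>n. 0 \<le> (\<integral>\<theta>. q n \<theta> \<partial>\<mu>) + \<beta> * U + \<beta> / 2 * step n * V) sequentially"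
  proof eventually_elim
    case (elim n)
    have "cost F0 F x0 a \<beta> \<mu> u \<le> cost F0 F x0 a \<beta> \<mu> (pert v (step n))"
      by (rule r(2)[OF pert_L2]) (use dist elim in simp)
    then have "0 \<le> (\<integral>\<theta>. a (xn n \<theta> 1) \<theta> \<partial>\<mu>) - (\<integral>\<theta>. a (traj u \<theta> 1) \<theta> \<partial>\<mu>) + \<beta> / 2 * (2 * step n * U + (step n)\<^sup>2 * V)"
      unfolding cost_def sq by (simp add: algebra_simps)
    also have "(\<integral>\<theta>. a (xn n \<theta> 1) \<theta> \<partial>\<mu>) - (\<integral>\<theta>. a (traj u \<theta> 1) \<theta> \<partial>\<mu>) = step n * (\<integral>\<theta>. q n \<theta> \<partial>\<mu>)"
      unfolding q_def using step(1)[of n]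
      by (simp add: Bochner_Integration.integral_diff[OF final_cost_integrable[OF pert_L2] final_cost_integrable[OF u]])
    also have "step n * (\<integral>\<theta>. q n \<theta> \<partial>\<mu>) + \<beta> / 2 * (2 * step n * U + (step n)\<^sup>2 * V)
        = step n * ((\<integral>\<theta>. q n \<theta> \<partial>\<mu>) + \<beta> * U + \<beta> / 2 * step n * V)"
      by (simp add: algebra_simps power2_eq_square)
    finally show ?case using step(1)[of n] by (simp add: zero_le_mult_iff)
  qed
  obtain B where B: "\<And>n \<theta>. \<theta> \<in> \<Theta> \<Longrightarrow> norm (q n \<theta>) \<le> B"
    using final_cost_quotient_bound unfolding q_def by blast
  have qi: "integrable \<mu> (q n)" for n
    unfolding q_def by (intro integrable_divide Bochner_Integration.integrable_diff final_cost_integrable pert_L2 u)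
  let ?Q = "\<lambda>\<theta>. integral {0..1} (\<lambda>t. \<Lambda> t \<theta> \<bullet> (F (traj u \<theta> t) \<theta> *v v t))"
  have qlim: "(\<lambda>n. q n \<theta>) \<longlonglongrightarrow> ?Q \<theta>" if "\<theta> \<in> space \<mu>" for \<theta>
    using final_cost_quotient_tendsto that unfolding q_def space_\<mu> .
  have "(\<lambda>n. \<integral>\<theta>. q n \<theta> \<partial>\<mu>) \<longlonglongrightarrow> (\<integral>\<theta>. ?Q \<theta> \<partial>\<mu>)"
  proof (rule integral_dominated_convergence[where w = "\<lambda>_. B"])
    \<comment> \<open>Measurability in the parameter is inherited from the difference quotients
      through the pointwise limit.\<close>
    show "?Q \<in> borel_measurable \<mu>"
      by (rule borel_measurable_LIMSEQ_metric[OF borel_measurable_integrable[OF qi] qlim])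
    show "q n \<in> borel_measurable \<mu>" for n by (rule borel_measurable_integrable[OF qi])
    show "integrable \<mu> (\<lambda>_. B)" by (rule finite_measure.integrable_const[OF finite_\<mu>])
    show "AE \<theta> in \<mu>. (\<lambda>n. q n \<theta>) \<longlonglongrightarrow> ?Q \<theta>" by (intro AE_I2 qlim)
    show "AE \<theta> in \<mu>. norm (q n \<theta>) \<le> B" for n by (intro AE_I2 B) (simp add: space_\<mu>)
  qed
  then have "(\<lambda>n. (\<integral>\<theta>. q n \<theta> \<partial>\<mu>) + \<beta> * U + \<beta> / 2 * step n * V) \<longlonglongrightarrow> (\<integral>\<theta>. ?Q \<theta> \<partial>\<mu>) + \<beta> * U + \<beta> / 2 * 0 * V"
    by (intro tendsto_intros step(3))
  then have "0 \<le> (\<integral>\<theta>. ?Q \<theta> \<partial>\<mu>) + \<beta> * U + \<beta> / 2 * 0 * V"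
    by (rule tendsto_lowerbound[OF _ ev]) simp
  then show ?thesis by (simp add: U_def)
qed

section \<open>Exchange of the integrals over time and parameter\<close>

text \<open>The row vector representing the functional that sends a direction to
  \<open>\<Lambda> F\<close> applied to it. With the direction factored out, averaging over the
  parameter acts on \<open>P\<close> alone.\<close>

definition P :: "real \<Rightarrow> 'p \<Rightarrow> real^'k" where
  "P t \<theta> = \<Lambda> t \<theta> v* F (traj u \<theta> t) \<theta>"

definition p :: "real \<Rightarrow> real^'k" where
  "p t = (\<integral>\<theta>. P t \<theta> \<partial>\<mu>)"

lemma P_continuous: "continuous_on ({0..1} \<times> \<Theta>) (\<lambda>(t,\<theta>). P t \<theta>)"
proof -
  have e: "P t \<theta> = (\<chi> i. \<Lambda> t \<theta> \<bullet> column i (F (traj u \<theta> t) \<theta>))" for t \<theta>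
    by (simp add: P_def vector_matrix_mult_def inner_vec_def column_def mult.commute)
  have c: "continuous_on ({0..1} \<times> \<Theta>) (\<lambda>x. traj u (snd x) (fst x))"
    "continuous_on ({0..1} \<times> \<Theta>) (\<lambda>x. \<Lambda> (fst x) (snd x))"
    using traj_continuous_on_Times[OF u] \<Lambda>_continuous_on_Times by (simp_all add: split_def)
  show ?thesis unfolding e split_def
    by (intro continuous_on_vec_lambda continuous_on_inner c continuous_on_column_F continuous_intros) auto
qed

lemma P_bound:
  obtains B where "B \<ge> 0" "\<And>t \<theta>. t \<in> {0..1} \<Longrightarrow> \<theta> \<in> \<Theta> \<Longrightarrow> norm (P t \<theta>) \<le> B"
proof -
  have S: "compact ({0..1::real} \<times> \<Theta>)" by (intro compact_Times compact_\<Theta> compact_Icc)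
  obtain B where B: "B \<ge> 0" "\<And>x. x \<in> {0..1} \<times> \<Theta> \<Longrightarrow> norm ((\<lambda>(t,\<theta>). P t \<theta>) x) \<le> B"
    by (rule compact_uniform_bound[where g = "\<lambda>_::unit. \<lambda>(t,\<theta>). P t \<theta>", OF S P_continuous]) blast
  show ?thesis by (rule that[OF B(1)]) (use B(2) in fastforce)
qed

lemma P_slice_integrable: "t \<in> {0..1} \<Longrightarrow> integrable \<mu> (P t)"
  using continuous_on_slices(2)[of "\<lambda>\<theta> t. P t \<theta>" t] P_continuous
  by (intro continuous_on_imp_integrable) (simp add: split_def)

text \<open>Continuity yields Borel measurability, whereas the product carries Lebesgue sets in
  time. The identity map from the product into the restricted Borel space is measurable, and
  composing with it bridges the two.\<close>

lemma P_measurable: "(\<lambda>(t,\<theta>). P t \<theta>) \<in> borel_measurable (unit_lebesgue \<Otimes>\<^sub>M \<mu>)"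
proof -
  have i1: "(\<lambda>t. t) \<in> borel_measurable unit_lebesgue"
    by (rule continuous_imp_measurable_on_sets_lebesgue) (auto intro: continuous_intros)
  have i2: "(\<lambda>\<theta>. \<theta>) \<in> borel_measurable \<mu>"
    by (rule continuous_on_imp_measurable) (rule continuous_on_id)
  have "(\<lambda>x. (fst x, snd x)) \<in> borel_measurable (unit_lebesgue \<Otimes>\<^sub>M \<mu>)"
    by (intro borel_measurable_Pair measurable_compose[OF measurable_fst i1] measurable_compose[OF measurable_snd i2])
  then have "(\<lambda>x. x) \<in> measurable (unit_lebesgue \<Otimes>\<^sub>M \<mu>) (restrict_space borel ({0..1} \<times> \<Theta>))"
    by (intro measurable_restrict_space2) (auto simp: space_pair_measure space_\<mu>)
  from measurable_compose[OF this borel_measurable_continuous_on_restrict[OF P_continuous]]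
  show ?thesis by simp
qed

lemma p_measurable: "p \<in> borel_measurable unit_lebesgue"
proof -
  interpret finite_measure \<mu> by (rule finite_\<mu>)
  show ?thesis unfolding p_def[abs_def] by (rule borel_measurable_lebesgue_integral[OF P_measurable])
qed

lemma p_bound:
  obtains B where "\<And>t. t \<in> {0..1} \<Longrightarrow> norm (p t) \<le> B"
proof -
  obtain B where B: "B \<ge> 0" "\<And>t \<theta>. t \<in> {0..1} \<Longrightarrow> \<theta> \<in> \<Theta> \<Longrightarrow> norm (P t \<theta>) \<le> B" using P_bound by blast
  show ?thesis
  proof (rule that)
    fix t :: real assume t: "t \<in> {0..1}"
    have "norm (p t) \<le> (\<integral>\<theta>. norm (P t \<theta>) \<partial>\<mu>)" unfolding p_def by (rule integral_norm_bound)
    also have "\<dots> \<le> (\<integral>\<theta>. B \<partial>\<mu>)"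
      using P_slice_integrable[OF t] B(2)[OF t]
      by (intro integral_mono finite_measure.integrable_const finite_\<mu> integrable_norm) (auto simp: space_\<mu>)
    finally show "norm (p t) \<le> (\<integral>\<theta>. B \<partial>\<mu>)" .
  qed
qed

text \<open>The integrand is bounded and measurable on a product of finite measures, so Fubini
  applies once the inner gauge integral is identified with the Lebesgue integral.\<close>

lemma integral_P_swap:
  fixes v :: "real \<Rightarrow> real^'k"
  assumes v: "v \<in> borel_measurable unit_lebesgue" "\<And>t. norm (v t) \<le> 1"
  shows "(\<integral>\<theta>. integral {0..1} (\<lambda>t. \<Lambda> t \<theta> \<bullet> (F (traj u \<theta> t) \<theta> *v v t)) \<partial>\<mu>) = (\<integral>t. p t \<bullet> v t \<partial>unit_lebesgue)"
proof -
  interpret M: finite_measure unit_lebesgue by (rule finite_unit_lebesgue)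
  interpret N: finite_measure \<mu> by (rule finite_\<mu>)
  interpret pair_sigma_finite unit_lebesgue \<mu> ..
  obtain B where B: "B \<ge> 0" "\<And>t \<theta>. t \<in> {0..1} \<Longrightarrow> \<theta> \<in> \<Theta> \<Longrightarrow> norm (P t \<theta>) \<le> B" using P_bound by blast
  have le: "norm (P t \<theta> \<bullet> v t) \<le> B" if "t \<in> {0..1}" "\<theta> \<in> \<Theta>" for t \<theta>
  proof -
    have "\<bar>P t \<theta> \<bullet> v t\<bar> \<le> norm (P t \<theta>) * norm (v t)" by (rule Cauchy_Schwarz_ineq2)
    also have "\<dots> \<le> B * 1" using B that v(2) by (intro mult_mono) auto
    finally show ?thesis by simp
  qed
  have m: "(\<lambda>(t,\<theta>). P t \<theta> \<bullet> v t) \<in> borel_measurable (unit_lebesgue \<Otimes>\<^sub>M \<mu>)"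
    using borel_measurable_inner[OF P_measurable measurable_compose[OF measurable_fst v(1)]]
    by (simp add: split_def)
  have i: "integrable (unit_lebesgue \<Otimes>\<^sub>M \<mu>) (\<lambda>(t,\<theta>). P t \<theta> \<bullet> v t)"
    by (rule finite_measure.integrable_const_bound[OF finite_measure_pair_measure[OF finite_\<mu> finite_unit_lebesgue] _ m, where B = B])
      (use le in \<open>auto intro!: AE_I2 simp: space_pair_measure space_\<mu>\<close>)
  have "(\<integral>\<theta>. integral {0..1} (\<lambda>t. \<Lambda> t \<theta> \<bullet> (F (traj u \<theta> t) \<theta> *v v t)) \<partial>\<mu>) = (\<integral>\<theta>. (\<integral>t. P t \<theta> \<bullet> v t \<partial>unit_lebesgue) \<partial>\<mu>)"
  proof (rule Bochner_Integration.integral_cong[OF refl])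
    fix \<theta> assume \<theta>: "\<theta> \<in> space \<mu>"
    have "(\<lambda>t. P t \<theta> \<bullet> v t) \<in> borel_measurable unit_lebesgue"
      using measurable_compose[OF measurable_Pair2'[OF \<theta>] m] by simp
    then have "integrable unit_lebesgue (\<lambda>t. P t \<theta> \<bullet> v t)"
      using le \<theta> by (intro M.integrable_const_bound[where B = B] AE_I2) (auto simp: space_\<mu>)
    from lebesgue_integral_eq_integral[OF this]
    show "integral {0..1} (\<lambda>t. \<Lambda> t \<theta> \<bullet> (F (traj u \<theta> t) \<theta> *v v t)) = (\<integral>t. P t \<theta> \<bullet> v t \<partial>unit_lebesgue)"
      by (simp add: P_def dot_lmul_matrix)
  qed
  also have "\<dots> = (\<integral>t. (\<integral>\<theta>. P t \<theta> \<bullet> v t \<partial>\<mu>) \<partial>unit_lebesgue)"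
    by (rule Fubini_integral[OF i])
  also have "\<dots> = (\<integral>t. p t \<bullet> v t \<partial>unit_lebesgue)"
    by (rule Bochner_Integration.integral_cong[OF refl]) (simp add: p_def P_slice_integrable)
  finally show ?thesis .
qed

section \<open>Stationarity and maximality\<close>

text \<open>\<open>g\<close> may be unbounded because \<open>u\<close> is only square integrable;
  dividing by \<open>1 + norm (g t)\<close> makes the direction admissible. The pairing of
  \<open>g\<close> with it is nonpositive and vanishes only where \<open>g\<close> does, so a
  one-sided inequality suffices.\<close>

lemma stationarity: "AE t in unit_lebesgue. p t + \<beta> *\<^sub>R u t = 0"
proof -
  define g where "g t = p t + \<beta> *\<^sub>R u t" for t
  define v where "v t = (- inverse (1 + norm (g t))) *\<^sub>R g t" for t
  have [measurable]: "u \<in> borel_measurable unit_lebesgue" by (rule L2_controls_measurable[OF u])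
  note [measurable] = p_measurable
  have g[measurable]: "g \<in> borel_measurable unit_lebesgue" unfolding g_def by measurable
  have v: "v \<in> borel_measurable unit_lebesgue" unfolding v_def by measurable
  have "1 + norm (g t) > 0" for t using norm_ge_zero[of "g t"] by linarith
  note pos = this
  have v1: "norm (v t) \<le> 1" for t using pos[of t] by (simp add: v_def field_simps)
  obtain B where B: "\<And>t. t \<in> {0..1} \<Longrightarrow> norm (p t) \<le> B" using p_bound by blast
  have ip: "integrable unit_lebesgue (\<lambda>t. p t \<bullet> v t)"
  proof (rule finite_measure.integrable_const_bound[OF finite_unit_lebesgue, where B = "\<bar>B\<bar>"])
    show "AE t in unit_lebesgue. norm (p t \<bullet> v t) \<le> \<bar>B\<bar>"
    proof (rule AE_I2)
      fix t assume "t \<in> space unit_lebesgue"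
      then have t: "t \<in> {0..1}" by simp
      have "\<bar>p t \<bullet> v t\<bar> \<le> norm (p t) * norm (v t)" by (rule Cauchy_Schwarz_ineq2)
      also have "\<dots> \<le> \<bar>B\<bar> * 1" using B[OF t] v1 by (intro mult_mono) auto
      finally show "norm (p t \<bullet> v t) \<le> \<bar>B\<bar>" by simp
    qed
  qed (use v in measurable)
  note iu = inner_bounded_integrable[OF v v1]
  have e: "p t \<bullet> v t + \<beta> * (u t \<bullet> v t) = - ((norm (g t))\<^sup>2 * inverse (1 + norm (g t)))" for t
  proof -
    have "p t \<bullet> v t + \<beta> * (u t \<bullet> v t) = g t \<bullet> v t" by (simp add: g_def inner_add_left)
    also have "\<dots> = - ((norm (g t))\<^sup>2 * inverse (1 + norm (g t)))"
      by (simp add: v_def power2_norm_eq_inner mult.commute)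
    finally show ?thesis .
  qed
  let ?h = "\<lambda>t. (norm (g t))\<^sup>2 * inverse (1 + norm (g t))"
  have i: "integrable unit_lebesgue (\<lambda>t. p t \<bullet> v t + \<beta> * (u t \<bullet> v t))"
    by (intro Bochner_Integration.integrable_add integrable_mult_right ip iu)
  then have ih: "integrable unit_lebesgue ?h" unfolding e by simp
  have "0 \<le> (\<integral>t. p t \<bullet> v t \<partial>unit_lebesgue) + \<beta> * (\<integral>t. u t \<bullet> v t \<partial>unit_lebesgue)"
    using first_variation_nonneg[OF v v1] unfolding integral_P_swap[OF v v1] .
  also have "\<dots> = (\<integral>t. p t \<bullet> v t + \<beta> * (u t \<bullet> v t) \<partial>unit_lebesgue)"
    using ip iu by simp
  also have "\<dots> = - (\<integral>t. ?h t \<partial>unit_lebesgue)" unfolding e by simp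
  finally have "(\<integral>t. ?h t \<partial>unit_lebesgue) \<le> 0" by simp
  moreover have nn: "0 \<le> ?h t" for t using pos[of t] by simp
  then have "0 \<le> (\<integral>t. ?h t \<partial>unit_lebesgue)" by (intro Bochner_Integration.integral_nonneg)
  ultimately have "(\<integral>t. ?h t \<partial>unit_lebesgue) = 0" by simp
  then have "AE t in unit_lebesgue. ?h t = 0"
    using integral_nonneg_eq_0_iff_AE[OF ih] nn by simp
  then show ?thesis
  proof eventually_elim
    case (elim t)
    then have "g t = 0" using pos[of t] by simp
    then show ?case by (simp add: g_def)
  qed
qed

text \<open>Stationarity replaces the averaged row vector by
  \<open>- (\<beta> *\<^sub>R u t)\<close>. Completing the square, the objective at \<open>v\<close>
  falls short of its value at \<open>u t\<close> by \<open>\<beta> / 2\<close> times the squared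
  distance from \<open>v\<close> to \<open>u t\<close>.\<close>

lemma maximum_condition:
  "AE t in unit_lebesgue. is_arg_max
     (\<lambda>v. (\<integral>\<theta>. - ((\<Lambda> t \<theta> v* F (traj u \<theta> t) \<theta>) \<bullet> v) \<partial>\<mu>) - \<beta> / 2 * (norm v)\<^sup>2) (\<lambda>v. True) (u t)"
  using stationarity AE_space
proof eventually_elim
  case (elim t)
  then have t: "t \<in> {0..1}" and "p t = - (\<beta> *\<^sub>R u t)" by (simp_all add: eq_neg_iff_add_eq_0)
  have obj: "(\<integral>\<theta>. - ((\<Lambda> t \<theta> v* F (traj u \<theta> t) \<theta>) \<bullet> v) \<partial>\<mu>) = \<beta> * (u t \<bullet> v)" for v
  proof -
    have "(\<integral>\<theta>. - (P t \<theta> \<bullet> v) \<partial>\<mu>) = - (p t \<bullet> v)"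
      using P_slice_integrable[OF t] by (simp add: p_def)
    then show ?thesis using \<open>p t = _\<close> by (simp add: P_def)
  qed
  have "\<beta> * (u t \<bullet> v) - \<beta> / 2 * (norm v)\<^sup>2 \<le> \<beta> * (u t \<bullet> u t) - \<beta> / 2 * (norm (u t))\<^sup>2" for v
  proof -
    have "0 \<le> \<beta> / 2 * (norm (u t - v))\<^sup>2" using \<beta>_pos by simp
    also have "\<dots> = (\<beta> * (u t \<bullet> u t) - \<beta> / 2 * (norm (u t))\<^sup>2) - (\<beta> * (u t \<bullet> v) - \<beta> / 2 * (norm v)\<^sup>2)"
      by (simp add: power2_norm_eq_inner inner_diff_left inner_diff_right inner_commute algebra_simps)
    finally show ?thesis by simp
  qed
  then show ?case unfolding is_arg_max_linorder obj by simp
qed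

end

theorem theorem5p3:
  fixes \<Theta> :: "'p::euclidean_space set"
    and F0 :: "real^'n \<Rightarrow> 'p \<Rightarrow> real^'n"
    and F :: "real^'n \<Rightarrow> 'p \<Rightarrow> real^'k^'n"
    and x0 :: "'p \<Rightarrow> real^'n"
    and a :: "real^'n \<Rightarrow> 'p \<Rightarrow> real"
    and L \<beta> :: real
    and \<mu> :: "'p measure"
    and u :: "real \<Rightarrow> real^'k"
    and X \<Lambda> :: "real \<Rightarrow> 'p \<Rightarrow> real^'n"
  assumes "compact \<Theta>"
    and "L > 0"
    and "\<And>x1 x2 \<theta>1 \<theta>2. \<theta>1 \<in> \<Theta> \<Longrightarrow> \<theta>2 \<in> \<Theta> \<Longrightarrow>
           norm (F0 x1 \<theta>1 - F0 x2 \<theta>2) \<le> L * (norm (x1 - x2) + norm (\<theta>1 - \<theta>2))"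
    and "\<And>i x1 x2 \<theta>1 \<theta>2. \<theta>1 \<in> \<Theta> \<Longrightarrow> \<theta>2 \<in> \<Theta> \<Longrightarrow>
           norm (column i (F x1 \<theta>1) - column i (F x2 \<theta>2)) \<le> L * (norm (x1 - x2) + norm (\<theta>1 - \<theta>2))"
    and "continuous_on \<Theta> x0"
    and "continuous_on (UNIV \<times> \<Theta>) (\<lambda>(x, \<theta>). a x \<theta>)"
    and "\<And>x \<theta>. \<theta> \<in> \<Theta> \<Longrightarrow> a x \<theta> \<ge> 0"
    and "\<And>x \<theta>. \<theta> \<in> \<Theta> \<Longrightarrow> (\<lambda>y. a y \<theta>) differentiable (at x)"
    and "\<beta> > 0"
    and "prob_space \<mu>" and "sets \<mu> = sets (restrict_space borel \<Theta>)"
    and "\<And>x \<theta>. \<theta> \<in> \<Theta> \<Longrightarrow> (\<lambda>y. F0 y \<theta>) differentiable (at x)"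
    and "continuous_on (UNIV \<times> \<Theta>) (\<lambda>(x, \<theta>). jacobian (\<lambda>y. F0 y \<theta>) (at x))"
    and "\<And>i x \<theta>. \<theta> \<in> \<Theta> \<Longrightarrow> (\<lambda>y. column i (F y \<theta>)) differentiable (at x)"
    and "\<And>i. continuous_on (UNIV \<times> \<Theta>) (\<lambda>(x, \<theta>). jacobian (\<lambda>y. column i (F y \<theta>)) (at x))"
    and "continuous_on (UNIV \<times> \<Theta>) (\<lambda>(x, \<theta>). gradient (\<lambda>y. a y \<theta>) x)"
    and "L2_local_minimizer (cost F0 F x0 a \<beta> \<mu>) u"
    and X_def: "X = (\<lambda>t \<theta>. trajectory F0 F x0 u \<theta> t)"
    and "\<And>\<theta>. \<theta> \<in> \<Theta> \<Longrightarrow> abs_continuous_on 0 1 (\<lambda>t. \<Lambda> t \<theta>)"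
    and "\<And>\<theta>. \<theta> \<in> \<Theta> \<Longrightarrow>
           AE t in lebesgue_on {0..1}.
             ((\<lambda>s. \<Lambda> s \<theta>) has_vector_derivative
                - (\<Lambda> t \<theta> v* (jacobian (\<lambda>y. F0 y \<theta>) (at (X t \<theta>)) +
                     (\<Sum>i\<in>UNIV. (u t $ i) *\<^sub>R jacobian (\<lambda>y. column i (F y \<theta>)) (at (X t \<theta>))))))
             (at t within {0..1})"
    and "\<And>\<theta>. \<theta> \<in> \<Theta> \<Longrightarrow> \<Lambda> 1 \<theta> = gradient (\<lambda>y. a y \<theta>) (X 1 \<theta>)"
  shows "AE t in lebesgue_on {0..1}.
           is_arg_max
             (\<lambda>v. (\<integral>\<theta>. - ((\<Lambda> t \<theta> v* F (X t \<theta>) \<theta>) \<bullet> v) \<partial>\<mu>) - \<beta> / 2 * (norm v)\<^sup>2)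
             (\<lambda>v. True) (u t)"
proof -
  interpret control_system \<Theta> F0 F x0 L by unfold_locales (fact assms)+
  interpret smooth_control_system \<Theta> F0 F x0 L a by unfold_locales (fact assms)+
  \<comment> \<open>Unfolding identifies \<open>X\<close> and the matrix in the adjoint hypothesis
    with \<open>traj u\<close> and \<open>lin u\<close>; membership of \<open>u\<close> in
    \<open>L2_controls\<close> is part of being a local minimizer.\<close>
  interpret adjoint_system \<Theta> F0 F x0 L a u \<Lambda>
    by unfold_locales
      (use assms in \<open>auto simp: X_def lin_def J0_def J_def L2_local_minimizer_def\<close>)
  interpret optimal_control_problem \<Theta> F0 F x0 L a u \<Lambda> \<beta> \<mu>
    by (intro optimal_control_problem.intro optimal_control_problem_axioms.intro adjoint_system_axioms) (fact assms)+
  show ?thesis unfolding X_def by (rule maximum_condition)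
qed

end
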